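(* Let $p$ be an odd prime, $r,q\ge1$ integers, and $0\le\alpha,\beta\le q$. The canonical commutators $C_cS_sC_c^{-1}S_s^{-1}$ are scalar for every $(c,s)\in A_\alpha\times B_\beta$ if and only if $r+\alpha+\beta\ge q$. On every such scalar window, $\mathbf B(c,s)=\chi(1+p^rcs)$ is a bicharacter of $A_\alpha\times B_\beta$, and $$\operatorname{Rad}_A(\mathbf B)=p^{\max(\alpha,q-\beta)}R_q,\qquad \operatorname{Rad}_B(\mathbf B)=p^{\max(\beta,q-\alpha)}R_q.$$ If $q\le r$, the full window $(\alpha,\beta)=(0,0)$ is scalar. If $q>r$, the inclusion-maximal scalar windows are exactly those with $\alpha+\beta=q-r$, $\alpha,\beta\ge0$, so there are precisely $q-r+1$ of them. On such a maximal window ($q>r$, $\alpha+\beta=q-r$): (i) the radicals are $\operatorname{Rad}_A=p^{\alpha+r}R_q$ and $\operatorname{Rad}_B=p^{\beta+r}R_q$, and the residual groups $\overline A_\alpha=A_\alpha/p^{\alpha+r}R_q$ and $\overline B_\beta=B_\beta/p^{\beta+r}R_q$ are cyclic of order $p^r$; (ii) for $c=p^\alpha x$, $s=p^\beta y$, $$\mathbf B(c,s)=\exp\!\left(\frac{2\pi i\,\kappa xy}{p^r}\right),$$ where $\kappa\in R_q^\times$ is the conductor unit of $\chi$; (iii) hence $\mathbf B$ descends to a perfect pairing $\overline A_\alpha\times\overline B_\beta\to\mu_{p^r}$ which, up to the conductor unit, is the standard pairing $(x,y)\mapsto\exp(2\pi i\,xy/p^r)$ on $(\mathbf Z/p^r\mathbf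 Z)^2$; (iv) the commutator data of this pairing therefore define the standard finite Heisenberg central extension $$1\to\mu_{p^r}\to\mathsf H_{p^r}\to\overline A_\alpha\oplus\overline B_\beta\to1$$ of order $p^{3r}$.
   Context: $\mathbf Z_p$ is the ring of $p$-adic integers, $R_q=\mathbf Z/p^q\mathbf Z$, $\mu_m$ is the group of complex $m$-th roots of unity. $\chi$ is a fixed faithful (injective) character of the cyclic group $(1+p^r\mathbf Z_p)/(1+p^{q+r}\mathbf Z_p)$ of order $p^q$. Let $\ell_{r,q}(z)=p^{-r}\log(1+p^rz)\bmod p^q$ be the normalized $p$-adic logarithm; the conductor unit $\kappa\in R_q^\times$ of $\chi$ is the unit with $\chi(1+p^rz)=\exp(2\pi i\,\kappa\,\ell_{r,q}(z)/p^q)$ for all $z\in\mathbf Z_p$. For $c,s\in R_q$ the canonical torsor operators on functions $f:R_q\to\mathbf C$ are $$(C_cf)(b)=\chi(1+p^rcb)\,f\!\left(\frac{b}{1+p^rcb}\right),\qquad (S_sf)(b)=f(b+s),$$ and the canonical commutator $C_cS_sC_c^{-1}S_s^{-1}$ is scalar if it is a scalar multiple of the identity operator. For $0\le\alpha,\beta\le q$ put $A_\alpha=p^\alpha R_q$, $B_\beta=p^\beta R_q$ (with $p^qR_q=\{0\}$) and $\mathbf B(c,s)=\chi(1+p^rcs)$. The window with exponents $(\alpha,\beta)$ is the rectangle $A_\alpha\times B_\beta$; it is a scalar window if all canonical commutators with $(c,s)$ in it are scalar, and maximality is with respect to inclusion among scalar windows. A bicharacter is a map to $\mathbf C^\times$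 that is a homomorphism in each variable separately. $\operatorname{Rad}_A(\mathbf B)=\{c\in A_\alpha:\mathbf B(c,s)=1\ \forall s\in B_\beta\}$ and $\operatorname{Rad}_B(\mathbf B)=\{s\in B_\beta:\mathbf B(c,s)=1\ \forall c\in A_\alpha\}$. A pairing is perfect if both induced maps to the character group of the other factor are isomorphisms. The standard finite Heisenberg central extension attached to a perfect pairing $\mathbf B:\overline A\times\overline B\to\mu_{p^r}$ is the set $\mu_{p^r}\times\overline A\times\overline B$ with product $(\zeta,x,y)(\zeta',x',y')=(\zeta\zeta'\mathbf B(x,y'),x+x',y+y')$; it is a central extension of $\overline A\oplus\overline B$ by $\mu_{p^r}$ in which the commutator of lifts of $(x,0)$ and $(0,y)$ is $\mathbf B(x,y)$. *)

theory Defs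
  imports
    "HOL-Number_Theory.Number_Theory"
    "HOL-Algebra.Algebra"
    Complex_Main
begin

section \<open>The ring of p-adic integers\<close>

text \<open>
  The inverse limit of the rings Z/p^n: an element is the sequence of its reduced residues, with
  entry \<open>n\<close> in \<open>{0..<p ^ n}\<close>. (Entry 0 is always 0, so also the unit has entry 0 there.)
\<close>

definition Zp :: "nat \<Rightarrow> (nat \<Rightarrow> int) ring" where
  "Zp p = \<lparr>carrier = {x. \<forall>n. x n \<in> {0..<int p ^ n} \<and> x (Suc n) mod int p ^ n = x n},
           monoid.mult = (\<lambda>x y n. (x n * y n) mod int p ^ n),
           monoid.one = (\<lambda>n. 1 mod int p ^ n),
           ring.zero = (\<lambda>n. 0),
           ring.add = (\<lambda>x y n. (x n + y n) mod int p ^ n)\<rparr>"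

definition zp_of_int :: "nat \<Rightarrow> int \<Rightarrow> (nat \<Rightarrow> int)" where
  "zp_of_int p k = (\<lambda>n. k mod int p ^ n)"

text \<open>The quotient \<open>a / k\<close> for \<open>k \<noteq> 0\<close>; meaningful when it lies in the p-adic integers.\<close>

definition zp_quot :: "nat \<Rightarrow> (nat \<Rightarrow> int) \<Rightarrow> int \<Rightarrow> (nat \<Rightarrow> int)" where
  "zp_quot p a k = (THE t. t \<in> carrier (Zp p) \<and> zp_of_int p k \<otimes>\<^bsub>Zp p\<^esub> t = a)"

text \<open>p-adic convergence: modulo each power of \<open>p\<close>, the sequence is eventually equal to its limit.\<close>

definition zp_tendsto :: "nat \<Rightarrow> (nat \<Rightarrow> (nat \<Rightarrow> int)) \<Rightarrow> (nat \<Rightarrow> int) \<Rightarrow> bool" where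
  "zp_tendsto p f L \<longleftrightarrow> L \<in> carrier (Zp p) \<and> (\<forall>k. \<forall>\<^sub>F N in sequentially. f N k = L k)"

text \<open>
  \<open>log (1 + x) = (\<Sum>n\<ge>1. (-1) ^ (n + 1) * x ^ n / n)\<close> for \<open>x\<close> divisible by \<open>p\<close>. All the
  terms of the series are p-adic integers, because \<open>n\<close> divides \<open>x ^ n\<close> when \<open>p\<close> divides \<open>x\<close>.
\<close>

definition zp_log1p :: "nat \<Rightarrow> (nat \<Rightarrow> int) \<Rightarrow> (nat \<Rightarrow> int)" where
  "zp_log1p p x = (THE L. zp_tendsto p
     (\<lambda>N. \<Oplus>\<^bsub>Zp p\<^esub>n\<in>{1..N}. zp_of_int p ((-1) ^ (n + 1)) \<otimes>\<^bsub>Zp p\<^esub> zp_quot p (x [^]\<^bsub>Zp p\<^esub> n) (int n)) L)"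

definition norm_log :: "nat \<Rightarrow> nat \<Rightarrow> nat \<Rightarrow> (nat \<Rightarrow> int) \<Rightarrow> int" where
  "norm_log p r q z =
     zp_quot p (zp_log1p p (zp_of_int p (int p ^ r) \<otimes>\<^bsub>Zp p\<^esub> z)) (int p ^ r) q"


section \<open>Characters of principal units\<close>

definition one_unit :: "nat \<Rightarrow> nat \<Rightarrow> (nat \<Rightarrow> int) \<Rightarrow> (nat \<Rightarrow> int)" where
  "one_unit p r z = \<one>\<^bsub>Zp p\<^esub> \<oplus>\<^bsub>Zp p\<^esub> zp_of_int p (int p ^ r) \<otimes>\<^bsub>Zp p\<^esub> z"

definition unit_grp :: "nat \<Rightarrow> nat \<Rightarrow> (nat \<Rightarrow> int) monoid" where
  "unit_grp p r = \<lparr>carrier = one_unit p r ` carrier (Zp p),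
                   monoid.mult = monoid.mult (Zp p), monoid.one = monoid.one (Zp p)\<rparr>"

definition unit_quot :: "nat \<Rightarrow> nat \<Rightarrow> nat \<Rightarrow> (nat \<Rightarrow> int) set monoid" where
  "unit_quot p r q = unit_grp p r Mod carrier (unit_grp p (q + r))"

definition Cx :: "complex monoid" where
  "Cx = \<lparr>carrier = {z. z \<noteq> 0}, monoid.mult = (*), monoid.one = 1\<rparr>"

definition mu :: "nat \<Rightarrow> complex monoid" where
  "mu m = \<lparr>carrier = {z. z ^ m = 1}, monoid.mult = (*), monoid.one = 1\<rparr>"

definition faithful_character ::
    "nat \<Rightarrow> nat \<Rightarrow> nat \<Rightarrow> ((nat \<Rightarrow> int) set \<Rightarrow> complex) \<Rightarrow> bool" where
  "faithful_character p r q \<psi> \<longleftrightarrow>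
     \<psi> \<in> hom (unit_quot p r q) Cx \<and> inj_on \<psi> (carrier (unit_quot p r q))"

text \<open>
  The value at the class of \<open>1 + p^r z\<close>. (The character is called \<open>\<psi>\<close> because the usual letter is a
  binder in HOL-Analysis.)
\<close>

definition chi_at ::
    "nat \<Rightarrow> nat \<Rightarrow> nat \<Rightarrow> ((nat \<Rightarrow> int) set \<Rightarrow> complex) \<Rightarrow> (nat \<Rightarrow> int) \<Rightarrow> complex" where
  "chi_at p r q \<psi> z = \<psi> (carrier (unit_grp p (q + r)) #>\<^bsub>unit_grp p r\<^esub> one_unit p r z)"

definition expi :: "int \<Rightarrow> nat \<Rightarrow> complex" where
  "expi k m = exp (2 * complex_of_real pi * \<i> * of_int k / of_nat m)"

text \<open>The ring \<open>R\<^sub>q\<close>. Its elements are the integers in \<open>{0..<p ^ q}\<close>.\<close>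

abbreviation R :: "nat \<Rightarrow> nat \<Rightarrow> int ring" where
  "R p q \<equiv> residue_ring (int p ^ q)"

definition is_conductor_unit ::
    "nat \<Rightarrow> nat \<Rightarrow> nat \<Rightarrow> ((nat \<Rightarrow> int) set \<Rightarrow> complex) \<Rightarrow> int \<Rightarrow> bool" where
  "is_conductor_unit p r q \<psi> \<kappa> \<longleftrightarrow> \<kappa> \<in> Units (R p q) \<and>
     (\<forall>z \<in> carrier (Zp p). chi_at p r q \<psi> z = expi (\<kappa> * norm_log p r q z) (p ^ q))"

definition conductor_unit ::
    "nat \<Rightarrow> nat \<Rightarrow> nat \<Rightarrow> ((nat \<Rightarrow> int) set \<Rightarrow> complex) \<Rightarrow> int" where
  "conductor_unit p r q \<psi> = (THE \<kappa>. is_conductor_unit p r q \<psi> \<kappa>)"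


section \<open>Canonical torsor operators\<close>

text \<open>The functions on \<open>R\<^sub>q\<close>, extended by \<open>undefined\<close> outside the carrier.\<close>

definition Fn :: "nat \<Rightarrow> nat \<Rightarrow> (int \<Rightarrow> complex) set" where
  "Fn p q = carrier (R p q) \<rightarrow>\<^sub>E UNIV"

text \<open>The class of \<open>p ^ a\<close> in \<open>R\<^sub>q\<close>\<close>

definition ppow :: "nat \<Rightarrow> nat \<Rightarrow> nat \<Rightarrow> int" where
  "ppow p q a = int p ^ a mod int p ^ q"

text \<open>
  For \<open>c, s\<close> in \<open>R\<^sub>q\<close> the coset of \<open>1 + p^r c s\<close> is computed from integer lifts of \<open>c\<close> and \<open>s\<close>;
  it does not depend on the lifts, because \<open>p^r c s\<close> is determined modulo \<open>p^(q + r)\<close>.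
\<close>

definition pairB ::
    "nat \<Rightarrow> nat \<Rightarrow> nat \<Rightarrow> ((nat \<Rightarrow> int) set \<Rightarrow> complex) \<Rightarrow> int \<Rightarrow> int \<Rightarrow> complex" where
  "pairB p r q \<psi> c s = chi_at p r q \<psi> (zp_of_int p (c * s))"

definition opC ::
    "nat \<Rightarrow> nat \<Rightarrow> nat \<Rightarrow> ((nat \<Rightarrow> int) set \<Rightarrow> complex) \<Rightarrow> int \<Rightarrow> (int \<Rightarrow> complex) \<Rightarrow> (int \<Rightarrow> complex)"
  where
  "opC p r q \<psi> c f = (\<lambda>b \<in> carrier (R p q). chi_at p r q \<psi> (zp_of_int p (c * b)) *
     f (b \<otimes>\<^bsub>R p q\<^esub> inv\<^bsub>R p q\<^esub> (\<one>\<^bsub>R p q\<^esub> \<oplus>\<^bsub>R p q\<^esub> ppow p q r \<otimes>\<^bsub>R p q\<^esub> c \<otimes>\<^bsub>R p q\<^esub> b)))"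

definition opS :: "nat \<Rightarrow> nat \<Rightarrow> int \<Rightarrow> (int \<Rightarrow> complex) \<Rightarrow> (int \<Rightarrow> complex)" where
  "opS p q s f = (\<lambda>b \<in> carrier (R p q). f (b \<oplus>\<^bsub>R p q\<^esub> s))"

definition can_comm ::
    "nat \<Rightarrow> nat \<Rightarrow> nat \<Rightarrow> ((nat \<Rightarrow> int) set \<Rightarrow> complex) \<Rightarrow> int \<Rightarrow> int \<Rightarrow> (int \<Rightarrow> complex) \<Rightarrow> (int \<Rightarrow> complex)"
  where
  "can_comm p r q \<psi> c s =
     opC p r q \<psi> c \<circ> opS p q s \<circ> inv_into (Fn p q) (opC p r q \<psi> c) \<circ> inv_into (Fn p q) (opS p q s)"

definition is_scalar :: "nat \<Rightarrow> nat \<Rightarrow> ((int \<Rightarrow> complex) \<Rightarrow> (int \<Rightarrow> complex)) \<Rightarrow> bool" where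
  "is_scalar p q T \<longleftrightarrow> (\<exists>l::complex. \<forall>f \<in> Fn p q. T f = (\<lambda>b \<in> carrier (R p q). l * f b))"


section \<open>Windows\<close>

text \<open>\<open>p^a R\<^sub>q\<close>; this is both \<open>A\<^sub>a\<close> and \<open>B\<^sub>a\<close>.\<close>

definition pideal :: "nat \<Rightarrow> nat \<Rightarrow> nat \<Rightarrow> int set" where
  "pideal p q a = PIdl\<^bsub>R p q\<^esub> (ppow p q a)"

definition window :: "nat \<Rightarrow> nat \<Rightarrow> nat \<Rightarrow> nat \<Rightarrow> (int \<times> int) set" where
  "window p q a b = pideal p q a \<times> pideal p q b"

definition scalar_window ::
    "nat \<Rightarrow> nat \<Rightarrow> nat \<Rightarrow> ((nat \<Rightarrow> int) set \<Rightarrow> complex) \<Rightarrow> (int \<times> int) set \<Rightarrow> bool" where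
  "scalar_window p r q \<psi> W \<longleftrightarrow> (\<exists>a\<le>q. \<exists>b\<le>q. W = window p q a b) \<and>
     (\<forall>(c, s) \<in> W. is_scalar p q (can_comm p r q \<psi> c s))"

definition maximal_scalar_window ::
    "nat \<Rightarrow> nat \<Rightarrow> nat \<Rightarrow> ((nat \<Rightarrow> int) set \<Rightarrow> complex) \<Rightarrow> (int \<times> int) set \<Rightarrow> bool" where
  "maximal_scalar_window p r q \<psi> W \<longleftrightarrow> scalar_window p r q \<psi> W \<and>
     (\<forall>W'. scalar_window p r q \<psi> W' \<longrightarrow> W \<subseteq> W' \<longrightarrow> W' = W)"

definition RadA ::
    "nat \<Rightarrow> nat \<Rightarrow> nat \<Rightarrow> ((nat \<Rightarrow> int) set \<Rightarrow> complex) \<Rightarrow> nat \<Rightarrow> nat \<Rightarrow> int set" where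
  "RadA p r q \<psi> a b = {c \<in> pideal p q a. \<forall>s \<in> pideal p q b. pairB p r q \<psi> c s = 1}"

definition RadB ::
    "nat \<Rightarrow> nat \<Rightarrow> nat \<Rightarrow> ((nat \<Rightarrow> int) set \<Rightarrow> complex) \<Rightarrow> nat \<Rightarrow> nat \<Rightarrow> int set" where
  "RadB p r q \<psi> a b = {s \<in> pideal p q b. \<forall>c \<in> pideal p q a. pairB p r q \<psi> c s = 1}"

definition pgroup :: "nat \<Rightarrow> nat \<Rightarrow> nat \<Rightarrow> int monoid" where
  "pgroup p q a = \<lparr>carrier = pideal p q a,
                   monoid.mult = ring.add (R p q), monoid.one = ring.zero (R p q)\<rparr>"

text \<open>\<open>p^a R\<^sub>q / p^(a + r) R\<^sub>q\<close>\<close>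

definition resid_grp :: "nat \<Rightarrow> nat \<Rightarrow> nat \<Rightarrow> nat \<Rightarrow> int set monoid" where
  "resid_grp p r q a = pgroup p q a Mod pideal p q (a + r)"

definition resid_class :: "nat \<Rightarrow> nat \<Rightarrow> nat \<Rightarrow> nat \<Rightarrow> int \<Rightarrow> int set" where
  "resid_class p r q a c = pideal p q (a + r) #>\<^bsub>pgroup p q a\<^esub> c"

text \<open>
  The pairing induced on classes: the common value of \<open>B\<close> on all representatives, which is
  meaningful when \<open>B\<close> is constant on products of classes.
\<close>

definition descB ::
    "nat \<Rightarrow> nat \<Rightarrow> nat \<Rightarrow> ((nat \<Rightarrow> int) set \<Rightarrow> complex) \<Rightarrow> int set \<Rightarrow> int set \<Rightarrow> complex" where
  "descB p r q \<psi> K L = the_elem ((\<lambda>(c, s). pairB p r q \<psi> c s) ` (K \<times> L))"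


section \<open>Pairings and Heisenberg extensions\<close>

definition bicharacter ::
    "('a, 'm) monoid_scheme \<Rightarrow> ('b, 'n) monoid_scheme \<Rightarrow> ('a \<Rightarrow> 'b \<Rightarrow> complex) \<Rightarrow> bool" where
  "bicharacter G H b \<longleftrightarrow> (\<forall>x \<in> carrier G. b x \<in> hom H Cx) \<and>
     (\<forall>y \<in> carrier H. (\<lambda>x. b x y) \<in> hom G Cx)"

definition char_grp :: "('a, 'm) monoid_scheme \<Rightarrow> ('a \<Rightarrow> complex) monoid" where
  "char_grp G = \<lparr>carrier = hom G Cx \<inter> extensional (carrier G),
                 monoid.mult = (\<lambda>\<phi> \<psi>. \<lambda>x \<in> carrier G. \<phi> x * \<psi> x),
                 monoid.one = (\<lambda>x \<in> carrier G. 1)\<rparr>"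

definition perfect_pairing ::
    "nat \<Rightarrow> ('a, 'm) monoid_scheme \<Rightarrow> ('b, 'n) monoid_scheme \<Rightarrow> ('a \<Rightarrow> 'b \<Rightarrow> complex) \<Rightarrow> bool" where
  "perfect_pairing m G H b \<longleftrightarrow> bicharacter G H b \<and>
     (\<forall>x \<in> carrier G. \<forall>y \<in> carrier H. b x y \<in> carrier (mu m)) \<and>
     (\<lambda>x. \<lambda>y \<in> carrier H. b x y) \<in> iso G (char_grp H) \<and>
     (\<lambda>y. \<lambda>x \<in> carrier G. b x y) \<in> iso H (char_grp G)"

definition std_pairing :: "nat \<Rightarrow> int \<Rightarrow> int \<Rightarrow> complex" where
  "std_pairing m x y = expi (x * y) m"

definition heisenberg ::
    "nat \<Rightarrow> ('a, 'm) monoid_scheme \<Rightarrow> ('b, 'n) monoid_scheme \<Rightarrow> ('a \<Rightarrow> 'b \<Rightarrow> complex) \<Rightarrow>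
     (complex \<times> 'a \<times> 'b) monoid" where
  "heisenberg m G H b =
     \<lparr>carrier = carrier (mu m) \<times> carrier G \<times> carrier H,
      monoid.mult = (\<lambda>(z, x, y) (z', x', y'). (z * z' * b x y', x \<otimes>\<^bsub>G\<^esub> x', y \<otimes>\<^bsub>H\<^esub> y')),
      monoid.one = (1, \<one>\<^bsub>G\<^esub>, \<one>\<^bsub>H\<^esub>)\<rparr>"

text \<open>\<open>1 \<rightarrow> N \<rightarrow> E \<rightarrow> Q \<rightarrow> 1\<close> is exact, with maps \<open>\<iota>\<close> and \<open>\<pi>\<close>, and \<open>\<iota> N\<close> is central in \<open>E\<close>.\<close>

definition central_extension ::
    "('n, 'i) monoid_scheme \<Rightarrow> ('e, 'j) monoid_scheme \<Rightarrow> ('q, 'k) monoid_scheme \<Rightarrow>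
     ('n \<Rightarrow> 'e) \<Rightarrow> ('e \<Rightarrow> 'q) \<Rightarrow> bool" where
  "central_extension N E Q \<iota> \<pi> \<longleftrightarrow> group N \<and> group E \<and> group Q \<and>
     \<iota> \<in> mon N E \<and> \<pi> \<in> epi E Q \<and> kernel E Q \<pi> = \<iota> ` carrier N \<and>
     (\<forall>n \<in> carrier N. \<forall>e \<in> carrier E. \<iota> n \<otimes>\<^bsub>E\<^esub> e = e \<otimes>\<^bsub>E\<^esub> \<iota> n)"

definition grp_comm :: "('e, 'j) monoid_scheme \<Rightarrow> 'e \<Rightarrow> 'e \<Rightarrow> 'e" where
  "grp_comm E u v = u \<otimes>\<^bsub>E\<^esub> v \<otimes>\<^bsub>E\<^esub> inv\<^bsub>E\<^esub> u \<otimes>\<^bsub>E\<^esub> inv\<^bsub>E\<^esub> v"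

definition heis_incl ::
    "('a, 'm) monoid_scheme \<Rightarrow> ('b, 'n) monoid_scheme \<Rightarrow> complex \<Rightarrow> complex \<times> 'a \<times> 'b" where
  "heis_incl G H z = (z, \<one>\<^bsub>G\<^esub>, \<one>\<^bsub>H\<^esub>)"

end

theory Submission
  imports Defs
begin

text \<open>
  The logarithm is controlled through \<open>log (1 + x) = lim ((1 + x) ^ p ^ n - 1) / p ^ n\<close>. Since
  \<open>(1 + x) ^ p ^ n - 1\<close> is divisible by \<open>p ^ n\<close> with a quotient that is small when \<open>x\<close> is, this gives
  the functional equation and, for odd \<open>p\<close>, that the normalized logarithm modulo \<open>p ^ q\<close> is a
  bijection from the classes of \<open>1 + p ^ r z\<close> onto \<open>R\<^sub>q\<close>. A faithful character is therefore an
  exponential of a unit multiple of this logarithm.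

  The commutator of \<open>C\<^sub>c\<close> and \<open>S\<^sub>s\<close> permutes the points of \<open>R\<^sub>q\<close> up to scalars, and comparing
  \<open>b / (1 + p ^ r c b) + s\<close> with the value at \<open>b + s\<close> shows that it is scalar exactly when
  \<open>p ^ r c s = 0\<close> in \<open>R\<^sub>q\<close>. On a scalar window the cross term in
  \<open>(1 + p ^ r c s) (1 + p ^ r c' s)\<close> vanishes modulo \<open>p ^ (q + r)\<close>, so \<open>B\<close> is a bicharacter, and
  faithfulness turns its radicals into divisibility conditions. On a maximal window the normalized
  logarithm of \<open>p ^ (q - r) x y\<close> is \<open>p ^ (q - r) x y\<close> itself, which makes \<open>B\<close> the standard pairing
  multiplied by the conductor unit.
\<close>

text \<open>The obstacle is precision. The terms \<open>x ^ k / k\<close> have unbounded powers of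
  \<open>p\<close> in their denominators, and the series says nothing directly about products.
  Passing to \<open>(1 + x) ^ p ^ n\<close> turns every statement about the logarithm into an
  integer congruence modulo \<open>P ^ (n + K)\<close>, in which a common factor
  \<open>P ^ n\<close> cancels and leaves exactly \<open>K\<close> digits. Since \<open>n\<close> is
  free, finitely many conditions of the form "for large \<open>n\<close>" can be met at once, and
  after the limit formula is proved no further limit is taken.

  No exponential series is built. Injectivity of the normalized logarithm modulo
  \<open>P ^ q\<close> is proved by exact tracking of digits, surjectivity follows by counting, and
  the conductor unit is read off from the value of the character at an element with logarithm 1.

  The pairing theory is carried out for arbitrary groups with chosen coordinates in Z/m. The p-adic
  part only has to supply the coordinates and the formula for the pairing in them.\<close>

locale padic =
  fixes p :: nat
  assumes p_prime: "normalization_semidom_class.prime p"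
begin

section \<open>Cancellation modulo powers of a prime\<close>

abbreviation P :: int where "P \<equiv> int p"

lemma prime_P: "normalization_semidom_class.prime P"
  using p_prime by simp

lemma P_gt_1: "1 < P" and P_pos: "0 < P" and P_pow_pos: "0 < P ^ n"
  using prime_gt_1_nat[OF p_prime] by auto

lemma P_pow_nonzero: "P ^ n \<noteq> 0"
  using P_pow_pos[of n] by linarith

lemma coprime_P_pow: "coprime a P \<Longrightarrow> coprime a (P ^ n)"
  by simp

lemma coprime_P_iff: "coprime a P \<longleftrightarrow> \<not> P dvd a"
  by (metis prime_P coprime_commute prime_imp_coprime not_coprimeI not_prime_unit dvd_refl)

lemma P_decompose:
  fixes d :: int
  assumes "d \<noteq> 0"
  obtains v m where "d = P ^ v * m" "coprime m P"
proof -
  have "\<not> is_unit P" using P_gt_1 by auto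
  from multiplicity_decompose'[OF assms this]
  obtain y where "d = P ^ multiplicity P d * y" "\<not> P dvd y" by blast
  with that coprime_P_iff show thesis by blast
qed

text \<open>Dividing by a number of valuation \<open>v\<close> costs \<open>v\<close> digits.
  Divisions by multiples of \<open>p\<close> are carried out accordingly: a congruence is first
  proved with \<open>v\<close> digits to spare and then cancelled.\<close>

lemma dvd_cancel_power:
  assumes "P ^ (n + v) dvd (P ^ v * m) * e" "coprime m P"
  shows "P ^ n dvd e"
proof -
  have "P ^ v * P ^ n dvd P ^ v * (m * e)"
    using assms(1) by (simp add: power_add mult_ac)
  hence "P ^ n dvd m * e" using P_pow_nonzero[of v] dvd_mult_cancel_left by blast
  moreover have "coprime (P ^ n) m" using coprime_P_pow[OF assms(2)] by (simp add: coprime_commute)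
  ultimately show ?thesis by (simp add: coprime_dvd_mult_right_iff)
qed

lemma cong_cancel_power:
  assumes "[(P ^ v * m) * a = (P ^ v * m) * b] (mod P ^ (n + v))" "coprime m P"
  shows "[a = b] (mod P ^ n)"
proof -
  have "P ^ (n + v) dvd (P ^ v * m) * (a - b)"
    using assms(1) by (simp add: cong_iff_dvd_diff algebra_simps)
  from dvd_cancel_power[OF this assms(2)] show ?thesis by (simp add: cong_iff_dvd_diff)
qed

lemma cong_cancel_P_power:
  assumes "[P ^ v * a = P ^ v * b] (mod P ^ (n + v))"
  shows "[a = b] (mod P ^ n)"
  using cong_cancel_power[of v 1 a b n] assms by simp

lemma cong_mod_power_le: "[a = b] (mod P ^ n) \<Longrightarrow> m \<le> n \<Longrightarrow> [a = b] (mod P ^ m)"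
  by (meson cong_dvd_modulus le_imp_power_dvd)

lemma mod_power_mod: "m \<le> n \<Longrightarrow> (a mod P ^ n) mod P ^ m = a mod P ^ m"
  by (simp add: le_imp_power_dvd mod_mod_cancel)

lemma cong_mult_P_power_iff: "[P ^ v * a = P ^ v * b] (mod P ^ (n + v)) \<longleftrightarrow> [a = b] (mod P ^ n)"
proof -
  have "[P ^ v * a = P ^ v * b] (mod P ^ (n + v)) \<longleftrightarrow> P ^ v * P ^ n dvd P ^ v * (a - b)"
    by (simp add: cong_iff_dvd_diff power_add algebra_simps)
  also have "\<dots> \<longleftrightarrow> P ^ n dvd a - b" using P_pow_nonzero[of v] dvd_mult_cancel_left by blast
  finally show ?thesis by (simp add: cong_iff_dvd_diff)
qed

lemma one_plus_cong_1: "r \<ge> 1 \<Longrightarrow> [1 + P ^ r * a = 1] (mod P)"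
  by (simp add: cong_iff_dvd_diff dvd_power)

lemma one_plus_cong_iff: "[1 + P ^ r * a = 1 + P ^ r * b] (mod P ^ (q + r)) \<longleftrightarrow> [a = b] (mod P ^ q)"
  using cong_mult_P_power_iff[of r a b q] by (simp add: cong_iff_dvd_diff)

section \<open>Powers of principal units\<close>

text \<open>With \<open>A = 1 + P * a\<close> and \<open>B = 1 + P * b\<close>, the geometric
  cofactor of \<open>A - B\<close> is P + P(a + b)p(p - 1)/2 modulo \<open>P ^ 2\<close>. For odd
  \<open>p\<close> the number p(p - 1)/2 is itself a multiple of \<open>p\<close>, so the cofactor
  is \<open>P\<close> times a unit. For \<open>p = 2\<close> this fails:
  \<open>3 ^ 2 - 1 ^ 2 = 8\<close>. Allowing \<open>B\<close> to differ from 1 is what later yields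
  injectivity of the logarithm.\<close>

lemma prime_power_diff_step:
  assumes "odd p" "[A = 1] (mod P)" "[B = 1] (mod P)"
  shows "\<exists>u. coprime u P \<and> A ^ p - B ^ p = (A - B) * (P * u)"
proof -
  obtain a where a: "A = 1 + P * a"
    using assms(2) by (metis cong_iff_lin cong_sym mult.commute)
  obtain b where b: "B = 1 + P * b"
    using assms(3) by (metis cong_iff_lin cong_sym mult.commute)
  have pw: "\<exists>k. (1 + P * c) ^ n = 1 + P * (int n * c) + P ^ 2 * k" for c n
  proof (induction n)
    case 0 show ?case by (rule exI[of _ 0]) simp
  next
    case (Suc n)
    then obtain k where k: "(1 + P * c) ^ n = 1 + P * (int n * c) + P ^ 2 * k" by blast
    show ?case
      by (rule exI[of _ "int n * c * c + k + P * k * c"])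
         (simp add: k[unfolded mult.assoc] power_Suc2 del: power_Suc, simp add: algebra_simps power2_eq_square)
  qed
  have tm: "[B ^ (p - Suc i) * A ^ i = 1 + P * (int i * a + int (p - Suc i) * b)] (mod P ^ 2)" for i
  proof -
    obtain k where k: "A ^ i = 1 + P * (int i * a) + P ^ 2 * k" using pw a by blast
    obtain l where l: "B ^ (p - Suc i) = 1 + P * (int (p - Suc i) * b) + P ^ 2 * l" using pw b by blast
    have "[A ^ i = 1 + P * (int i * a)] (mod P ^ 2)" "[B ^ (p - Suc i) = 1 + P * (int (p - Suc i) * b)] (mod P ^ 2)"
      unfolding k l by (simp_all add: cong_iff_dvd_diff)
    from cong_mult[OF this(2,1)]
    have "[B ^ (p - Suc i) * A ^ i = (1 + P * (int (p - Suc i) * b)) * (1 + P * (int i * a))] (mod P ^ 2)" .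
    also have "[(1 + P * (int (p - Suc i) * b)) * (1 + P * (int i * a)) =
       1 + P * (int i * a + int (p - Suc i) * b)] (mod P ^ 2)"
      by (simp add: cong_iff_dvd_diff algebra_simps power2_eq_square)
    finally show ?thesis .
  qed
  obtain h where h: "p = 2 * h + 1" using assms(1) by (elim oddE)
  define S where "S = (\<Sum>i<p. B ^ (p - Suc i) * A ^ i)"
  have "[S = (\<Sum>i<p. 1 + P * (int i * a + int (p - Suc i) * b))] (mod P ^ 2)"
    unfolding S_def by (rule cong_sum) (rule tm)
  also have "(\<Sum>i<p. 1 + P * (int i * a + int (p - Suc i) * b)) =
      P + P * ((\<Sum>i<p. int i) * a + (\<Sum>i<p. int (p - Suc i)) * b)"
    by (simp only: sum.distrib sum_distrib_left sum_distrib_right distrib_left distrib_right mult.assoc) simp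
  also have "(\<Sum>i<p. int (p - Suc i)) = (\<Sum>i<p. int i)"
    using sum.nat_diff_reindex[of int p] by simp
  also have "(\<Sum>i<p. int i) = P * int h"
  proof -
    have "2 * (\<Sum>i<n. int i) = int n * (int n - 1)" for n
      by (induction n) (auto simp: algebra_simps)
    from this[of p] show ?thesis using h by (simp add: algebra_simps)
  qed
  finally have "[S = P + P * (P * int h * a + P * int h * b)] (mod P ^ 2)" .
  moreover have "[P + P * (P * int h * a + P * int h * b) = P] (mod P ^ 2)"
    by (simp add: cong_iff_dvd_diff algebra_simps power2_eq_square)
  ultimately have "[S = P] (mod P ^ 2)" by (rule cong_trans)
  then obtain k where "S = P + P ^ 2 * k" by (metis cong_iff_lin cong_sym mult.commute)
  hence S: "S = P * (1 + P * k)" by (simp add: algebra_simps power2_eq_square)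
  have "coprime (1 + P * k) P"
    unfolding coprime_P_iff using P_gt_1
    by (metis dvd_add_times_triv_right_iff mult.commute not_prime_unit prime_P)
  moreover have "A ^ p - B ^ p = (A - B) * S"
    unfolding S_def by (subst power_diff_sumr2) (simp add: mult.commute)
  ultimately show ?thesis using S by (auto simp: mult_ac)
qed

lemma prime_power_diff:
  assumes "odd p" "[A = 1] (mod P)" "[B = 1] (mod P)"
  shows "\<exists>u. coprime u P \<and> A ^ (p ^ n) - B ^ (p ^ n) = (P ^ n * u) * (A - B)"
proof (induction n)
  case 0 show ?case by (rule exI[of _ 1]) simp
next
  case (Suc n)
  then obtain u where u: "coprime u P" "A ^ (p ^ n) - B ^ (p ^ n) = (P ^ n * u) * (A - B)" by blast
  have "[A ^ (p ^ n) = 1] (mod P)" "[B ^ (p ^ n) = 1] (mod P)"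
    using cong_pow[OF assms(2), of "p ^ n"] cong_pow[OF assms(3), of "p ^ n"] by simp_all
  from prime_power_diff_step[OF assms(1) this] obtain w where w: "coprime w P"
    "(A ^ (p ^ n)) ^ p - (B ^ (p ^ n)) ^ p = (A ^ (p ^ n) - B ^ (p ^ n)) * (P * w)" by blast
  have "A ^ (p ^ Suc n) - B ^ (p ^ Suc n) = (P ^ Suc n * (u * w)) * (A - B)"
    using w(2) unfolding u(2) power_mult[symmetric] by (simp add: mult_ac)
  moreover have "coprime (u * w) P" using u(1) w(1) by simp
  ultimately show ?case by blast
qed

text \<open>Powers with exponent \<open>p ^ n\<close> shift the precision by exactly
  \<open>n\<close>. From left to right this makes the logarithm injective; from right to left it
  makes the limit formula independent of the chosen lift.\<close>

lemma prime_power_cong_iff: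
  assumes "odd p" "[A = 1] (mod P)" "[B = 1] (mod P)"
  shows "[A ^ (p ^ n) = B ^ (p ^ n)] (mod P ^ (j + n)) \<longleftrightarrow> [A = B] (mod P ^ j)"
proof -
  obtain u where u: "coprime u P" "A ^ (p ^ n) - B ^ (p ^ n) = (P ^ n * u) * (A - B)"
    using prime_power_diff[OF assms] by blast
  show ?thesis
    using dvd_cancel_power[of j n u "A - B"] u
    by (auto simp: cong_iff_dvd_diff power_add mult_ac mult_dvd_mono)
qed

text \<open>Here the linear term is kept, and the error has twice the depth \<open>m\<close>; this
  evaluates the logarithm near 1. In the induction the error stays inside the parameter, as
  \<open>w + P ^ m * k\<close>, so that each \<open>p\<close>-th power only raises the outer
  exponent by one.\<close>

lemma one_plus_prime_power:
  assumes "odd p" "m \<ge> 1"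
  shows "[(1 + P ^ m * w) ^ (p ^ n) = 1 + P ^ (n + m) * w] (mod P ^ (n + 2 * m))"
proof -
  have p3: "p \<ge> 3" using assms(1) prime_gt_1_nat[OF p_prime] by (cases "p = 2") auto
  have step: "\<exists>k. (1 + P ^ j * y) ^ p = 1 + P ^ (j + 1) * y + P ^ (2 * j + 1) * k" if "j \<ge> 1" for j y
  proof -
    obtain d where d: "p = 3 + d" using p3 le_Suc_ex by blast
    have "(1 + P ^ j * y) ^ p = (\<Sum>k\<le>p. of_nat (p choose k) * (P ^ j * y) ^ k)"
      using binomial_ring[of "P ^ j * y" 1 p] by (simp add: add.commute)
    also have "{..p} = {0, 1} \<union> {2..p}" using p3 by auto
    also have "(\<Sum>k\<in>{0, 1} \<union> {2..p}. of_nat (p choose k) * (P ^ j * y) ^ k)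
        = 1 + P ^ (j + 1) * y + (\<Sum>k\<in>{2..p}. of_nat (p choose k) * (P ^ j * y) ^ k)"
      by (subst sum.union_disjoint) auto
    finally have e: "(1 + P ^ j * y) ^ p =
      1 + P ^ (j + 1) * y + (\<Sum>k\<in>{2..p}. of_nat (p choose k) * (P ^ j * y) ^ k)" .
    have "P ^ (2 * j + 1) dvd (\<Sum>k\<in>{2..p}. of_nat (p choose k) * (P ^ j * y) ^ k)"
    proof (rule dvd_sum)
      fix k assume k: "k \<in> {2..p}"
      show "P ^ (2 * j + 1) dvd of_nat (p choose k) * (P ^ j * y) ^ k"
      proof (cases "k = p")
        case True
        \<comment> \<open>The top binomial coefficient is 1 and supplies no factor \<open>p\<close>,
          so the exponent of \<open>P ^ j\<close> must provide the extra digit; this is where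
          \<open>p\<close> has to be at least 3.\<close>
        have "2 * j + 1 \<le> j * p" using that p3 mult_le_mono2[OF p3, of j] by linarith
        hence "P ^ (2 * j + 1) dvd (P ^ j) ^ p"
          by (simp only: power_mult[symmetric] le_imp_power_dvd)
        thus ?thesis using True by (simp add: power_mult_distrib)
      next
        case False
        hence "p dvd (p choose k)" using k by (intro dvd_choose_prime p_prime) auto
        hence "P dvd of_nat (p choose k)" using of_nat_dvd_iff by blast
        moreover have "j * 2 \<le> j * k" using k by simp
        hence "P ^ (j * 2) dvd (P ^ j) ^ k" by (simp only: power_mult[symmetric] le_imp_power_dvd)
        hence "P ^ (2 * j) dvd (P ^ j * y) ^ k" by (simp add: power_mult_distrib mult.commute)
        ultimately have "P * P ^ (2 * j) dvd of_nat (p choose k) * (P ^ j * y) ^ k" by (rule mult_dvd_mono)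
        thus ?thesis by simp
      qed
    qed
    then obtain k where "(\<Sum>k\<in>{2..p}. of_nat (p choose k) * (P ^ j * y) ^ k) = P ^ (2 * j + 1) * k" ..
    with e show ?thesis by auto
  qed
  have "\<exists>k. (1 + P ^ m * w) ^ (p ^ n) = 1 + P ^ (n + m) * (w + P ^ m * k)"
  proof (induction n)
    case 0 show ?case by (rule exI[of _ 0]) simp
  next
    case (Suc n)
    then obtain k where k: "(1 + P ^ m * w) ^ (p ^ n) = 1 + P ^ (n + m) * (w + P ^ m * k)" by blast
    have nm: "n + m \<ge> 1" using assms(2) by simp
    obtain l where l: "(1 + P ^ (n + m) * (w + P ^ m * k)) ^ p =
        1 + P ^ (n + m + 1) * (w + P ^ m * k) + P ^ (2 * (n + m) + 1) * l" using step[OF nm] by blast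
    have "2 * (n + m) + 1 = (Suc n + m) + (n + m)" by simp
    hence e: "P ^ (2 * (n + m) + 1) = P ^ (Suc n + m) * (P ^ m * P ^ n)"
      by (simp only: power_add mult_ac)
    have "(1 + P ^ m * w) ^ (p ^ Suc n) = ((1 + P ^ m * w) ^ (p ^ n)) ^ p"
      by (simp only: power_Suc2 power_mult)
    also have "\<dots> = 1 + P ^ (Suc n + m) * (w + P ^ m * (k + P ^ n * l))"
      unfolding k l e by (simp add: algebra_simps)
    finally show ?case by blast
  qed
  then obtain k where "(1 + P ^ m * w) ^ (p ^ n) = 1 + P ^ (n + m) * (w + P ^ m * k)" by blast
  moreover have "n + 2 * m = (n + m) + m" by simp
  hence "P ^ (n + 2 * m) = P ^ (n + m) * P ^ m" by (simp only: power_add)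
  ultimately show ?thesis
    by (simp add: cong_iff_dvd_diff algebra_simps)
qed

text \<open>The numerator (M - 1)(M - 2)...(M - j) of the binomial coefficient is congruent to
  (-1)^j j! modulo M. The factorial stays on both sides because it need not be invertible modulo
  \<open>N\<close>.\<close>

lemma fact_binomial_cong:
  fixes N :: int
  assumes "j < M" "N = int M"
  shows "[fact j * int ((M - 1) choose j) = fact j * (-1) ^ j] (mod N)"
  using assms(1)
proof (induction j)
  case 0 show ?case by simp
next
  case (Suc j)
  hence IH: "[fact j * int ((M - 1) choose j) = fact j * (-1) ^ j] (mod N)" by simp
  have "Suc j * ((M - 1) choose Suc j) = ((M - 1) - j) * ((M - 1) choose j)"
    by (metis binomial_absorption binomial_absorb_comp)
  hence "int (Suc j) * int ((M - 1) choose Suc j) = int (M - 1 - j) * int ((M - 1) choose j)"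
    by (metis of_nat_mult)
  moreover have "int (M - 1 - j) = N - 1 - int j" using Suc.prems assms(2) by auto
  ultimately have "int (Suc j) * int ((M - 1) choose Suc j) = (N - 1 - int j) * int ((M - 1) choose j)"
    by simp
  hence "fact (Suc j) * int ((M - 1) choose Suc j) = (N - 1 - int j) * (fact j * int ((M - 1) choose j))"
    by (simp add: mult_ac)
  also have "[\<dots> = (- 1 - int j) * (fact j * (-1) ^ j)] (mod N)"
    by (rule cong_mult[OF _ IH]) (simp add: cong_iff_dvd_diff)
  also have "(- 1 - int j) * (fact j * (-1) ^ j) = fact (Suc j) * (-1) ^ Suc j"
    by (simp add: algebra_simps)
  finally show ?case .
qed

section \<open>Coordinates of p-adic integers\<close>

lemma Zp_carrier_iff:
  "x \<in> carrier (Zp p) \<longleftrightarrow> (\<forall>n. 0 \<le> x n \<and> x n < P ^ n \<and> x (Suc n) mod P ^ n = x n)"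
  by (auto simp: Zp_def)

lemma Zp_mod:
  assumes "x \<in> carrier (Zp p)" "m \<le> n"
  shows "x n mod P ^ m = x m"
  using assms(2)
proof (induction n rule: dec_induct)
  case base
  show ?case using assms(1) by (simp add: Zp_carrier_iff)
next
  case (step n)
  have "x (Suc n) mod P ^ m = (x (Suc n) mod P ^ n) mod P ^ m"
    using step.hyps(1) by (simp add: mod_power_mod)
  thus ?case using step.IH assms(1) by (simp add: Zp_carrier_iff)
qed

lemma Zp_cong: "x \<in> carrier (Zp p) \<Longrightarrow> m \<le> n \<Longrightarrow> [x n = x m] (mod P ^ m)"
  using Zp_mod[of x m n] Zp_mod[of x m m] by (simp add: cong_def)

lemma Zp_bounds: "x \<in> carrier (Zp p) \<Longrightarrow> 0 \<le> x n \<and> x n < P ^ n"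
  by (simp add: Zp_carrier_iff)

lemma Zp_eqI_cong:
  assumes "x \<in> carrier (Zp p)" "y \<in> carrier (Zp p)" "\<And>n. [x n = y n] (mod P ^ n)"
  shows "x = y"
proof
  fix n
  show "x n = y n"
    using assms(3)[of n] Zp_mod[OF assms(1), of n n] Zp_mod[OF assms(2), of n n] by (simp add: cong_def)
qed

text \<open>Negatives, inverses and quotients are built from unreduced representatives;
  compatibility of neighbouring entries is then all that has to be checked.\<close>

lemma Zp_limI:
  assumes "\<And>n. [F (Suc n) = F n] (mod P ^ n)"
  shows "(\<lambda>n. F n mod P ^ n) \<in> carrier (Zp p)"
  unfolding Zp_carrier_iff
  using assms P_pow_pos mod_power_mod[OF le_SucI[OF order_refl]] by (auto simp: cong_def simp del: power_Suc)

lemma zp_of_int_nth: "zp_of_int p k n = k mod P ^ n"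
  by (simp add: zp_of_int_def)

lemma zp_of_int_closed [simp]: "zp_of_int p k \<in> carrier (Zp p)"
  unfolding zp_of_int_def by (rule Zp_limI) simp

lemma Zp_mult_nth: "(x \<otimes>\<^bsub>Zp p\<^esub> y) n = (x n * y n) mod P ^ n"
  and Zp_add_nth: "(x \<oplus>\<^bsub>Zp p\<^esub> y) n = (x n + y n) mod P ^ n"
  and Zp_one_nth: "\<one>\<^bsub>Zp p\<^esub> n = 1 mod P ^ n"
  and Zp_zero_nth: "\<zero>\<^bsub>Zp p\<^esub> n = 0"
  by (simp_all add: Zp_def)

lemmas Zp_nth = Zp_mult_nth Zp_add_nth Zp_one_nth Zp_zero_nth

lemma Zp_closed:
  assumes "x \<in> carrier (Zp p)" "y \<in> carrier (Zp p)"
  shows "x \<otimes>\<^bsub>Zp p\<^esub> y \<in> carrier (Zp p)" "x \<oplus>\<^bsub>Zp p\<^esub> y \<in> carrier (Zp p)"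
proof -
  note c = Zp_cong[OF assms(1) le_SucI[OF order_refl]] Zp_cong[OF assms(2) le_SucI[OF order_refl]]
  show "x \<otimes>\<^bsub>Zp p\<^esub> y \<in> carrier (Zp p)"
    using Zp_limI[of "\<lambda>n. x n * y n"] c by (simp add: Zp_def cong_mult)
  show "x \<oplus>\<^bsub>Zp p\<^esub> y \<in> carrier (Zp p)"
    using Zp_limI[of "\<lambda>n. x n + y n"] c by (simp add: Zp_def cong_add)
qed

lemma Zp_const_closed: "\<one>\<^bsub>Zp p\<^esub> \<in> carrier (Zp p)" "\<zero>\<^bsub>Zp p\<^esub> \<in> carrier (Zp p)"
  using Zp_limI[of "\<lambda>n. 1"] Zp_limI[of "\<lambda>n. 0"] by (simp_all add: Zp_def)

lemma Zp_cring: "cring (Zp p)"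
proof (rule cringI)
  show "abelian_group (Zp p)"
  proof (rule abelian_groupI)
    fix x assume x: "x \<in> carrier (Zp p)"
    have "(\<lambda>n. (- x n) mod P ^ n) \<in> carrier (Zp p)"
      by (rule Zp_limI) (use Zp_cong[OF x le_SucI[OF order_refl]] in \<open>simp add: cong_minus_minus_iff\<close>)
    moreover have "(\<lambda>n. (- x n) mod P ^ n) \<oplus>\<^bsub>Zp p\<^esub> x = \<zero>\<^bsub>Zp p\<^esub>"
      by (rule ext) (simp add: Zp_nth mod_simps)
    ultimately show "\<exists>y\<in>carrier (Zp p). y \<oplus>\<^bsub>Zp p\<^esub> x = \<zero>\<^bsub>Zp p\<^esub>" by blast
    show "\<zero>\<^bsub>Zp p\<^esub> \<oplus>\<^bsub>Zp p\<^esub> x = x"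
      by (rule ext) (use Zp_bounds[OF x] in \<open>simp add: Zp_nth\<close>)
  qed (auto simp: Zp_closed Zp_const_closed Zp_nth fun_eq_iff mod_simps add_ac)
  show "Group.comm_monoid (Zp p)"
  proof (rule comm_monoidI)
    fix x assume x: "x \<in> carrier (Zp p)"
    show "\<one>\<^bsub>Zp p\<^esub> \<otimes>\<^bsub>Zp p\<^esub> x = x"
      by (rule ext) (use Zp_bounds[OF x] in \<open>simp add: Zp_nth mod_simps\<close>)
  qed (auto simp: Zp_closed Zp_const_closed Zp_nth fun_eq_iff mod_simps mult_ac)
qed (auto simp: Zp_nth fun_eq_iff mod_simps algebra_simps)

sublocale Zp: cring "Zp p"
  by (rule Zp_cring)

lemma Zp_pow_nth: "(x [^]\<^bsub>Zp p\<^esub> (k::nat)) n = x n ^ k mod P ^ n"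
  by (induction k) (simp_all add: Zp_nth mod_simps mult_ac)

lemma Zp_finsum_nth:
  assumes "finite A" "f \<in> A \<rightarrow> carrier (Zp p)"
  shows "(\<Oplus>\<^bsub>Zp p\<^esub>i\<in>A. f i) n = (\<Sum>i\<in>A. f i n) mod P ^ n"
  using assms
  by (induction A rule: finite_induct) (auto simp: Zp_nth Zp.finsum_insert mod_simps Pi_iff)

lemma Zp_of_int_mult_eq_iff:
  assumes "t \<in> carrier (Zp p)" "a \<in> carrier (Zp p)"
  shows "zp_of_int p k \<otimes>\<^bsub>Zp p\<^esub> t = a \<longleftrightarrow> (\<forall>n. [k * t n = a n] (mod P ^ n))"
  using Zp_mod[OF assms(2) order_refl]
  by (auto simp: fun_eq_iff Zp_nth zp_of_int_def cong_def mod_simps)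

text \<open>Inverses are chosen independently modulo each \<open>P ^ n\<close>; their uniqueness
  modulo \<open>P ^ n\<close> makes the choices compatible.\<close>

lemma Zp_inverse:
  assumes x: "x \<in> carrier (Zp p)" and cop: "coprime (x 1) P"
  shows "\<exists>y\<in>carrier (Zp p). x \<otimes>\<^bsub>Zp p\<^esub> y = \<one>\<^bsub>Zp p\<^esub>"
proof -
  have cop': "coprime (x n) (P ^ n)" for n
  proof (cases "n = 0")
    case False
    hence "[x n = x 1] (mod P ^ 1)" by (intro Zp_cong[OF x]) simp
    hence "coprime (x n) P" using cop by (metis cong_imp_coprime cong_sym power_one_right)
    thus ?thesis by simp
  qed simp
  hence "\<exists>y. [x n * y = 1] (mod P ^ n)" for n by (simp add: cong_solve_coprime_int)
  then obtain F where F: "\<And>n. [x n * F n = 1] (mod P ^ n)" by metis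
  have "[F (Suc n) = F n] (mod P ^ n)" for n
  proof -
    have "[x n * F (Suc n) = x (Suc n) * F (Suc n)] (mod P ^ n)"
      by (rule cong_mult[OF cong_sym[OF Zp_cong[OF x le_SucI[OF order_refl]]] cong_refl])
    also have "[x (Suc n) * F (Suc n) = 1] (mod P ^ n)"
      by (rule cong_mod_power_le[OF F[of "Suc n"]]) simp
    also have "[1 = x n * F n] (mod P ^ n)" using F[of n] by (rule cong_sym)
    finally show ?thesis using cop'[of n] by (simp add: cong_mult_lcancel)
  qed
  hence "(\<lambda>n. F n mod P ^ n) \<in> carrier (Zp p)" by (rule Zp_limI)
  moreover have "x \<otimes>\<^bsub>Zp p\<^esub> (\<lambda>n. F n mod P ^ n) = \<one>\<^bsub>Zp p\<^esub>"
    by (rule ext) (use F in \<open>simp add: Zp_nth mod_simps cong_def\<close>)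
  ultimately show ?thesis by blast
qed

text \<open>Entry \<open>n\<close> of the quotient is computed from entry \<open>n + v\<close> of
  \<open>a\<close>, since division by \<open>P ^ v\<close> loses \<open>v\<close> digits.
  Uniqueness, needed for the definite description, is the same loss read backwards: two quotients
  are compared at \<open>n + v\<close> to agree at \<open>n\<close>.\<close>

lemma zp_quot:
  assumes a: "a \<in> carrier (Zp p)" and k: "k = P ^ v * m" "coprime m P" and av: "a v = 0"
  shows "zp_quot p a k \<in> carrier (Zp p)" "[k * zp_quot p a k n = a n] (mod P ^ n)"
proof -
  have "\<exists>e. [m * e = 1] (mod P ^ (n + v))" for n
    using coprime_P_pow[OF k(2)] by (rule cong_solve_coprime_int)
  then obtain e where e: "\<And>n. [m * e n = 1] (mod P ^ (n + v))" by metis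
  define G where "G n = e n * (a (n + v) div P ^ v)" for n
  have kG: "[k * G n = a (n + v)] (mod P ^ (n + v))" for n
  proof -
    have "a (n + v) mod P ^ v = 0" using Zp_mod[OF a, of v "n + v"] av by simp
    hence "P ^ v * (a (n + v) div P ^ v) = a (n + v)" by (metis add.right_neutral mult_div_mod_eq)
    hence "k * G n = (m * e n) * a (n + v)" unfolding G_def k(1) by (metis mult.assoc mult.left_commute)
    also have "[\<dots> = 1 * a (n + v)] (mod P ^ (n + v))" by (rule cong_mult[OF e cong_refl])
    finally show ?thesis by simp
  qed
  have "[G (Suc n) = G n] (mod P ^ n)" for n
  proof (rule cong_cancel_power[OF _ k(2)])
    have "[k * G (Suc n) = a (Suc n + v)] (mod P ^ (n + v))"
      by (rule cong_mod_power_le[OF kG]) simp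
    also have "[a (Suc n + v) = a (n + v)] (mod P ^ (n + v))" by (rule Zp_cong[OF a]) simp
    also have "[a (n + v) = k * G n] (mod P ^ (n + v))" by (rule cong_sym[OF kG])
    finally show "[P ^ v * m * G (Suc n) = P ^ v * m * G n] (mod P ^ (n + v))" unfolding k(1) .
  qed
  hence t: "(\<lambda>n. G n mod P ^ n) \<in> carrier (Zp p)" by (rule Zp_limI)
  define t where "t = (\<lambda>n. G n mod P ^ n)"
  note t = t[folded t_def]
  have kt: "[k * t n = a n] (mod P ^ n)" for n
  proof -
    have "[k * t n = k * G n] (mod P ^ n)" by (simp add: t_def cong_def mod_simps)
    also have "[k * G n = a (n + v)] (mod P ^ n)" by (rule cong_mod_power_le[OF kG]) simp
    also have "[a (n + v) = a n] (mod P ^ n)" by (rule Zp_cong[OF a]) simp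
    finally show ?thesis .
  qed
  have "zp_quot p a k = t"
    unfolding zp_quot_def
  proof (rule the_equality)
    show "t \<in> carrier (Zp p) \<and> zp_of_int p k \<otimes>\<^bsub>Zp p\<^esub> t = a"
      using t kt by (simp add: Zp_of_int_mult_eq_iff[OF t a])
  next
    fix s assume "s \<in> carrier (Zp p) \<and> zp_of_int p k \<otimes>\<^bsub>Zp p\<^esub> s = a"
    hence s: "s \<in> carrier (Zp p)" and ks: "\<And>n. [k * s n = a n] (mod P ^ n)"
      using Zp_of_int_mult_eq_iff[OF _ a] by auto
    show "s = t"
    proof (rule Zp_eqI_cong[OF s t])
      fix n
      have "[k * s (n + v) = k * t (n + v)] (mod P ^ (n + v))"
        using ks kt cong_trans cong_sym by blast
      hence "[s (n + v) = t (n + v)] (mod P ^ n)" unfolding k(1) by (rule cong_cancel_power) (rule k(2))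
      moreover have "[s (n + v) = s n] (mod P ^ n)" "[t (n + v) = t n] (mod P ^ n)"
        by (rule Zp_cong[OF s], simp, rule Zp_cong[OF t], simp)
      ultimately show "[s n = t n] (mod P ^ n)" using cong_trans cong_sym by blast
    qed
  qed
  thus "zp_quot p a k \<in> carrier (Zp p)" "[k * zp_quot p a k n = a n] (mod P ^ n)" using t kt by auto
qed

section \<open>The p-adic logarithm\<close>

definition log_term :: "(nat \<Rightarrow> int) \<Rightarrow> nat \<Rightarrow> (nat \<Rightarrow> int)" where
  "log_term x k = zp_quot p (x [^]\<^bsub>Zp p\<^esub> k) (int k)"

text \<open>Crude but sufficient: \<open>2 * v \<le> 2 ^ v \<le> p ^ v \<le> k\<close>. As
  \<open>p ^ k\<close> divides \<open>x ^ k\<close>, the term \<open>x ^ k / k\<close> keeps at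
  least half of its \<open>k\<close> factors \<open>p\<close>, which is the origin of the truncation
  index \<open>2 * K\<close> below.\<close>

lemma valuation_bound:
  assumes "k \<ge> 1" "int k = P ^ v * m"
  shows "2 * v \<le> k"
proof -
  have "2 * v \<le> (2::nat) ^ v"
  proof (cases v)
    case (Suc w)
    have "w < (2::nat) ^ w" by (rule less_exp)
    thus ?thesis unfolding Suc power_Suc by (intro mult_le_mono2 Suc_leI)
  qed simp
  also have "(2::nat) ^ v \<le> p ^ v" using prime_ge_2_nat[OF p_prime] by (rule power_mono) simp
  also have "p ^ v dvd k" using assms(2) by (metis dvd_triv_left of_nat_dvd_iff of_nat_power)
  hence "p ^ v \<le> k" using assms(1) by (intro dvd_imp_le) auto
  finally show ?thesis .
qed

lemma log_term:
  assumes x: "x \<in> carrier (Zp p)" "x 1 = 0" and k: "k \<ge> 1"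
  shows "log_term x k \<in> carrier (Zp p)" "[int k * log_term x k n = x n ^ k] (mod P ^ n)"
proof -
  have "int k \<noteq> 0" using k by simp
  then obtain v m where vm: "int k = P ^ v * m" "coprime m P" by (rule P_decompose)
  have xk: "x [^]\<^bsub>Zp p\<^esub> k \<in> carrier (Zp p)" using x by simp
  have "P ^ v dvd x v ^ k"
  proof (cases "v = 0")
    case False
    hence "x v mod P ^ 1 = x 1" by (intro Zp_mod[OF x(1)]) simp
    hence "P dvd x v" using x(2) by auto
    hence "P ^ k dvd x v ^ k" by (rule dvd_power_same)
    moreover have "v \<le> k" using valuation_bound[OF k vm(1)] by simp
    ultimately show ?thesis using le_imp_power_dvd dvd_trans by blast
  qed simp
  hence "(x [^]\<^bsub>Zp p\<^esub> k) v = 0" by (simp add: Zp_pow_nth)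
  note q = zp_quot[OF xk vm this, folded log_term_def]
  show "log_term x k \<in> carrier (Zp p)" by (rule q)
  show "[int k * log_term x k n = x n ^ k] (mod P ^ n)"
    using q(2)[of n] by (simp add: Zp_pow_nth cong_def)
qed

lemma log_term_eq_0:
  assumes x: "x \<in> carrier (Zp p)" "x r = 0" "r \<ge> 1" and k: "k \<ge> 1"
    and vm: "int k = P ^ v * m" "coprime m P" and le: "j + v \<le> r * k"
  shows "log_term x k j = 0"
proof -
  have x1: "x 1 = 0" using Zp_mod[OF x(1), of 1 r] x by simp
  note t = log_term[OF x(1) x1 k]
  define n where "n = j + v + r"
  have "x n mod P ^ r = x r" by (rule Zp_mod[OF x(1)]) (simp add: n_def)
  hence "P ^ r dvd x n" using x(2) by auto
  hence "(P ^ r) ^ k dvd x n ^ k" by (rule dvd_power_same)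
  hence "P ^ (r * k) dvd x n ^ k" by (simp only: power_mult)
  hence "P ^ (j + v) dvd x n ^ k" using le le_imp_power_dvd dvd_trans by blast
  moreover have "[int k * log_term x k n = x n ^ k] (mod P ^ (j + v))"
    by (rule cong_mod_power_le[OF t(2)]) (simp add: n_def)
  ultimately have "P ^ (j + v) dvd (P ^ v * m) * log_term x k n"
    unfolding vm(1) by (simp add: cong_dvd_iff)
  hence "P ^ j dvd log_term x k n" by (rule dvd_cancel_power) (rule vm(2))
  moreover have "log_term x k n mod P ^ j = log_term x k j" by (rule Zp_mod[OF t(1)]) (simp add: n_def)
  ultimately show ?thesis by auto
qed

lemma log_term_tail:
  assumes x: "x \<in> carrier (Zp p)" "x 1 = 0" and k: "k \<ge> 1" "k \<ge> 2 * j"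
  shows "log_term x k j = 0"
proof -
  have "int k \<noteq> 0" using k by simp
  then obtain v m where vm: "int k = P ^ v * m" "coprime m P" by (rule P_decompose)
  have "j + v \<le> 1 * k" using valuation_bound[OF k(1) vm(1)] k(2) by simp
  from log_term_eq_0[OF x(1,2) _ k(1) vm this] show ?thesis by simp
qed

lemma zp_log1p:
  assumes x: "x \<in> carrier (Zp p)" "x 1 = 0"
  shows "zp_log1p p x \<in> carrier (Zp p)"
    and "N \<ge> 2 * K \<Longrightarrow> zp_log1p p x K = (\<Sum>k=1..N. (-1) ^ (k + 1) * log_term x k K) mod P ^ K"
proof -
  define S where "S = (\<lambda>N. \<Oplus>\<^bsub>Zp p\<^esub>n\<in>{1..N}. zp_of_int p ((-1) ^ (n + 1)) \<otimes>\<^bsub>Zp p\<^esub> zp_quot p (x [^]\<^bsub>Zp p\<^esub> n) (int n))"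
  have mem: "(\<lambda>n. zp_of_int p ((-1) ^ (n + 1)) \<otimes>\<^bsub>Zp p\<^esub> log_term x n) \<in> {1..N} \<rightarrow> carrier (Zp p)" for N
    using log_term(1)[OF x] by auto
  have S: "S N \<in> carrier (Zp p)" for N
    unfolding S_def log_term_def[symmetric] by (rule Zp.finsum_closed[OF mem])
  have S_nth: "S N K = (\<Sum>k=1..N. (-1) ^ (k + 1) * log_term x k K) mod P ^ K" for N K
  proof -
    have "S N K = (\<Sum>k=1..N. (zp_of_int p ((-1) ^ (k + 1)) \<otimes>\<^bsub>Zp p\<^esub> log_term x k) K) mod P ^ K"
      unfolding S_def log_term_def[symmetric] by (rule Zp_finsum_nth[OF _ mem]) simp
    also have "\<dots> = (\<Sum>k=1..N. ((-1) ^ (k + 1) * log_term x k K) mod P ^ K) mod P ^ K"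
      by (simp add: Zp_nth zp_of_int_def mod_simps)
    also have "\<dots> = (\<Sum>k=1..N. (-1) ^ (k + 1) * log_term x k K) mod P ^ K" by (rule mod_sum_eq)
    finally show ?thesis .
  qed
  have S_const: "S N K = S (2 * K) K" if "N \<ge> 2 * K" for N K
  proof -
    have "(\<Sum>k=1..N. (-1) ^ (k + 1) * log_term x k K) = (\<Sum>k=1..2*K. (-1) ^ (k + 1) * log_term x k K)"
      using that by (intro sum.mono_neutral_right) (auto intro!: log_term_tail[OF x])
    thus ?thesis by (simp add: S_nth)
  qed
  \<comment> \<open>Terms of index at least \<open>2 * K\<close> vanish in entry \<open>K\<close>,
    so this entry of the limit is already attained by the partial sum of length
    \<open>2 * K\<close>.\<close>
  define L where "L K = S (2 * K) K" for K
  have L: "L \<in> carrier (Zp p)"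
    unfolding Zp_carrier_iff
  proof (intro allI conjI)
    fix n
    show "0 \<le> L n" "L n < P ^ n" using Zp_bounds[OF S] by (auto simp: L_def)
    have "L (Suc n) mod P ^ n = S (2 * Suc n) n"
      unfolding L_def by (rule Zp_mod[OF S]) simp
    also have "\<dots> = L n" unfolding L_def by (rule S_const) simp
    finally show "L (Suc n) mod P ^ n = L n" .
  qed
  have lim: "zp_tendsto p S L"
    unfolding zp_tendsto_def eventually_sequentially
  proof (intro conjI allI L)
    show "\<exists>N. \<forall>n\<ge>N. S n k = L k" for k
      by (rule exI[of _ "2 * k"]) (simp add: L_def S_const[symmetric])
  qed
  have "zp_log1p p x = L"
    unfolding zp_log1p_def S_def[symmetric]
  proof (rule the_equality)
    show "zp_tendsto p S L" by (rule lim)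
  next
    fix L' assume L': "zp_tendsto p S L'"
    show "L' = L"
    proof
      fix k
      have "\<forall>\<^sub>F N in sequentially. S N k = L' k \<and> S N k = L k"
        using lim L' by (intro eventually_conj) (auto simp: zp_tendsto_def)
      thus "L' k = L k" by (metis (mono_tags, lifting) eventually_happens' sequentially_bot)
    qed
  qed
  thus "zp_log1p p x \<in> carrier (Zp p)"
    and "N \<ge> 2 * K \<Longrightarrow> zp_log1p p x K = (\<Sum>k=1..N. (-1) ^ (k + 1) * log_term x k K) mod P ^ K"
    using L S_const[of K N] S_nth[of N K] by (simp_all add: L_def)
qed

lemma binomial_prime_power_cong:
  "\<exists>n0. \<forall>n\<ge>n0. \<forall>j<J. [int ((p ^ n - 1) choose j) = (-1) ^ j] (mod P ^ K)"
proof -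
  have "(fact J :: int) \<noteq> 0" by simp
  then obtain v m where vm: "fact J = P ^ v * m" "coprime m P" by (rule P_decompose)
  \<comment> \<open>Cancelling \<open>fact J\<close>, used for all \<open>j < J\<close> alike, costs
    \<open>v\<close> digits; the summand \<open>J\<close> ensures \<open>j < p ^ n\<close>.\<close>
  show ?thesis
  proof (rule exI[of _ "K + v + J"], intro allI impI)
    fix n j assume n: "n \<ge> K + v + J" and j: "j < J"
    have "n < p ^ n" using prime_gt_1_nat[OF p_prime] by (simp add: power_gt_expt)
    hence "j < p ^ n" using n j by linarith
    from fact_binomial_cong[OF this refl]
    have "[fact j * int ((p ^ n - 1) choose j) = fact j * (-1) ^ j] (mod P ^ n)" by simp
    hence c: "[fact j * int ((p ^ n - 1) choose j) = fact j * (-1) ^ j] (mod P ^ (K + v))"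
      by (rule cong_mod_power_le) (use n in simp)
    have "(fact j :: int) dvd fact J" using j by (intro fact_dvd) simp
    then obtain d where d: "(fact J :: int) = fact j * d" by (elim dvdE)
    from cong_scalar_left[OF c, of d]
    have "[(P ^ v * m) * int ((p ^ n - 1) choose j) = (P ^ v * m) * (-1) ^ j] (mod P ^ (K + v))"
      unfolding vm(1)[symmetric] d by (simp add: mult_ac)
    thus "[int ((p ^ n - 1) choose j) = (-1) ^ j] (mod P ^ K)" by (rule cong_cancel_power) (rule vm(2))
  qed
qed

text \<open>
  \<open>log (1 + x)\<close> is the limit of \<open>((1 + x) ^ p ^ n - 1) / p ^ n\<close>: the binomial expansion has the terms
  \<open>(p ^ n - 1 choose k - 1) * x ^ k / k\<close>, whose binomial coefficient tends to \<open>(-1) ^ (k - 1)\<close>.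
\<close>

lemma zp_log1p_power_cong:
  assumes x: "x \<in> carrier (Zp p)" "x 1 = 0"
  shows "\<exists>n0. \<forall>n\<ge>n0. [P ^ n * zp_log1p p x K = (1 + x (n + K)) ^ (p ^ n) - 1] (mod P ^ (n + K))"
proof -
  obtain n0 where n0: "\<And>n j. n \<ge> n0 \<Longrightarrow> j < 2 * K \<Longrightarrow> [int ((p ^ n - 1) choose j) = (-1) ^ j] (mod P ^ K)"
    using binomial_prime_power_cong[of "2 * K" K] by metis
  \<comment> \<open>The summand \<open>2 * K\<close> guarantees \<open>p ^ n \<ge> 2 * K\<close>, so
    the binomial sum reaches all terms of the logarithm that are visible modulo
    \<open>P ^ K\<close>.\<close>
  show ?thesis
  proof (rule exI[of _ "n0 + 2 * K"], intro allI impI)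
    fix n assume n: "n \<ge> n0 + 2 * K"
    define M where "M = n + K"
    define y where "y = x M"
    define t where "t k = log_term x k M" for k
    define N where "N = p ^ n"
    have "n < p ^ n" using prime_gt_1_nat[OF p_prime] by (simp add: power_gt_expt)
    hence NK: "N \<ge> 2 * K" "N \<ge> 1" using n by (auto simp: N_def)
    have PN: "int N = P ^ n" by (simp add: N_def)
    have t: "[int k * t k = y ^ k] (mod P ^ M)" if "k \<ge> 1" for k
      unfolding t_def y_def by (rule log_term(2)[OF x that])
    have tK: "[t k = log_term x k K] (mod P ^ K)" if "k \<ge> 1" for k
      unfolding t_def by (rule Zp_cong[OF log_term(1)[OF x that]]) (simp add: M_def)
    \<comment> \<open>The binomial coefficients are controlled only for boundedly many indices.
      Beyond that range \<open>t k\<close> itself vanishes modulo \<open>P ^ K\<close>, so its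
      coefficient does not matter.\<close>
    have coef: "[int ((N - 1) choose (k - 1)) * t k = (-1) ^ (k + 1) * t k] (mod P ^ K)" if k: "k \<ge> 1" for k
    proof (cases "k \<ge> 2 * K")
      case True
      hence "log_term x k K = 0" by (intro log_term_tail[OF x k])
      hence "[t k = 0] (mod P ^ K)" using tK[OF k] by simp
      hence "[a * t k = b * t k] (mod P ^ K)" for a b by (simp add: cong_iff_dvd_diff)
      thus ?thesis .
    next
      case False
      hence "[int ((N - 1) choose (k - 1)) = (-1) ^ (k - 1)] (mod P ^ K)"
        unfolding N_def using n k by (intro n0) auto
      moreover have "(-1 :: int) ^ (k - 1) = (-1) ^ (k + 1)" using k by (cases k) simp_all
      ultimately show ?thesis by (metis cong_scalar_right)
    qed
    have "(1 + y) ^ N = (\<Sum>k\<le>N. int (N choose k) * y ^ k)"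
      using binomial_ring[of y 1 N] by (simp add: add.commute)
    also have "{..N} = insert 0 {1..N}" by auto
    also have "(\<Sum>k\<in>insert 0 {1..N}. int (N choose k) * y ^ k) = 1 + (\<Sum>k=1..N. int (N choose k) * y ^ k)"
      by simp
    finally have "(1 + y) ^ N - 1 = (\<Sum>k=1..N. int (N choose k) * y ^ k)" by simp
    also have "[\<dots> = (\<Sum>k=1..N. P ^ n * ((-1) ^ (k + 1) * t k))] (mod P ^ M)"
    proof (rule cong_sum)
      fix k assume "k \<in> {1..N}"
      hence k: "k \<ge> 1" by simp
      have "int (N choose k) * int k = P ^ n * int ((N - 1) choose (k - 1))"
        using times_binomial_minus1_eq[of k N] k unfolding PN[symmetric] by (metis mult.commute of_nat_mult less_eq_Suc_le One_nat_def)
      hence e: "int (N choose k) * (int k * t k) = P ^ n * (int ((N - 1) choose (k - 1)) * t k)"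
        by (metis mult.assoc)
      have "[int (N choose k) * y ^ k = int (N choose k) * (int k * t k)] (mod P ^ M)"
        by (rule cong_scalar_left[OF cong_sym[OF t[OF k]]])
      also note e
      also have "[P ^ n * (int ((N - 1) choose (k - 1)) * t k) = P ^ n * ((-1) ^ (k + 1) * t k)] (mod P ^ M)"
        using coef[OF k] unfolding M_def power_add cong_iff_dvd_diff right_diff_distrib[symmetric]
        by (rule mult_dvd_mono[OF dvd_refl])
      finally show "[int (N choose k) * y ^ k = P ^ n * ((-1) ^ (k + 1) * t k)] (mod P ^ M)" .
    qed
    finally have 1: "[(1 + y) ^ N - 1 = P ^ n * (\<Sum>k=1..N. (-1) ^ (k + 1) * t k)] (mod P ^ M)"
      by (simp only: sum_distrib_left)
    have "[(\<Sum>k=1..N. (-1) ^ (k + 1) * t k) = (\<Sum>k=1..N. (-1) ^ (k + 1) * log_term x k K)] (mod P ^ K)"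
      by (intro cong_sum cong_scalar_left tK) simp
    also have "[(\<Sum>k=1..N. (-1) ^ (k + 1) * log_term x k K) = zp_log1p p x K] (mod P ^ K)"
      unfolding zp_log1p(2)[OF x NK(1)] by (simp add: cong_def)
    finally have "[P ^ n * (\<Sum>k=1..N. (-1) ^ (k + 1) * t k) = P ^ n * zp_log1p p x K] (mod P ^ M)"
      unfolding M_def power_add cong_iff_dvd_diff right_diff_distrib[symmetric]
      by (rule mult_dvd_mono[OF dvd_refl])
    from cong_sym[OF cong_trans[OF 1 this]]
    show "[P ^ n * zp_log1p p x K = (1 + x (n + K)) ^ (p ^ n) - 1] (mod P ^ (n + K))"
      by (simp add: M_def y_def N_def)
  qed
qed

end

section \<open>Complex roots of unity\<close>

lemma expi_cis: "expi k m = cis (2 * pi * of_int k / of_nat m)"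
  by (simp add: expi_def cis_conv_exp mult_ac)

lemma expi_add: "expi (a + b) m = expi a m * expi b m"
  by (simp add: expi_cis cis_mult ring_distribs add_divide_distrib)

lemma expi_0 [simp]: "expi 0 m = 1"
  by (simp add: expi_cis)

lemma expi_mult_self [simp]: "m > 0 \<Longrightarrow> expi (int m * k) m = 1"
proof -
  assume "m > 0"
  hence "expi (int m * k) m = cis (2 * pi * of_int k)" by (simp add: expi_cis mult.assoc)
  thus ?thesis by (simp only: cis_multiple_2pi Ints_of_int)
qed

lemma expi_mod: "m > 0 \<Longrightarrow> expi (a mod int m) m = expi a m"
  using expi_add[of "int m * (a div int m)" "a mod int m" m] by simp

lemma expi_bij_betw:
  assumes "m > 0"
  shows "bij_betw (\<lambda>k. expi k m) {0..<int m} {z. z ^ m = 1}"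
proof -
  have "bij_betw (\<lambda>k. cis (2 * pi * real k / real m)) {..<m} {z. z ^ m = 1}"
    by (rule bij_betw_roots_unity[OF assms])
  moreover have "bij_betw nat {0..<int m} {..<m}"
    by (rule bij_betw_byWitness[of _ int]) auto
  ultimately have "bij_betw ((\<lambda>k. cis (2 * pi * real k / real m)) \<circ> nat) {0..<int m} {z. z ^ m = 1}"
    by (rule bij_betw_trans[rotated])
  thus ?thesis by (subst bij_betw_cong[where g = "(\<lambda>k. cis (2 * pi * real k / real m)) \<circ> nat"]) (auto simp: expi_cis)
qed

lemma expi_eq_iff:
  assumes "m > 0"
  shows "expi a m = expi b m \<longleftrightarrow> [a = b] (mod int m)"
proof -
  have "expi (a mod int m) m = expi (b mod int m) m \<longleftrightarrow> a mod int m = b mod int m"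
    using assms by (intro inj_on_eq_iff[OF bij_betw_imp_inj_on[OF expi_bij_betw[OF assms]]]) auto
  thus ?thesis using assms by (simp add: expi_mod cong_def)
qed

lemma root_of_unity_expi:
  assumes "m > 0" "z ^ m = 1"
  obtains k where "0 \<le> k" "k < int m" "z = expi k m"
proof -
  have "z \<in> (\<lambda>k. expi k m) ` {0..<int m}"
    using expi_bij_betw[OF assms(1)] assms(2) by (simp add: bij_betw_def)
  thus thesis using that by auto
qed

lemma expi_power_nat: "expi a m ^ k = expi (int k * a) m"
  by (induction k) (simp_all add: expi_add algebra_simps)

lemma expi_power_1: "m > 0 \<Longrightarrow> expi a m ^ m = 1"
  by (simp add: expi_power_nat)

lemma expi_scale: "k > 0 \<Longrightarrow> expi (int k * a) (k * m) = expi a m"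
  by (simp add: expi_cis mult.assoc)

locale odd_padic = padic +
  assumes odd_p: "odd p"
begin

section \<open>The normalized logarithm\<close>

text \<open>The modulus counts \<open>q\<close> digits for the value, \<open>r\<close> for the
  division by \<open>p ^ r\<close> and \<open>n\<close> for the limit formula. Cancelling
  \<open>P ^ (n + r)\<close> leaves the value modulo \<open>P ^ q\<close>.\<close>

lemma norm_log_bounds_cong:
  assumes z: "z \<in> carrier (Zp p)" and r: "r \<ge> 1"
  shows "0 \<le> norm_log p r q z \<and> norm_log p r q z < P ^ q"
    and "\<exists>n0. \<forall>n\<ge>n0. [P ^ (n + r) * norm_log p r q z = (1 + P ^ r * z (n + q + r)) ^ (p ^ n) - 1] (mod P ^ (n + q + r))"
proof -
  define x where "x = zp_of_int p (P ^ r) \<otimes>\<^bsub>Zp p\<^esub> z"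
  have x: "x \<in> carrier (Zp p)" unfolding x_def using z by simp
  have x_nth: "x n = (P ^ r * z n) mod P ^ n" for n
    by (simp add: x_def Zp_nth zp_of_int_def mod_simps)
  have "x r = 0" by (simp add: x_nth)
  hence x1: "x 1 = 0" using Zp_mod[OF x r] by simp
  define L where "L = zp_log1p p x"
  have L: "L \<in> carrier (Zp p)" unfolding L_def by (rule zp_log1p[OF x x1])
  \<comment> \<open>The quotient by \<open>p ^ r\<close> is meaningful only if the logarithm is
    divisible by it. The limit formula at precision \<open>r\<close> shows this, because
    \<open>(1 + x) ^ p ^ n\<close> is 1 modulo \<open>P ^ (r + n)\<close>.\<close>
  have "L r = 0"
  proof -
    obtain n where n: "[P ^ n * L r = (1 + x (n + r)) ^ (p ^ n) - 1] (mod P ^ (n + r))"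
      using zp_log1p_power_cong[OF x x1, of r] unfolding L_def by blast
    have "x (n + r) mod P ^ r = 0" using Zp_mod[OF x, of r "n + r"] \<open>x r = 0\<close> by simp
    hence c: "[1 + x (n + r) = 1] (mod P ^ r)" by (simp add: cong_iff_dvd_diff mod_eq_0_iff_dvd)
    hence c1: "[1 + x (n + r) = 1] (mod P)" using cong_mod_power_le[OF c r] by simp
    have "[(1 + x (n + r)) ^ (p ^ n) = 1 ^ (p ^ n)] (mod P ^ (r + n))"
      using prime_power_cong_iff[OF odd_p c1 cong_refl, of n r] c by simp
    hence "[(1 + x (n + r)) ^ (p ^ n) - 1 = 0] (mod P ^ (n + r))"
      by (simp add: cong_iff_dvd_diff add.commute[of r n])
    from cong_trans[OF n this] have "[P ^ n * L r = P ^ n * 0] (mod P ^ (r + n))"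
      by (simp add: add.commute)
    hence "[L r = 0] (mod P ^ r)" by (rule cong_cancel_P_power)
    thus ?thesis using Zp_bounds[OF L, of r] by (simp add: cong_def)
  qed
  define t where "t = zp_quot p L (P ^ r)"
  have t: "t \<in> carrier (Zp p)" "[P ^ r * t n = L n] (mod P ^ n)" for n
    unfolding t_def using zp_quot[OF L, of "P ^ r" r 1] \<open>L r = 0\<close> by auto
  have nl: "norm_log p r q z = t q"
    by (simp add: norm_log_def t_def L_def x_def)
  show "0 \<le> norm_log p r q z \<and> norm_log p r q z < P ^ q"
    unfolding nl by (rule Zp_bounds[OF t(1)])
  have "[t q = t (q + r)] (mod P ^ q)" by (rule cong_sym[OF Zp_cong[OF t(1)]]) simp
  hence "[P ^ r * t q = P ^ r * t (q + r)] (mod P ^ (q + r))" by (simp only: cong_mult_P_power_iff)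
  from cong_trans[OF this t(2)]
  have "[P ^ r * t q = L (q + r)] (mod P ^ (q + r))" .
  hence tL: "[P ^ (n + r) * t q = P ^ n * L (q + r)] (mod P ^ (n + q + r))" for n
    unfolding cong_iff_dvd_diff power_add mult.assoc right_diff_distrib[symmetric]
    by (rule mult_dvd_mono[OF dvd_refl])
  obtain n0 where n0: "\<And>n. n \<ge> n0 \<Longrightarrow> [P ^ n * L (q + r) = (1 + x (n + (q + r))) ^ (p ^ n) - 1] (mod P ^ (n + (q + r)))"
    using zp_log1p_power_cong[OF x x1, of "q + r"] unfolding L_def by blast
  show "\<exists>n0. \<forall>n\<ge>n0. [P ^ (n + r) * norm_log p r q z = (1 + P ^ r * z (n + q + r)) ^ (p ^ n) - 1] (mod P ^ (n + q + r))"
  proof (rule exI[of _ n0], intro allI impI)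
    fix n assume "n \<ge> n0"
    note tL[of n]
    also have "[P ^ n * L (q + r) = (1 + x (n + q + r)) ^ (p ^ n) - 1] (mod P ^ (n + q + r))"
      using n0[OF \<open>n \<ge> n0\<close>] by (simp add: add.assoc)
    also have "[(1 + x (n + q + r)) ^ (p ^ n) - 1 = (1 + P ^ r * z (n + q + r)) ^ (p ^ n) - 1] (mod P ^ (n + q + r))"
      by (intro cong_diff cong_pow cong_add cong_refl) (simp add: x_nth cong_def)
    finally show "[P ^ (n + r) * norm_log p r q z = (1 + P ^ r * z (n + q + r)) ^ (p ^ n) - 1] (mod P ^ (n + q + r))"
      unfolding nl .
  qed
qed

text \<open>The lift \<open>z (n + q + r)\<close>, which moves with \<open>n\<close>, may be
  replaced by one fixed integer: an error of depth \<open>q + r\<close> in the base has depth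
  \<open>n + q + r\<close> after the power \<open>p ^ n\<close>.\<close>

lemma norm_log_cong:
  assumes z: "z \<in> carrier (Zp p)" and r: "r \<ge> 1" and a: "[z q = a] (mod P ^ q)"
  shows "\<exists>n0. \<forall>n\<ge>n0. [P ^ (n + r) * norm_log p r q z = (1 + P ^ r * a) ^ (p ^ n) - 1] (mod P ^ (n + q + r))"
proof -
  have "[(1 + P ^ r * z (n + q + r)) ^ (p ^ n) - 1 = (1 + P ^ r * a) ^ (p ^ n) - 1] (mod P ^ (n + q + r))" for n
  proof -
    have "[z (n + q + r) = z q] (mod P ^ q)" by (rule Zp_cong[OF z]) simp
    from cong_trans[OF this a] have "[z (n + q + r) = a] (mod P ^ q)" .
    hence "[1 + P ^ r * z (n + q + r) = 1 + P ^ r * a] (mod P ^ (q + r))" by (simp only: one_plus_cong_iff)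
    hence "[(1 + P ^ r * z (n + q + r)) ^ (p ^ n) = (1 + P ^ r * a) ^ (p ^ n)] (mod P ^ (q + r + n))"
      using prime_power_cong_iff[OF odd_p one_plus_cong_1[OF r] one_plus_cong_1[OF r]] by blast
    moreover have "q + r + n = n + q + r" by simp
    ultimately have "[(1 + P ^ r * z (n + q + r)) ^ (p ^ n) = (1 + P ^ r * a) ^ (p ^ n)] (mod P ^ (n + q + r))"
      by metis
    thus ?thesis by (intro cong_diff cong_refl)
  qed
  with norm_log_bounds_cong(2)[OF z r, of q] show ?thesis by (meson cong_trans)
qed

text \<open>At one large \<open>n\<close> every step is an equivalence, so faithfulness of the
  logarithm on classes is reduced to the exact precision shift of \<open>p ^ n\<close>-th
  powers.\<close>

lemma norm_log_eq_iff:
  assumes "z \<in> carrier (Zp p)" "z' \<in> carrier (Zp p)" and r: "r \<ge> 1"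
  shows "norm_log p r q z = norm_log p r q z' \<longleftrightarrow> z q = z' q"
proof -
  obtain n1 where n1: "\<And>n. n \<ge> n1 \<Longrightarrow> [P ^ (n + r) * norm_log p r q z = (1 + P ^ r * z q) ^ (p ^ n) - 1] (mod P ^ (n + q + r))"
    using norm_log_cong[OF assms(1) r cong_refl] by blast
  obtain n2 where n2: "\<And>n. n \<ge> n2 \<Longrightarrow> [P ^ (n + r) * norm_log p r q z' = (1 + P ^ r * z' q) ^ (p ^ n) - 1] (mod P ^ (n + q + r))"
    using norm_log_cong[OF assms(2) r cong_refl] by blast
  define n where "n = max n1 n2"
  have n12: "n \<ge> n1" "n \<ge> n2" by (auto simp: n_def)
  let ?A = "(1 + P ^ r * z q)" and ?B = "(1 + P ^ r * z' q)" and ?M = "P ^ (n + q + r)"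
  have "norm_log p r q z = norm_log p r q z' \<longleftrightarrow> [norm_log p r q z = norm_log p r q z'] (mod P ^ q)"
    using norm_log_bounds_cong(1)[OF assms(1) r, of q] norm_log_bounds_cong(1)[OF assms(2) r, of q] by (simp add: cong_def)
  also have "\<dots> \<longleftrightarrow> [P ^ (n + r) * norm_log p r q z = P ^ (n + r) * norm_log p r q z'] (mod P ^ (q + (n + r)))"
    by (simp only: cong_mult_P_power_iff)
  also have "\<dots> \<longleftrightarrow> [?A ^ (p ^ n) - 1 = ?B ^ (p ^ n) - 1] (mod P ^ (q + (n + r)))"
  proof -
    have e: "n + q + r = q + (n + r)" by simp
    note n1[OF n12(1), unfolded e cong_def] n2[OF n12(2), unfolded e cong_def]
    thus ?thesis unfolding cong_def by (simp only:)
  qed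
  also have "\<dots> \<longleftrightarrow> [?A ^ (p ^ n) = ?B ^ (p ^ n)] (mod P ^ ((q + r) + n))"
  proof -
    have e: "q + (n + r) = (q + r) + n" by simp
    show ?thesis unfolding e by (simp add: cong_iff_dvd_diff)
  qed
  also have "\<dots> \<longleftrightarrow> [?A = ?B] (mod P ^ (q + r))"
    by (rule prime_power_cong_iff[OF odd_p one_plus_cong_1[OF r] one_plus_cong_1[OF r]])
  also have "\<dots> \<longleftrightarrow> [z q = z' q] (mod P ^ q)" by (rule one_plus_cong_iff)
  also have "\<dots> \<longleftrightarrow> z q = z' q"
    using Zp_bounds[OF assms(1), of q] Zp_bounds[OF assms(2), of q] by (simp add: cong_def)
  finally show ?thesis .
qed

text \<open>The assumption on \<open>z''\<close> says that its principal unit is the product of the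
  other two. With \<open>A\<close> and \<open>B\<close> their \<open>p ^ n\<close>-th powers, the
  defect (AB - 1) - (A - 1) - (B - 1) equals (A - 1)(B - 1). This has depth
  \<open>2 * (r + n)\<close>, which exceeds the working precision once \<open>n\<close> is
  large.\<close>

lemma norm_log_add:
  assumes z: "z \<in> carrier (Zp p)" "z' \<in> carrier (Zp p)" "z'' \<in> carrier (Zp p)" and r: "r \<ge> 1"
    and e: "[z'' q = z q + z' q + P ^ r * z q * z' q] (mod P ^ q)"
  shows "[norm_log p r q z'' = norm_log p r q z + norm_log p r q z'] (mod P ^ q)"
proof -
  obtain n1 where n1: "\<And>n. n \<ge> n1 \<Longrightarrow> [P ^ (n + r) * norm_log p r q z = (1 + P ^ r * z q) ^ (p ^ n) - 1] (mod P ^ (n + q + r))"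
    using norm_log_cong[OF z(1) r cong_refl] by blast
  obtain n2 where n2: "\<And>n. n \<ge> n2 \<Longrightarrow> [P ^ (n + r) * norm_log p r q z' = (1 + P ^ r * z' q) ^ (p ^ n) - 1] (mod P ^ (n + q + r))"
    using norm_log_cong[OF z(2) r cong_refl] by blast
  obtain n3 where n3: "\<And>n. n \<ge> n3 \<Longrightarrow> [P ^ (n + r) * norm_log p r q z'' =
      (1 + P ^ r * (z q + z' q + P ^ r * z q * z' q)) ^ (p ^ n) - 1] (mod P ^ (n + q + r))"
    using norm_log_cong[OF z(3) r e] by blast
  \<comment> \<open>The summand \<open>q\<close> gives
    \<open>n + q + r \<le> 2 * (r + n)\<close>.\<close>
  define n where "n = n1 + n2 + n3 + q"
  have n: "n \<ge> n1" "n \<ge> n2" "n \<ge> n3" "n \<ge> q" by (auto simp: n_def)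
  define A B M where "A = (1 + P ^ r * z q) ^ (p ^ n)" "B = (1 + P ^ r * z' q) ^ (p ^ n)" "M = P ^ (n + q + r)"
  have one: "[(1 + P ^ r * a) ^ (p ^ n) = 1] (mod P ^ (r + n))" for a
    using prime_power_cong_iff[OF odd_p one_plus_cong_1[OF r, of a] cong_refl, of n r] 
    by (simp add: cong_iff_dvd_diff)
  have "P ^ (r + n) * P ^ (r + n) dvd (A - 1) * (B - 1)"
    using one unfolding A_B_M_def(1,2) cong_iff_dvd_diff by (intro mult_dvd_mono)
  moreover have "M dvd P ^ (r + n) * P ^ (r + n)"
    unfolding A_B_M_def(3) power_add[symmetric] using n by (intro le_imp_power_dvd) simp
  ultimately have "M dvd (A - 1) * (B - 1)" using dvd_trans by blast
  hence "[A * B - 1 = (A - 1) + (B - 1)] (mod M)" by (simp add: cong_iff_dvd_diff algebra_simps)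
  hence 1: "[(A - 1) + (B - 1) = A * B - 1] (mod M)" by (rule cong_sym)
  have 2: "A * B = (1 + P ^ r * (z q + z' q + P ^ r * z q * z' q)) ^ (p ^ n)"
    unfolding A_B_M_def(1,2) power_mult_distrib[symmetric] by (simp add: algebra_simps)
  have "[P ^ (n + r) * norm_log p r q z'' = (A - 1) + (B - 1)] (mod M)"
    using n3[OF n(3), folded A_B_M_def(3) 2] cong_sym[OF 1] by (rule cong_trans)
  also have "[(A - 1) + (B - 1) = P ^ (n + r) * norm_log p r q z + P ^ (n + r) * norm_log p r q z'] (mod M)"
    unfolding A_B_M_def by (rule cong_sym[OF cong_add[OF n1[OF n(1)] n2[OF n(2)]]])
  also have "P ^ (n + r) * norm_log p r q z + P ^ (n + r) * norm_log p r q z' = P ^ (n + r) * (norm_log p r q z + norm_log p r q z')"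
    by (simp only: distrib_left)
  also have "M = P ^ (q + (n + r))" unfolding A_B_M_def(3) by (simp only: add_ac)
  finally have "[P ^ (n + r) * norm_log p r q z'' = P ^ (n + r) * (norm_log p r q z + norm_log p r q z')] (mod P ^ (q + (n + r)))" .
  thus ?thesis by (rule cong_cancel_P_power)
qed

text \<open>The quadratic error of the linear approximation is \<open>P ^ (n + 2 * (r + d))\<close>;
  dividing by \<open>P ^ (n + r)\<close> leaves \<open>P ^ (r + 2 * d)\<close>, hence the bound on
  \<open>q\<close>. For \<open>d = q - r\<close> the bound reads \<open>r \<le> q\<close>, which is
  the case of a maximal window.\<close>

lemma norm_log_deep:
  assumes z: "z \<in> carrier (Zp p)" and r: "r \<ge> 1" and e: "[z q = P ^ d * w] (mod P ^ q)" and d: "q \<le> r + 2 * d"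
  shows "[norm_log p r q z = P ^ d * w] (mod P ^ q)"
proof -
  obtain n where n: "[P ^ (n + r) * norm_log p r q z = (1 + P ^ r * (P ^ d * w)) ^ (p ^ n) - 1] (mod P ^ (n + q + r))"
    using norm_log_cong[OF z r e] by blast
  have "[(1 + P ^ (r + d) * w) ^ (p ^ n) = 1 + P ^ (n + (r + d)) * w] (mod P ^ (n + 2 * (r + d)))"
    using r by (intro one_plus_prime_power odd_p) simp
  hence "[(1 + P ^ (r + d) * w) ^ (p ^ n) = 1 + P ^ (n + (r + d)) * w] (mod P ^ (n + q + r))"
    by (rule cong_mod_power_le) (use d in simp)
  from cong_diff[OF this cong_refl[of 1]]
  have c: "[(1 + P ^ (r + d) * w) ^ (p ^ n) - 1 = P ^ (n + (r + d)) * w] (mod P ^ (n + q + r))"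
    by (simp only: add_diff_cancel_left')
  have e1: "P ^ r * (P ^ d * w) = P ^ (r + d) * w" by (simp only: power_add mult.assoc)
  have e2: "n + q + r = q + (n + r)" by (simp only: add_ac)
  have e3: "P ^ (n + (r + d)) * w = P ^ (n + r) * (P ^ d * w)" by (simp only: power_add mult.assoc)
  have "[P ^ (n + r) * norm_log p r q z = P ^ (n + r) * (P ^ d * w)] (mod P ^ (q + (n + r)))"
    using cong_trans[OF n[unfolded e1] c] unfolding e2 e3 .
  thus ?thesis by (rule cong_cancel_P_power)
qed

end

context padic
begin

section \<open>Groups of principal units\<close>

lemma one_unit_nth: "one_unit p r z n = (1 + P ^ r * z n) mod P ^ n"
  by (simp add: one_unit_def Zp_nth zp_of_int_nth mod_simps)

lemma one_unit_closed: "z \<in> carrier (Zp p) \<Longrightarrow> one_unit p r z \<in> carrier (Zp p)"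
  unfolding one_unit_def by simp

text \<open>Membership becomes a condition on a single entry, because \<open>u - 1\<close> has a
  quotient by \<open>p ^ r\<close> as soon as its entry \<open>r\<close> vanishes.\<close>

lemma carrier_unit_grp: "carrier (unit_grp p r) = {u \<in> carrier (Zp p). [u r = 1] (mod P ^ r)}"
proof (intro equalityI subsetI)
  fix u assume "u \<in> carrier (unit_grp p r)"
  then obtain z where "z \<in> carrier (Zp p)" "u = one_unit p r z" by (auto simp: unit_grp_def)
  thus "u \<in> {u \<in> carrier (Zp p). [u r = 1] (mod P ^ r)}"
    by (auto simp: one_unit_closed one_unit_nth cong_def)
next
  fix u assume "u \<in> {u \<in> carrier (Zp p). [u r = 1] (mod P ^ r)}"
  hence u: "u \<in> carrier (Zp p)" "[u r = 1] (mod P ^ r)" by auto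
  define a where "a = (\<lambda>n. (u n - 1) mod P ^ n)"
  have a: "a \<in> carrier (Zp p)"
    unfolding a_def by (rule Zp_limI) (intro cong_diff cong_refl Zp_cong[OF u(1)] le_SucI order_refl)
  have "a r = 0" using u(2) by (simp add: a_def cong_iff_dvd_diff)
  define t where "t = zp_quot p a (P ^ r)"
  have t: "t \<in> carrier (Zp p)" "[P ^ r * t n = a n] (mod P ^ n)" for n
    unfolding t_def using zp_quot[OF a, of "P ^ r" r 1] \<open>a r = 0\<close> by auto
  have "u = one_unit p r t"
  proof (rule Zp_eqI_cong[OF u(1) one_unit_closed[OF t(1)]])
    fix n
    have "[1 + P ^ r * t n = 1 + a n] (mod P ^ n)" by (rule cong_add[OF cong_refl t(2)])
    also have "[1 + a n = u n] (mod P ^ n)" by (simp add: a_def cong_def mod_simps)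
    finally show "[u n = one_unit p r t n] (mod P ^ n)"
      by (simp add: one_unit_nth cong_def)
  qed
  thus "u \<in> carrier (unit_grp p r)" using t(1) by (auto simp: unit_grp_def)
qed

lemma comm_group_unit_grp:
  assumes r: "r \<ge> 1"
  shows "comm_group (unit_grp p r)"
proof (rule comm_groupI)
  fix u v assume "u \<in> carrier (unit_grp p r)" "v \<in> carrier (unit_grp p r)"
  hence uv: "u \<in> carrier (Zp p)" "v \<in> carrier (Zp p)" "[u r = 1] (mod P ^ r)" "[v r = 1] (mod P ^ r)"
    by (auto simp: carrier_unit_grp)
  have "[(u \<otimes>\<^bsub>Zp p\<^esub> v) r = 1] (mod P ^ r)"
    using cong_mult[OF uv(3,4)] by (simp add: Zp_nth cong_def)
  with uv show "u \<otimes>\<^bsub>unit_grp p r\<^esub> v \<in> carrier (unit_grp p r)"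
    unfolding carrier_unit_grp by (simp add: unit_grp_def)
  show "u \<otimes>\<^bsub>unit_grp p r\<^esub> v = v \<otimes>\<^bsub>unit_grp p r\<^esub> u"
    using uv Zp.m_comm by (simp add: unit_grp_def)
  fix w assume "w \<in> carrier (unit_grp p r)"
  hence "w \<in> carrier (Zp p)" by (simp add: carrier_unit_grp)
  with uv show "u \<otimes>\<^bsub>unit_grp p r\<^esub> v \<otimes>\<^bsub>unit_grp p r\<^esub> w = u \<otimes>\<^bsub>unit_grp p r\<^esub> (v \<otimes>\<^bsub>unit_grp p r\<^esub> w)"
    by (simp add: unit_grp_def Zp.m_assoc)
next
  show "\<one>\<^bsub>unit_grp p r\<^esub> \<in> carrier (unit_grp p r)"
    unfolding carrier_unit_grp by (simp add: unit_grp_def Zp_nth cong_def)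
next
  fix u assume "u \<in> carrier (unit_grp p r)"
  hence u: "u \<in> carrier (Zp p)" "[u r = 1] (mod P ^ r)" by (auto simp: carrier_unit_grp)
  show "\<one>\<^bsub>unit_grp p r\<^esub> \<otimes>\<^bsub>unit_grp p r\<^esub> u = u" using u by (simp add: unit_grp_def)
  have "[u 1 = u r] (mod P ^ 1)" by (rule cong_sym[OF Zp_cong[OF u(1) r]])
  also have "[u r = 1] (mod P ^ 1)" by (rule cong_mod_power_le[OF u(2) r])
  finally have "[1 = u 1] (mod P)" by (simp add: cong_sym)
  hence "coprime (u 1) P" by (rule cong_imp_coprime) simp
  from Zp_inverse[OF u(1) this] obtain y where y: "y \<in> carrier (Zp p)" "u \<otimes>\<^bsub>Zp p\<^esub> y = \<one>\<^bsub>Zp p\<^esub>" by blast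
  have "[u r * y r = 1] (mod P ^ r)" using fun_cong[OF y(2), of r] by (simp add: Zp_nth cong_def)
  moreover have "[1 * y r = u r * y r] (mod P ^ r)" by (rule cong_mult[OF cong_sym[OF u(2)] cong_refl])
  ultimately have "[1 * y r = 1] (mod P ^ r)" by (metis cong_trans)
  hence "[y r = 1] (mod P ^ r)" by simp
  hence "y \<in> carrier (unit_grp p r)" using y by (simp add: carrier_unit_grp)
  moreover have "y \<otimes>\<^bsub>unit_grp p r\<^esub> u = \<one>\<^bsub>unit_grp p r\<^esub>"
    using y u Zp.m_comm by (simp add: unit_grp_def)
  ultimately show "\<exists>y\<in>carrier (unit_grp p r). y \<otimes>\<^bsub>unit_grp p r\<^esub> u = \<one>\<^bsub>unit_grp p r\<^esub>" by blast
qed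

lemma normal_unit_grp:
  assumes r: "r \<ge> 1"
  shows "carrier (unit_grp p (q + r)) \<lhd> unit_grp p r"
proof -
  interpret comm_group "unit_grp p r" by (rule comm_group_unit_grp[OF r])
  have "carrier (unit_grp p (q + r)) \<subseteq> carrier (unit_grp p r)"
    unfolding carrier_unit_grp
  proof safe
    fix u assume u: "u \<in> carrier (Zp p)" "[u (q + r) = 1] (mod P ^ (q + r))"
    have "[u r = u (q + r)] (mod P ^ r)" by (rule cong_sym[OF Zp_cong[OF u(1)]]) simp
    also have "[u (q + r) = 1] (mod P ^ r)" by (rule cong_mod_power_le[OF u(2)]) simp
    finally show "[u r = 1] (mod P ^ r)" .
  qed
  moreover have "group (unit_grp p (q + r))"
    using comm_group_unit_grp[of "q + r"] r by (simp add: comm_group_def)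
  hence "group ((unit_grp p r)\<lparr>carrier := carrier (unit_grp p (q + r))\<rparr>)"
    by (simp add: unit_grp_def)
  ultimately have "subgroup (carrier (unit_grp p (q + r))) (unit_grp p r)"
    by (rule group_incl_imp_subgroup)
  thus ?thesis by (rule subgroup_imp_normal)
qed

text \<open>This allows a character of the quotient group to be treated as a function of the
  parameter modulo \<open>P ^ q\<close>, hence of integers.\<close>

lemma unit_coset_eq_iff:
  assumes r: "r \<ge> 1" and z: "z \<in> carrier (Zp p)" "z' \<in> carrier (Zp p)"
  shows "carrier (unit_grp p (q + r)) #>\<^bsub>unit_grp p r\<^esub> one_unit p r z =
         carrier (unit_grp p (q + r)) #>\<^bsub>unit_grp p r\<^esub> one_unit p r z' \<longleftrightarrow> z q = z' q"
    (is "?N #>\<^bsub>?G\<^esub> ?u = ?N #>\<^bsub>?G\<^esub> ?v \<longleftrightarrow> _")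
proof -
  interpret comm_group ?G by (rule comm_group_unit_grp[OF r])
  interpret normal ?N ?G by (rule normal_unit_grp[OF r])
  have uv: "?u \<in> carrier ?G" "?v \<in> carrier ?G" using z by (auto simp: unit_grp_def)
  hence uv': "?u \<in> carrier (Zp p)" "?v \<in> carrier (Zp p)" by (auto simp: carrier_unit_grp)
  have mult: "x \<otimes>\<^bsub>?G\<^esub> y = x \<otimes>\<^bsub>Zp p\<^esub> y" for x y by (simp add: unit_grp_def)
  let ?m = "q + r"
  have "?N #>\<^bsub>?G\<^esub> ?u = ?N #>\<^bsub>?G\<^esub> ?v \<longleftrightarrow> [?u ?m = ?v ?m] (mod P ^ ?m)"
  proof
    assume "?N #>\<^bsub>?G\<^esub> ?u = ?N #>\<^bsub>?G\<^esub> ?v"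
    hence "?u \<in> ?N #>\<^bsub>?G\<^esub> ?v" using rcos_self[OF uv(1) is_subgroup] by simp
    then obtain n where n: "n \<in> ?N" "?u = n \<otimes>\<^bsub>Zp p\<^esub> ?v" by (auto simp: r_coset_def mult)
    have "[?u ?m = n ?m * ?v ?m] (mod P ^ ?m)"
      by (subst n(2)) (simp add: Zp_nth cong_def)
    also have "[n ?m * ?v ?m = 1 * ?v ?m] (mod P ^ ?m)"
      using n(1) by (intro cong_mult cong_refl) (simp add: carrier_unit_grp)
    finally show "[?u ?m = ?v ?m] (mod P ^ ?m)" by simp
  next
    assume c: "[?u ?m = ?v ?m] (mod P ^ ?m)"
    define y where "y = inv\<^bsub>?G\<^esub> ?v"
    have y: "y \<in> carrier ?G" "y \<otimes>\<^bsub>?G\<^esub> ?v = \<one>\<^bsub>?G\<^esub>" using uv by (auto simp: y_def)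
    have "[(?u \<otimes>\<^bsub>?G\<^esub> y) ?m = ?u ?m * y ?m] (mod P ^ ?m)" by (simp add: mult Zp_nth cong_def)
    also have "[?u ?m * y ?m = ?v ?m * y ?m] (mod P ^ ?m)" by (rule cong_mult[OF c cong_refl])
    also have "[?v ?m * y ?m = (y \<otimes>\<^bsub>?G\<^esub> ?v) ?m] (mod P ^ ?m)"
      unfolding mult by (simp add: Zp_nth cong_def mult.commute)
    also have "[(y \<otimes>\<^bsub>?G\<^esub> ?v) ?m = 1] (mod P ^ ?m)"
      unfolding y(2) by (simp add: unit_grp_def Zp_nth cong_def)
    finally have "?u \<otimes>\<^bsub>?G\<^esub> y \<in> ?N"
      using uv y by (simp add: carrier_unit_grp mult)
    hence "?u \<in> ?N #>\<^bsub>?G\<^esub> ?v"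
      using uv unfolding y_def by (metis rcos_module_imp is_group rcos_module)
    thus "?N #>\<^bsub>?G\<^esub> ?u = ?N #>\<^bsub>?G\<^esub> ?v"
      using repr_independence[OF _ uv(2) is_subgroup] by simp
  qed
  also have "\<dots> \<longleftrightarrow> [1 + P ^ r * z ?m = 1 + P ^ r * z' ?m] (mod P ^ ?m)"
    by (simp add: one_unit_nth cong_def)
  also have "\<dots> \<longleftrightarrow> [z ?m = z' ?m] (mod P ^ q)" by (rule one_plus_cong_iff)
  also have "\<dots> \<longleftrightarrow> z q = z' q"
    using Zp_mod[OF z(1), of q ?m] Zp_mod[OF z(2), of q ?m] by (simp add: cong_def)
  finally show ?thesis .
qed

end

locale faithful_char = odd_padic +
  fixes r q :: nat and \<psi> :: "(nat \<Rightarrow> int) set \<Rightarrow> complex"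
  assumes r_pos: "r \<ge> 1" and q_pos: "q \<ge> 1" and faithful: "faithful_character p r q \<psi>"
begin

section \<open>The character as a function of integers modulo a prime power\<close>

lemma unit_coset_closed:
  assumes "z \<in> carrier (Zp p)"
  shows "carrier (unit_grp p (q + r)) #>\<^bsub>unit_grp p r\<^esub> one_unit p r z \<in> carrier (unit_quot p r q)"
  using assms by (auto simp: unit_quot_def FactGroup_def RCOSETS_def unit_grp_def)

lemma chi_at_eq_iff:
  assumes "z \<in> carrier (Zp p)" "z' \<in> carrier (Zp p)"
  shows "chi_at p r q \<psi> z = chi_at p r q \<psi> z' \<longleftrightarrow> z q = z' q"
  unfolding chi_at_def unit_coset_eq_iff[OF r_pos assms, symmetric]
  using faithful assms by (intro inj_on_eq_iff[of \<psi> "carrier (unit_quot p r q)"] unit_coset_closed)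
    (auto simp: faithful_character_def)

lemma chi_at_nonzero: "z \<in> carrier (Zp p) \<Longrightarrow> chi_at p r q \<psi> z \<noteq> 0"
  using faithful unit_coset_closed unfolding chi_at_def faithful_character_def hom_def Cx_def by auto

text \<open>The congruence assumed for \<open>z''\<close> is the multiplication of principal units
  in the coordinate z of 1 + p^r z. Only entry \<open>q\<close> has to satisfy it, since that entry
  determines the coset.\<close>

lemma chi_at_mult:
  assumes z: "z \<in> carrier (Zp p)" "z' \<in> carrier (Zp p)" "z'' \<in> carrier (Zp p)"
    and e: "[z'' q = z q + z' q + P ^ r * z q * z' q] (mod P ^ q)"
  shows "chi_at p r q \<psi> z'' = chi_at p r q \<psi> z * chi_at p r q \<psi> z'"
proof -
  let ?N = "carrier (unit_grp p (q + r))" and ?G = "unit_grp p r"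
  interpret comm_group ?G by (rule comm_group_unit_grp[OF r_pos])
  interpret normal ?N ?G by (rule normal_unit_grp[OF r_pos])
  have uv: "one_unit p r z \<in> carrier ?G" "one_unit p r z' \<in> carrier ?G" using z by (auto simp: unit_grp_def)
  hence "one_unit p r z \<otimes>\<^bsub>?G\<^esub> one_unit p r z' \<in> carrier ?G" by simp
  then obtain w where w: "w \<in> carrier (Zp p)" "one_unit p r z \<otimes>\<^bsub>?G\<^esub> one_unit p r z' = one_unit p r w"
    by (auto simp: unit_grp_def)
  have "chi_at p r q \<psi> z * chi_at p r q \<psi> z' =
      \<psi> ((?N #>\<^bsub>?G\<^esub> one_unit p r z) \<otimes>\<^bsub>unit_quot p r q\<^esub> (?N #>\<^bsub>?G\<^esub> one_unit p r z'))"
    using faithful unit_coset_closed[OF z(1)] unit_coset_closed[OF z(2)]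
    by (simp add: faithful_character_def hom_def Cx_def chi_at_def)
  also have "\<dots> = chi_at p r q \<psi> w"
    using rcos_sum[OF uv] w(2) by (simp add: unit_quot_def FactGroup_def chi_at_def)
  also have "\<dots> = chi_at p r q \<psi> z''"
  proof (subst chi_at_eq_iff[OF w(1) z(3)])
    let ?m = "q + r"
    have "[1 + P ^ r * w ?m = (1 + P ^ r * z ?m) * (1 + P ^ r * z' ?m)] (mod P ^ ?m)"
      using fun_cong[OF w(2), of ?m] by (simp add: unit_grp_def one_unit_nth Zp_nth cong_def mod_simps)
    also have "(1 + P ^ r * z ?m) * (1 + P ^ r * z' ?m) = 1 + P ^ r * (z ?m + z' ?m + P ^ r * z ?m * z' ?m)"
      by (simp add: algebra_simps)
    finally have "[w ?m = z ?m + z' ?m + P ^ r * z ?m * z' ?m] (mod P ^ q)"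
      by (simp only: one_plus_cong_iff)
    moreover have "[z ?m + z' ?m + P ^ r * z ?m * z' ?m = z q + z' q + P ^ r * z q * z' q] (mod P ^ q)"
      by (intro cong_add cong_mult cong_refl Zp_cong z) simp_all
    moreover have "[w q = w ?m] (mod P ^ q)" by (rule cong_sym[OF Zp_cong[OF w(1)]]) simp
    ultimately have "[w q = z'' q] (mod P ^ q)" using e unfolding cong_def by metis
    thus "w q = z'' q" using Zp_bounds[OF w(1), of q] Zp_bounds[OF z(3), of q] by (simp add: cong_def)
  qed
  finally show ?thesis by simp
qed

definition chi :: "int \<Rightarrow> complex" where
  "chi a = chi_at p r q \<psi> (zp_of_int p a)"

lemma chi_at_chi: "z \<in> carrier (Zp p) \<Longrightarrow> chi_at p r q \<psi> z = chi (z q)"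
  unfolding chi_def by (subst chi_at_eq_iff) (simp_all add: zp_of_int_nth Zp_mod r_pos)

lemma chi_eq_iff: "chi a = chi b \<longleftrightarrow> [a = b] (mod P ^ q)"
  by (simp add: chi_def chi_at_eq_iff) (simp add: zp_of_int_nth cong_def)

lemma chi_nonzero [simp]: "chi a \<noteq> 0"
  by (simp add: chi_def chi_at_nonzero)

lemma cong_zp_of_int:
  assumes "[c = a + b + P ^ r * a * b] (mod P ^ q)"
  shows "[zp_of_int p c q = zp_of_int p a q + zp_of_int p b q + P ^ r * zp_of_int p a q * zp_of_int p b q] (mod P ^ q)"
proof -
  have "[k = zp_of_int p k q] (mod P ^ q)" for k by (simp add: zp_of_int_nth cong_def)
  hence "[a + b + P ^ r * a * b = zp_of_int p a q + zp_of_int p b q + P ^ r * zp_of_int p a q * zp_of_int p b q] (mod P ^ q)"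
    by (intro cong_add cong_mult cong_refl)
  with assms show ?thesis by (simp add: zp_of_int_nth cong_def)
qed

lemma chi_mult: "[c = a + b + P ^ r * a * b] (mod P ^ q) \<Longrightarrow> chi c = chi a * chi b"
  unfolding chi_def by (rule chi_at_mult) (simp_all add: cong_zp_of_int)

lemma chi_0 [simp]: "chi 0 = 1"
  using chi_mult[of 0 0 0] by simp

lemma chi_eq_1_iff: "chi a = 1 \<longleftrightarrow> P ^ q dvd a"
  using chi_eq_iff[of a 0] by (simp add: cong_0_iff)

lemma pairB_chi: "pairB p r q \<psi> c s = chi (c * s)"
  by (simp add: pairB_def chi_def)

section \<open>The conductor unit\<close>

abbreviation ell :: "int \<Rightarrow> int" where
  "ell a \<equiv> norm_log p r q (zp_of_int p a)"

lemma ell_bounds: "0 \<le> ell a" "ell a < P ^ q"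
  using norm_log_bounds_cong(1)[OF zp_of_int_closed r_pos] by auto

lemma norm_log_ell: "z \<in> carrier (Zp p) \<Longrightarrow> norm_log p r q z = ell (z q)"
  by (subst norm_log_eq_iff[OF _ _ r_pos]) (simp_all add: zp_of_int_nth Zp_mod r_pos)

lemma ell_eq_iff: "ell a = ell b \<longleftrightarrow> [a = b] (mod P ^ q)"
  unfolding norm_log_eq_iff[OF zp_of_int_closed zp_of_int_closed r_pos] by (simp add: zp_of_int_nth cong_def)

lemma ell_add: "[c = a + b + P ^ r * a * b] (mod P ^ q) \<Longrightarrow> [ell c = ell a + ell b] (mod P ^ q)"
  by (rule norm_log_add[OF _ _ _ r_pos]) (simp_all add: cong_zp_of_int)

text \<open>An injective self-map of the finite set of residues is onto; this takes the place of an
  exponential function.\<close>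

lemma ell_surj: "\<exists>a. ell a = b mod P ^ q"
proof -
  have "inj_on ell {0..<P ^ q}"
    by (rule inj_onI) (auto simp: ell_eq_iff cong_def)
  moreover have "ell ` {0..<P ^ q} \<subseteq> {0..<P ^ q}" using ell_bounds by auto
  ultimately have "ell ` {0..<P ^ q} = {0..<P ^ q}" by (intro endo_inj_surj) auto
  moreover have "b mod P ^ q \<in> {0..<P ^ q}" using P_pow_pos by simp
  ultimately show ?thesis by (metis imageE)
qed

text \<open>\<open>1 + p ^ r * unit_power a n = (1 + p ^ r * a) ^ n\<close>\<close>

primrec unit_power :: "int \<Rightarrow> nat \<Rightarrow> int" where
  "unit_power a 0 = 0"
| "unit_power a (Suc n) = unit_power a n + a + P ^ r * unit_power a n * a"

lemma chi_unit_power: "chi (unit_power a n) = chi a ^ n"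
  by (induction n) (simp_all add: chi_mult[OF cong_refl])

lemma ell_unit_power: "[ell (unit_power a n) = int n * ell a] (mod P ^ q)"
proof (induction n)
  case 0
  show ?case using ell_add[of 0 0 0] by (simp add: cong_iff_dvd_diff)
next
  case (Suc n)
  have "[ell (unit_power a (Suc n)) = ell (unit_power a n) + ell a] (mod P ^ q)"
    by (rule ell_add) simp
  also have "[ell (unit_power a n) + ell a = int n * ell a + ell a] (mod P ^ q)"
    by (rule cong_add[OF Suc cong_refl])
  finally show ?case by (simp add: algebra_simps)
qed

lemma residues_R: "residues (P ^ q)"
  using P_gt_1 q_pos by (simp add: residues_def one_less_power)

text \<open>An element \<open>g\<close> with logarithm 1 generates: every class is the
  \<open>ell a\<close>-th power of the class of \<open>g\<close>. So the character is fixed by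
  \<open>chi g\<close>, a \<open>p ^ q\<close>-th root of unity, whose exponent is the conductor
  unit.\<close>

lemma conductor_unit_ex:
  "\<exists>\<kappa>. \<kappa> \<in> Units (R p q) \<and> (\<forall>a. chi a = expi (\<kappa> * ell a) (p ^ q))"
proof -
  interpret residues "P ^ q" "R p q" by (rule residues_R)
  have pq: "p ^ q > 0" "int (p ^ q) = P ^ q" using P_pos by auto
  have gt1: "P ^ q > 1" using P_gt_1 q_pos by (simp add: one_less_power)
  obtain g where g: "ell g = 1" using ell_surj[of 1] gt1 by auto
  have rep: "chi a = chi g ^ nat (ell a)" for a
  proof -
    have "[ell (unit_power g (nat (ell a))) = ell a] (mod P ^ q)"
      using ell_unit_power[of g "nat (ell a)"] g ell_bounds by simp
    hence "ell (unit_power g (nat (ell a))) = ell a" using ell_bounds by (simp add: cong_def)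
    hence "chi (unit_power g (nat (ell a))) = chi a" by (simp only: ell_eq_iff chi_eq_iff)
    thus ?thesis by (simp add: chi_unit_power)
  qed
  have ell_0: "ell 0 = 0" using ell_unit_power[of 0 0] ell_bounds by (simp add: cong_def)
  have "[ell (unit_power g (p ^ q)) = 0] (mod P ^ q)"
    using ell_unit_power[of g "p ^ q"] g by (simp add: cong_def)
  hence "ell (unit_power g (p ^ q)) = ell 0" using ell_bounds by (simp add: cong_def ell_0)
  hence "chi (unit_power g (p ^ q)) = chi 0" by (simp only: ell_eq_iff chi_eq_iff)
  hence "chi g ^ (p ^ q) = 1" by (simp add: chi_unit_power)
  then obtain \<kappa> where k: "0 \<le> \<kappa>" "\<kappa> < P ^ q" "chi g = expi \<kappa> (p ^ q)"
    using root_of_unity_expi[OF pq(1)] by (metis pq(2))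
  have main: "chi a = expi (\<kappa> * ell a) (p ^ q)" for a
    unfolding rep[of a] k(3) using ell_bounds by (simp add: expi_power_nat mult.commute)
  have "coprime \<kappa> P"
  proof (rule ccontr)
    assume "\<not> coprime \<kappa> P"
    hence "P dvd \<kappa>" by (simp add: coprime_P_iff)
    then obtain m where m: "\<kappa> = P * m" ..
    \<comment> \<open>This element represents a class of order \<open>p\<close>. If \<open>p\<close>
      divided \<open>\<kappa>\<close> it would lie in the kernel, against faithfulness.\<close>
    obtain a where a: "ell a = P ^ (q - 1) mod P ^ q" using ell_surj by blast
    have "P ^ (q - 1) < P ^ q" using P_gt_1 q_pos by (simp add: power_strict_increasing)
    hence a: "ell a = P ^ (q - 1)" using a P_pow_pos by simp
    have "P * P ^ (q - 1) = P ^ q" using q_pos by (metis Suc_diff_1 power_Suc less_eq_Suc_le One_nat_def)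
    hence "\<kappa> * ell a = int (p ^ q) * m" using m a by (simp add: mult_ac)
    hence "chi a = 1" by (metis main expi_mult_self pq(1))
    hence "[a = 0] (mod P ^ q)" using chi_eq_iff[of a 0] by simp
    hence "ell a = 0" using ell_eq_iff[of a 0] ell_0 by simp
    with a P_pow_nonzero[of "q - 1"] show False by linarith
  qed
  moreover have "\<kappa> \<noteq> 0" using calculation P_gt_1 by auto
  ultimately have "\<kappa> \<in> Units (R p q)" using k by (simp add: res_units_eq)
  with main show ?thesis by blast
qed

lemma is_conductor_unit_iff:
  "is_conductor_unit p r q \<psi> \<kappa> \<longleftrightarrow> \<kappa> \<in> Units (R p q) \<and> (\<forall>a. chi a = expi (\<kappa> * ell a) (p ^ q))"
proof -
  have "(\<forall>z \<in> carrier (Zp p). chi_at p r q \<psi> z = expi (\<kappa> * norm_log p r q z) (p ^ q)) \<longleftrightarrow>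
      (\<forall>a. chi a = expi (\<kappa> * ell a) (p ^ q))"
  proof (intro iffI ballI allI)
    fix a assume "\<forall>z \<in> carrier (Zp p). chi_at p r q \<psi> z = expi (\<kappa> * norm_log p r q z) (p ^ q)"
    thus "chi a = expi (\<kappa> * ell a) (p ^ q)" by (simp add: chi_def)
  next
    fix z assume "\<forall>a. chi a = expi (\<kappa> * ell a) (p ^ q)" "z \<in> carrier (Zp p)"
    thus "chi_at p r q \<psi> z = expi (\<kappa> * norm_log p r q z) (p ^ q)"
      by (simp only: chi_at_chi norm_log_ell)
  qed
  thus ?thesis by (simp only: is_conductor_unit_def)
qed

lemma conductor_unit: "is_conductor_unit p r q \<psi> (conductor_unit p r q \<psi>)"
proof -
  interpret residues "P ^ q" "R p q" by (rule residues_R)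
  have pq: "p ^ q > 0" "int (p ^ q) = P ^ q" using P_pos by auto
  have gt1: "P ^ q > 1" using P_gt_1 q_pos by (simp add: one_less_power)
  obtain g where g: "ell g = 1" using ell_surj[of 1] gt1 by auto
  have "\<exists>!\<kappa>. is_conductor_unit p r q \<psi> \<kappa>"
  proof (rule ex_ex1I)
    show "\<exists>\<kappa>. is_conductor_unit p r q \<psi> \<kappa>" unfolding is_conductor_unit_iff by (rule conductor_unit_ex)
  next
    fix k l assume kl: "is_conductor_unit p r q \<psi> k" "is_conductor_unit p r q \<psi> l"
    hence "expi k (p ^ q) = expi l (p ^ q)" unfolding is_conductor_unit_iff by (metis g mult.right_neutral)
    hence "[k = l] (mod P ^ q)" using expi_eq_iff[OF pq(1)] pq(2) by simp
    moreover have "0 \<le> k" "k < P ^ q" "0 \<le> l" "l < P ^ q"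
      using kl by (auto simp: is_conductor_unit_iff res_units_eq)
    ultimately show "k = l" by (simp add: cong_def)
  qed
  thus ?thesis unfolding conductor_unit_def by (rule theI')
qed

lemma coprime_conductor_unit: "coprime (conductor_unit p r q \<psi>) P"
proof -
  interpret residues "P ^ q" "R p q" by (rule residues_R)
  show ?thesis using conductor_unit q_pos by (simp add: is_conductor_unit_iff res_units_eq)
qed

text \<open>For an argument deep enough, the normalized logarithm is the identity, and its factor
  \<open>P ^ d\<close> cancels against the order of the root of unity.\<close>

lemma chi_conductor_unit:
  assumes "q \<le> r + 2 * d" "d \<le> q"
  shows "chi (P ^ d * w) = expi (conductor_unit p r q \<psi> * w) (p ^ (q - d))"
proof -
  let ?k = "conductor_unit p r q \<psi>"
  have "[ell (P ^ d * w) = P ^ d * w] (mod P ^ q)"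
    by (rule norm_log_deep[OF _ r_pos _ assms(1)]) (simp_all add: zp_of_int_nth cong_def)
  hence "[?k * ell (P ^ d * w) = ?k * (P ^ d * w)] (mod int (p ^ q))" by (simp add: cong_scalar_left)
  hence "expi (?k * ell (P ^ d * w)) (p ^ q) = expi (?k * (P ^ d * w)) (p ^ q)"
    using P_pos by (subst expi_eq_iff) auto
  also have "expi (?k * (P ^ d * w)) (p ^ q) = expi (int (p ^ d) * (?k * w)) (p ^ d * p ^ (q - d))"
    using assms(2) by (simp add: power_add[symmetric] mult_ac)
  also have "\<dots> = expi (?k * w) (p ^ (q - d))"
    using P_pos by (intro expi_scale) simp
  finally show ?thesis using conductor_unit by (simp add: is_conductor_unit_iff)
qed

end

section \<open>Canonical operators on functions\<close>

text \<open>Both canonical operators have this form, the shift with weight 1. Hence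
  \<open>inv_into\<close> in the definition of the commutator is a genuine inverse on the function
  space.\<close>

lemma bij_betw_monomial:
  fixes m :: "'a \<Rightarrow> complex"
  assumes \<pi>: "bij_betw \<pi> A A" and m: "\<And>b. b \<in> A \<Longrightarrow> m b \<noteq> 0"
  shows "bij_betw (\<lambda>f. \<lambda>b\<in>A. m b * f (\<pi> b)) (A \<rightarrow>\<^sub>E UNIV) (A \<rightarrow>\<^sub>E UNIV)"
  unfolding bij_betw_def
proof (intro conjI inj_onI equalityI subsetI)
  fix f g assume fg: "f \<in> A \<rightarrow>\<^sub>E UNIV" "g \<in> A \<rightarrow>\<^sub>E UNIV"
    and e: "(\<lambda>b\<in>A. m b * f (\<pi> b)) = (\<lambda>b\<in>A. m b * g (\<pi> b))"
  show "f = g"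
  proof (rule PiE_ext[OF fg])
    fix x assume "x \<in> A"
    then obtain b where b: "b \<in> A" "x = \<pi> b" using \<pi> by (auto simp: bij_betw_def)
    thus "f x = g x" using fun_cong[OF e, of b] m[of b] by simp
  qed
next
  fix h :: "'a \<Rightarrow> complex" assume h: "h \<in> A \<rightarrow>\<^sub>E UNIV"
  define f where "f = (\<lambda>x\<in>A. h (inv_into A \<pi> x) / m (inv_into A \<pi> x))"
  have "(\<lambda>b\<in>A. m b * f (\<pi> b)) = h"
  proof
    fix b show "(\<lambda>b\<in>A. m b * f (\<pi> b)) b = h b"
    proof (cases "b \<in> A")
      case True
      hence "\<pi> b \<in> A" "inv_into A \<pi> (\<pi> b) = b" using \<pi> by (auto simp: bij_betw_def)
      thus ?thesis using True m by (simp add: f_def)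
    qed (use h in \<open>auto simp: PiE_def extensional_def\<close>)
  qed
  moreover have "f \<in> A \<rightarrow>\<^sub>E UNIV" by (simp add: f_def)
  ultimately show "h \<in> (\<lambda>f. \<lambda>b\<in>A. m b * f (\<pi> b)) ` (A \<rightarrow>\<^sub>E UNIV)" by blast
qed auto

text \<open>Substituting \<open>f = S (C g)\<close> removes the inverses from a commutator.\<close>

lemma commutator_scalar_iff:
  assumes C: "bij_betw C F F" and S: "bij_betw S F F"
  shows "(\<forall>f\<in>F. (C \<circ> S \<circ> inv_into F C \<circ> inv_into F S) f = h f) \<longleftrightarrow> (\<forall>g\<in>F. C (S g) = h (S (C g)))"
proof (intro iffI ballI)
  fix g assume "\<forall>f\<in>F. (C \<circ> S \<circ> inv_into F C \<circ> inv_into F S) f = h f" and g: "g \<in> F"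
  moreover have "C g \<in> F" "S (C g) \<in> F" using g C S by (auto simp: bij_betw_def)
  ultimately have "C (S (inv_into F C (inv_into F S (S (C g))))) = h (S (C g))" by simp
  thus "C (S g) = h (S (C g))" using g \<open>C g \<in> F\<close> C S by (simp add: bij_betw_def)
next
  fix f assume h: "\<forall>g\<in>F. C (S g) = h (S (C g))" and f: "f \<in> F"
  define g where "g = inv_into F C (inv_into F S f)"
  have "inv_into F S f \<in> F" using f S by (metis bij_betw_def inv_into_into)
  hence "g \<in> F" "C g = inv_into F S f" unfolding g_def
    using C by (metis bij_betw_def inv_into_into, metis bij_betw_inv_into_right)
  moreover have "S (inv_into F S f) = f" using f S by (metis bij_betw_inv_into_right)
  ultimately show "(C \<circ> S \<circ> inv_into F C \<circ> inv_into F S) f = h f" using h by (simp add: g_def)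
qed

context faithful_char
begin

lemma Pq_gt_1: "1 < P ^ q"
  using P_gt_1 q_pos by (simp add: one_less_power)

lemma R_carrier: "carrier (R p q) = {0..<P ^ q}"
  by (auto simp: residue_ring_def)

lemma R_ops: "x \<otimes>\<^bsub>R p q\<^esub> y = (x * y) mod P ^ q" "x \<oplus>\<^bsub>R p q\<^esub> y = (x + y) mod P ^ q"
  "\<one>\<^bsub>R p q\<^esub> = 1" "\<zero>\<^bsub>R p q\<^esub> = 0"
  by (simp_all add: residue_ring_def)

section \<open>Commutators of the canonical operators\<close>

definition phi :: "int \<Rightarrow> int \<Rightarrow> int" where
  "phi c b = b \<otimes>\<^bsub>R p q\<^esub> inv\<^bsub>R p q\<^esub> (\<one>\<^bsub>R p q\<^esub> \<oplus>\<^bsub>R p q\<^esub> ppow p q r \<otimes>\<^bsub>R p q\<^esub> c \<otimes>\<^bsub>R p q\<^esub> b)"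

lemma coprime_one_plus: "coprime (1 + P ^ r * a) (P ^ n)"
proof -
  have "[1 = 1 + P ^ r * a] (mod P)" by (rule cong_sym[OF one_plus_cong_1[OF r_pos]])
  hence "coprime (1 + P ^ r * a) P" by (rule cong_imp_coprime) simp
  thus ?thesis by simp
qed

text \<open>Later arguments use the multiplied-out form and never touch the ring inverse.\<close>

lemma phi:
  shows "phi c b \<in> carrier (R p q)" "[phi c b * (1 + P ^ r * (c * b)) = b] (mod P ^ q)"
proof -
  interpret residues "P ^ q" "R p q" by (rule residues_R)
  define u where "u = \<one>\<^bsub>R p q\<^esub> \<oplus>\<^bsub>R p q\<^esub> ppow p q r \<otimes>\<^bsub>R p q\<^esub> c \<otimes>\<^bsub>R p q\<^esub> b"
  have u: "u = (1 + P ^ r * (c * b)) mod P ^ q"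
    unfolding u_def R_ops ppow_def by (simp add: mod_simps mult.assoc)
  hence "u \<in> Units (R p q)" using mod_in_res_units[OF Pq_gt_1 coprime_one_plus] by simp
  hence inv: "inv\<^bsub>R p q\<^esub> u \<otimes>\<^bsub>R p q\<^esub> u = \<one>\<^bsub>R p q\<^esub>" by (rule Units_l_inv)
  have ph: "phi c b = b \<otimes>\<^bsub>R p q\<^esub> inv\<^bsub>R p q\<^esub> u" by (simp add: phi_def u_def)
  show "phi c b \<in> carrier (R p q)" unfolding ph R_ops R_carrier using P_pow_pos by simp
  have "[phi c b * (1 + P ^ r * (c * b)) = (b * inv\<^bsub>R p q\<^esub> u) * u] (mod P ^ q)"
    unfolding ph R_ops u by (intro cong_mult) (simp_all add: cong_def)
  also have "(b * inv\<^bsub>R p q\<^esub> u) * u = b * (inv\<^bsub>R p q\<^esub> u * u)" by simp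
  also have "[\<dots> = b * 1] (mod P ^ q)"
    using inv Pq_gt_1 by (intro cong_mult cong_refl) (simp add: R_ops cong_def)
  finally show "[phi c b * (1 + P ^ r * (c * b)) = b] (mod P ^ q)" by simp
qed

text \<open>After cross-multiplication the terms with c b b' cancel, as for any fractional linear
  map of determinant one, leaving \<open>b\<close> and \<open>b'\<close> congruent.\<close>

lemma phi_bij: "bij_betw (phi c) (carrier (R p q)) (carrier (R p q))"
proof -
  have "inj_on (phi c) (carrier (R p q))"
  proof (rule inj_onI)
    fix b b' assume b: "b \<in> carrier (R p q)" "b' \<in> carrier (R p q)" and e: "phi c b = phi c b'"
    let ?U = "1 + P ^ r * (c * b)" and ?V = "1 + P ^ r * (c * b')"
    have "[b * ?V = (phi c b * ?U) * ?V] (mod P ^ q)" by (rule cong_mult[OF cong_sym[OF phi(2)] cong_refl])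
    also have "(phi c b * ?U) * ?V = (phi c b' * ?V) * ?U" by (simp add: e)
    also have "[\<dots> = b' * ?U] (mod P ^ q)" by (rule cong_mult[OF phi(2) cong_refl])
    finally have "[b = b'] (mod P ^ q)" by (simp add: cong_iff_dvd_diff algebra_simps)
    thus "b = b'" using b by (simp add: R_carrier cong_def)
  qed
  moreover have "phi c ` carrier (R p q) \<subseteq> carrier (R p q)" using phi(1) by auto
  ultimately show ?thesis
    unfolding bij_betw_def by (metis endo_inj_surj R_carrier finite_atLeastLessThan_int)
qed

lemma opC_eq: "opC p r q \<psi> c = (\<lambda>f. \<lambda>b\<in>carrier (R p q). chi (c * b) * f (phi c b))"
  by (rule ext) (simp add: opC_def phi_def chi_def)

lemma opS_eq: "opS p q s = (\<lambda>f. \<lambda>b\<in>carrier (R p q). 1 * f ((b + s) mod P ^ q))"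
  by (rule ext) (simp add: opS_def R_ops)

lemma opC_bij: "bij_betw (opC p r q \<psi> c) (Fn p q) (Fn p q)"
  unfolding opC_eq Fn_def by (rule bij_betw_monomial[OF phi_bij]) simp

lemma shift_bij: "bij_betw (\<lambda>b. (b + s) mod P ^ q) (carrier (R p q)) (carrier (R p q))"
proof -
  have "inj_on (\<lambda>b. (b + s) mod P ^ q) (carrier (R p q))"
  proof (rule inj_onI)
    fix b b' assume "b \<in> carrier (R p q)" "b' \<in> carrier (R p q)" "(b + s) mod P ^ q = (b' + s) mod P ^ q"
    thus "b = b'" using cong_add_rcancel[of b s b' "P ^ q"] by (simp add: R_carrier cong_def)
  qed
  moreover have "(\<lambda>b. (b + s) mod P ^ q) ` carrier (R p q) \<subseteq> carrier (R p q)"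
    using P_pow_pos by (auto simp: R_carrier)
  ultimately show ?thesis
    unfolding bij_betw_def by (metis endo_inj_surj R_carrier finite_atLeastLessThan_int)
qed

lemma opS_bij: "bij_betw (opS p q s) (Fn p q) (Fn p q)"
  unfolding opS_eq Fn_def by (rule bij_betw_monomial[OF shift_bij]) simp

text \<open>Multiplying by the units \<open>U = 1 + P ^ r * c * b\<close> and
  \<open>V = 1 + P ^ r * c * (b + s)\<close> clears both fractions, and the identity bV + UVs - (b +
  s)U = P^r c s (b + U(b + s)) isolates the obstruction.\<close>

lemma phi_shift_iff:
  assumes b: "b \<in> carrier (R p q)"
  shows "(phi c b + s) mod P ^ q = phi c ((b + s) mod P ^ q) \<longleftrightarrow>
    P ^ q dvd (P ^ r * (c * s)) * (b + (1 + P ^ r * (c * b)) * (b + s))"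
proof -
  let ?b = "(b + s) mod P ^ q"
  let ?U = "1 + P ^ r * (c * b)" and ?V = "1 + P ^ r * (c * (b + s))"
  define y z where "y = phi c b" "z = phi c ?b"
  have zb: "z \<in> {0..<P ^ q}" using phi(1) by (simp add: y_z_def R_carrier)
  have "[?b = b + s] (mod P ^ q)" by (simp add: cong_def)
  hence "[1 + P ^ r * (c * ?b) = ?V] (mod P ^ q)" by (intro cong_add cong_mult cong_refl)
  hence "[z * ?V = z * (1 + P ^ r * (c * ?b))] (mod P ^ q)" by (intro cong_scalar_left) (rule cong_sym)
  also have "[z * (1 + P ^ r * (c * ?b)) = ?b] (mod P ^ q)" unfolding y_z_def by (rule phi(2))
  also have "[?b = b + s] (mod P ^ q)" by (simp add: cong_def)
  finally have z: "[z * ?V = b + s] (mod P ^ q)" .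
  have y: "[y * ?U = b] (mod P ^ q)" unfolding y_z_def by (rule phi(2))
  have "coprime (?U * ?V) (P ^ q)" using coprime_one_plus coprime_mult_left_iff by blast
  hence "[y + s = z] (mod P ^ q) \<longleftrightarrow> [(?U * ?V) * (y + s) = (?U * ?V) * z] (mod P ^ q)"
    by (simp add: cong_mult_lcancel)
  also have "(?U * ?V) * (y + s) = (y * ?U) * ?V + ?U * ?V * s" by (simp add: algebra_simps)
  also have "(?U * ?V) * z = (z * ?V) * ?U" by (simp add: algebra_simps)
  also have "[(y * ?U) * ?V + ?U * ?V * s = (z * ?V) * ?U] (mod P ^ q) \<longleftrightarrow>
      [b * ?V + ?U * ?V * s = (b + s) * ?U] (mod P ^ q)"
  proof -
    have "[(y * ?U) * ?V + ?U * ?V * s = b * ?V + ?U * ?V * s] (mod P ^ q)"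
      by (rule cong_add[OF cong_mult[OF y cong_refl] cong_refl])
    moreover have "[(z * ?V) * ?U = (b + s) * ?U] (mod P ^ q)" by (rule cong_mult[OF z cong_refl])
    ultimately show ?thesis unfolding cong_def by simp
  qed
  also have "\<dots> \<longleftrightarrow> P ^ q dvd (P ^ r * (c * s)) * (b + ?U * (b + s))"
    by (simp add: cong_iff_dvd_diff algebra_simps)
  finally show ?thesis
    using zb by (simp add: cong_def y_z_def)
qed

lemma chi_add: "P ^ q dvd P ^ r * (x * y) \<Longrightarrow> chi (x + y) = chi x * chi y"
  by (rule chi_mult) (simp add: cong_iff_dvd_diff mult.assoc)

text \<open>Both orders of composition are monomial, so scalarity means that the two permutations
  agree and that the ratio of the weights is constant. Agreement of the permutations already forces
  the divisibility, and the divisibility in turn makes the ratio constant.\<close>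

lemma is_scalar_iff:
  assumes s: "s \<in> carrier (R p q)"
  shows "is_scalar p q (can_comm p r q \<psi> c s) \<longleftrightarrow> P ^ q dvd P ^ r * (c * s)"
proof -
  let ?A = "carrier (R p q)" and ?C = "opC p r q \<psi> c" and ?S = "opS p q s"
  have closed: "(x + s) mod P ^ q \<in> ?A" for x using P_pow_pos by (simp add: R_carrier)
  have "is_scalar p q (can_comm p r q \<psi> c s) \<longleftrightarrow>
      (\<exists>l. \<forall>g\<in>Fn p q. ?C (?S g) = (\<lambda>b\<in>?A. l * ?S (?C g) b))"
    unfolding is_scalar_def can_comm_def by (simp only: commutator_scalar_iff[OF opC_bij opS_bij])
  also have "\<dots> \<longleftrightarrow> (\<exists>l. \<forall>g\<in>Fn p q. \<forall>b\<in>?A. chi (c * b) * g ((phi c b + s) mod P ^ q) =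
      l * (chi (c * ((b + s) mod P ^ q)) * g (phi c ((b + s) mod P ^ q))))"
    using phi(1) closed by (simp add: opC_eq opS_eq fun_eq_iff restrict_def Ball_def)
  also have "\<dots> \<longleftrightarrow> P ^ q dvd P ^ r * (c * s)"
  proof
    assume "\<exists>l. \<forall>g\<in>Fn p q. \<forall>b\<in>?A. chi (c * b) * g ((phi c b + s) mod P ^ q) =
      l * (chi (c * ((b + s) mod P ^ q)) * g (phi c ((b + s) mod P ^ q)))"
    then obtain l where l: "\<And>g b. g \<in> Fn p q \<Longrightarrow> b \<in> ?A \<Longrightarrow> chi (c * b) * g ((phi c b + s) mod P ^ q) =
      l * (chi (c * ((b + s) mod P ^ q)) * g (phi c ((b + s) mod P ^ q)))" by blast
    have dvd: "P ^ q dvd (P ^ r * (c * s)) * (b + (1 + P ^ r * (c * b)) * (b + s))" if b: "b \<in> ?A" for b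
    proof (rule ccontr)
      assume "\<not> ?thesis"
      hence ne: "phi c ((b + s) mod P ^ q) \<noteq> (phi c b + s) mod P ^ q" using phi_shift_iff[OF b, of c s] by auto
      \<comment> \<open>A point mass separates the two target points: the left side is nonzero while
        the right side vanishes for every \<open>l\<close>.\<close>
      define g where "g = (\<lambda>x\<in>?A. if x = (phi c b + s) mod P ^ q then 1 else 0 :: complex)"
      have "g \<in> Fn p q" by (simp add: g_def Fn_def)
      from l[OF this b] show False using ne closed phi(1) by (simp add: g_def)
    qed
    \<comment> \<open>The second factor in \<open>dvd\<close> is \<open>2 * b + s\<close> modulo \<open>p\<close>, a unit for \<open>b = 0\<close> or, as \<open>p\<close> is odd, for \<open>b = 1\<close>.\<close>
    show "P ^ q dvd P ^ r * (c * s)"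
    proof (cases "P dvd s")
      case False
      hence "coprime s (P ^ q)" by (simp add: coprime_P_iff[symmetric])
      thus ?thesis using dvd[of 0] P_pow_pos by (simp add: R_carrier coprime_dvd_mult_left_iff coprime_commute)
    next
      case True
      let ?t = "1 + (1 + P ^ r * (c * 1)) * (1 + s)"
      have "\<not> P dvd ?t"
      proof
        assume "P dvd ?t"
        moreover have "P dvd P ^ r" using r_pos by (simp add: dvd_power)
        hence "P dvd s + P ^ r * (c * (1 + s))" using True by simp
        ultimately have "P dvd ?t - (s + P ^ r * (c * (1 + s)))" by (rule dvd_diff)
        also have "?t - (s + P ^ r * (c * (1 + s))) = 2" by (simp add: algebra_simps)
        finally have "P \<le> 2" by (rule zdvd_imp_le) simp
        hence "p = 2" using prime_ge_2_nat[OF p_prime] by simp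
        thus False using odd_p by simp
      qed
      hence "coprime ?t (P ^ q)" by (simp only: coprime_P_iff[symmetric] coprime_P_pow)
      moreover have "P ^ q dvd (P ^ r * (c * s)) * ?t" using dvd[of 1] Pq_gt_1 by (simp add: R_carrier)
      ultimately show ?thesis by (metis coprime_commute coprime_dvd_mult_left_iff)
    qed
  next
    assume d: "P ^ q dvd P ^ r * (c * s)"
    show "\<exists>l. \<forall>g\<in>Fn p q. \<forall>b\<in>?A. chi (c * b) * g ((phi c b + s) mod P ^ q) =
      l * (chi (c * ((b + s) mod P ^ q)) * g (phi c ((b + s) mod P ^ q)))"
    \<comment> \<open>The weights compared are \<open>chi (c * b)\<close> and
      \<open>chi (c * (b + s))\<close>, so the scalar is the inverse of
      \<open>chi (c * s)\<close>.\<close>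
    proof (intro exI[of _ "inverse (chi (c * s))"] ballI)
      fix g b assume b: "b \<in> ?A"
      have "(phi c b + s) mod P ^ q = phi c ((b + s) mod P ^ q)"
        using d by (simp only: phi_shift_iff[OF b] dvd_mult2)
      moreover have "chi (c * ((b + s) mod P ^ q)) = chi (c * b + c * s)"
        unfolding chi_eq_iff by (simp add: cong_def mod_simps distrib_left)
      moreover have "P ^ q dvd P ^ r * ((c * b) * (c * s))"
        using dvd_mult2[OF d, of "b * c"] by (simp add: mult_ac)
      hence "chi (c * b + c * s) = chi (c * b) * chi (c * s)" by (rule chi_add)
      ultimately show "chi (c * b) * g ((phi c b + s) mod P ^ q) =
        inverse (chi (c * s)) * (chi (c * ((b + s) mod P ^ q)) * g (phi c ((b + s) mod P ^ q)))" by simp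
    qed
  qed
  finally show ?thesis .
qed

section \<open>Windows\<close>

lemma pideal_eq:
  assumes "a \<le> q"
  shows "pideal p q a = {c \<in> {0..<P ^ q}. P ^ a dvd c}"
proof (intro equalityI subsetI)
  fix c assume "c \<in> pideal p q a"
  then obtain x where "c = (x * (P ^ a mod P ^ q)) mod P ^ q"
    by (auto simp: pideal_def cgenideal_def R_ops ppow_def)
  hence c: "c = (x * P ^ a) mod P ^ q" by (simp add: mod_simps)
  moreover have "P ^ a dvd P ^ q" using assms by (rule le_imp_power_dvd)
  ultimately show "c \<in> {c \<in> {0..<P ^ q}. P ^ a dvd c}" using P_pow_pos by (simp add: dvd_mod)
next
  fix c assume "c \<in> {c \<in> {0..<P ^ q}. P ^ a dvd c}"
  then obtain k where k: "c = P ^ a * k" "0 \<le> c" "c < P ^ q" by auto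
  have "c = ((k mod P ^ q) * (P ^ a mod P ^ q)) mod P ^ q" using k by (simp add: mod_simps mult.commute)
  moreover have "k mod P ^ q \<in> carrier (R p q)" using P_pow_pos by (simp add: R_carrier)
  ultimately show "c \<in> pideal p q a" by (auto simp: pideal_def cgenideal_def R_ops ppow_def)
qed

lemma P_power_dvd_iff: "P ^ a dvd P ^ b \<longleftrightarrow> a \<le> b"
  using P_gt_1 by (simp add: dvd_power_iff)

text \<open>At \<open>a = q\<close> the ideal is zero and \<open>P ^ q\<close> is not a reduced
  representative, hence the strict inequality.\<close>

lemma pideal_memI: "a < q \<Longrightarrow> P ^ a \<in> pideal p q a"
  using P_gt_1 by (simp add: pideal_eq power_strict_increasing)

lemma zero_in_pideal: "a \<le> q \<Longrightarrow> 0 \<in> pideal p q a"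
  using P_pow_pos by (simp add: pideal_eq)

text \<open>The generators \<open>P ^ a\<close> and \<open>P ^ b\<close> are the extreme case. If
  the inequality fails, both exponents are below \<open>q\<close>, so the generators are reduced and
  can be tested.\<close>

lemma commutators_scalar_iff:
  assumes "a \<le> q" "b \<le> q"
  shows "(\<forall>c \<in> pideal p q a. \<forall>s \<in> pideal p q b. is_scalar p q (can_comm p r q \<psi> c s)) \<longleftrightarrow> q \<le> r + a + b"
proof
  assume sc: "\<forall>c \<in> pideal p q a. \<forall>s \<in> pideal p q b. is_scalar p q (can_comm p r q \<psi> c s)"
  show "q \<le> r + a + b"
  proof (rule ccontr)
    assume "\<not> q \<le> r + a + b"
    hence "a < q" "b < q" "r + a + b < q" by auto
    hence "is_scalar p q (can_comm p r q \<psi> (P ^ a) (P ^ b))" using sc pideal_memI by blast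
    moreover have "P ^ b \<in> carrier (R p q)" using pideal_memI[OF \<open>b < q\<close>] assms by (simp add: pideal_eq R_carrier)
    ultimately have "P ^ q dvd P ^ r * (P ^ a * P ^ b)" by (simp only: is_scalar_iff)
    hence "q \<le> r + (a + b)" by (simp only: power_add[symmetric] P_power_dvd_iff)
    with \<open>r + a + b < q\<close> show False by simp
  qed
next
  assume le: "q \<le> r + a + b"
  show "\<forall>c \<in> pideal p q a. \<forall>s \<in> pideal p q b. is_scalar p q (can_comm p r q \<psi> c s)"
  proof (intro ballI)
    fix c s assume "c \<in> pideal p q a" "s \<in> pideal p q b"
    hence cs: "P ^ a dvd c" "P ^ b dvd s" "s \<in> carrier (R p q)" using assms by (auto simp: pideal_eq R_carrier)
    have "P ^ r * (P ^ a * P ^ b) dvd P ^ r * (c * s)" using cs by (intro mult_dvd_mono dvd_refl)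
    moreover have "P ^ q dvd P ^ r * (P ^ a * P ^ b)"
      using le by (simp only: power_add[symmetric] P_power_dvd_iff add.assoc)
    ultimately have "P ^ q dvd P ^ r * (c * s)" by (rule dvd_trans[rotated])
    thus "is_scalar p q (can_comm p r q \<psi> c s)" by (simp only: is_scalar_iff[OF cs(3)])
  qed
qed

lemma scalar_window_iff:
  "scalar_window p r q \<psi> W \<longleftrightarrow> (\<exists>a b. a \<le> q \<and> b \<le> q \<and> W = window p q a b \<and> q \<le> r + a + b)"
proof -
  have "(\<forall>(c, s) \<in> window p q a b. is_scalar p q (can_comm p r q \<psi> c s)) \<longleftrightarrow> q \<le> r + a + b"
    if "a \<le> q" "b \<le> q" for a b
    unfolding commutators_scalar_iff[OF that, symmetric] window_def by auto
  thus ?thesis unfolding scalar_window_def by blast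
qed

lemma pideal_subset_iff:
  assumes "a \<le> q" "a' \<le> q"
  shows "pideal p q a \<subseteq> pideal p q a' \<longleftrightarrow> a' \<le> a"
proof
  assume sub: "pideal p q a \<subseteq> pideal p q a'"
  show "a' \<le> a"
  proof (cases "a < q")
    case True
    hence "P ^ a \<in> pideal p q a'" using sub pideal_memI by blast
    thus ?thesis using assms(2) by (simp add: pideal_eq P_power_dvd_iff)
  qed (use assms in simp)
next
  assume "a' \<le> a"
  hence "P ^ a' dvd P ^ a" by (rule le_imp_power_dvd)
  thus "pideal p q a \<subseteq> pideal p q a'" using assms by (auto simp: pideal_eq intro: dvd_trans)
qed

lemma window_subset_iff:
  assumes "a \<le> q" "b \<le> q" "a' \<le> q" "b' \<le> q"
  shows "window p q a b \<subseteq> window p q a' b' \<longleftrightarrow> a' \<le> a \<and> b' \<le> b"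
proof -
  have "pideal p q a \<noteq> {}" "pideal p q b \<noteq> {}" using zero_in_pideal assms by blast+
  thus ?thesis
    unfolding window_def using assms by (auto simp: times_subset_iff pideal_subset_iff)
qed

lemma window_eq_iff:
  assumes "a \<le> q" "b \<le> q" "a' \<le> q" "b' \<le> q"
  shows "window p q a b = window p q a' b' \<longleftrightarrow> a = a' \<and> b = b'"
  unfolding set_eq_subset window_subset_iff[OF assms] window_subset_iff[OF assms(3,4,1,2)] by linarith

lemma maximal_scalar_window_iff:
  assumes "r < q"
  shows "maximal_scalar_window p r q \<psi> W \<longleftrightarrow> (\<exists>a b. W = window p q a b \<and> a + b = q - r)"
proof
  assume max: "maximal_scalar_window p r q \<psi> W"
  then obtain a b where ab: "a \<le> q" "b \<le> q" "W = window p q a b" "q \<le> r + a + b"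
    unfolding maximal_scalar_window_def scalar_window_iff by blast
  \<comment> \<open>The exponents are lowered to the line \<open>a' + b' = q - r\<close>, which
    enlarges the window; scalarity of the original one gives \<open>b' \<le> b\<close>.\<close>
  define a' b' where "a' = min a (q - r)" "b' = q - r - a'"
  have ab': "a' \<le> q" "b' \<le> q" "q \<le> r + a' + b'" "a' + b' = q - r" "a' \<le> a" "b' \<le> b"
    using ab assms by (auto simp: a'_b'_def)
  hence "scalar_window p r q \<psi> (window p q a' b')" unfolding scalar_window_iff by blast
  moreover have "W \<subseteq> window p q a' b'" using ab ab' by (simp add: window_subset_iff)
  ultimately have "window p q a' b' = W" using max by (simp add: maximal_scalar_window_def)
  thus "\<exists>a b. W = window p q a b \<and> a + b = q - r" using ab' by blast
next
  assume "\<exists>a b. W = window p q a b \<and> a + b = q - r"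
  then obtain a b where ab: "W = window p q a b" "a + b = q - r" by blast
  hence le: "a \<le> q" "b \<le> q" "q \<le> r + a + b" by auto
  show "maximal_scalar_window p r q \<psi> W"
    unfolding maximal_scalar_window_def
  proof (intro conjI allI impI)
    show "scalar_window p r q \<psi> W" using ab le unfolding scalar_window_iff by blast
    fix W' assume "scalar_window p r q \<psi> W'" and sub: "W \<subseteq> W'"
    then obtain a' b' where ab': "a' \<le> q" "b' \<le> q" "W' = window p q a' b'" "q \<le> r + a' + b'"
      unfolding scalar_window_iff by blast
    hence "a' \<le> a \<and> b' \<le> b" using sub ab le by (simp add: window_subset_iff)
    hence "a' = a \<and> b' = b" using ab ab' assms by auto
    thus "W' = W" using ab ab' by simp
  qed
qed

lemma card_maximal_scalar_windows:
  assumes "r < q"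
  shows "card {W. maximal_scalar_window p r q \<psi> W} = q - r + 1"
proof -
  have "{W. maximal_scalar_window p r q \<psi> W} = (\<lambda>a. window p q a (q - r - a)) ` {..q - r}"
    unfolding maximal_scalar_window_iff[OF assms]
  proof (intro equalityI subsetI)
    fix W assume "W \<in> {W. \<exists>a b. W = window p q a b \<and> a + b = q - r}"
    then obtain a b where ab: "W = window p q a b" "a + b = q - r" by blast
    hence "b = q - r - a" "a \<in> {..q - r}" by auto
    with ab(1) show "W \<in> (\<lambda>a. window p q a (q - r - a)) ` {..q - r}" by simp
  next
    fix W assume "W \<in> (\<lambda>a. window p q a (q - r - a)) ` {..q - r}"
    then obtain a where "a \<le> q - r" "W = window p q a (q - r - a)" by blast
    moreover from this have "a + (q - r - a) = q - r" by simp
    ultimately show "W \<in> {W. \<exists>a b. W = window p q a b \<and> a + b = q - r}" by blast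
  qed
  moreover have "inj_on (\<lambda>a. window p q a (q - r - a)) {..q - r}"
    by (rule inj_onI) (simp add: window_eq_iff)
  ultimately show ?thesis by (simp add: card_image)
qed

section \<open>The bicharacter and its radicals\<close>

lemma pgroup_simps: "carrier (pgroup p q a) = pideal p q a"
  "x \<otimes>\<^bsub>pgroup p q a\<^esub> y = (x + y) mod P ^ q" "\<one>\<^bsub>pgroup p q a\<^esub> = 0"
  by (simp_all add: pgroup_def R_ops)

text \<open>In the cross term P^r (cs)(cs') the part P^r cs is by itself divisible by
  \<open>P ^ q\<close>, so it suffices that one of the two summands lies in the window; similarly in
  the other variable.\<close>

lemma pairB_hom:
  assumes "a \<le> q" "b \<le> q" "q \<le> r + a + b" and c: "P ^ a dvd c" and s: "P ^ b dvd s"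
  shows "chi (c * ((s + s') mod P ^ q)) = chi (c * s) * chi (c * s')"
    and "chi (((c + c') mod P ^ q) * s) = chi (c * s) * chi (c' * s)"
proof -
  have "P ^ r * (P ^ a * P ^ b) dvd P ^ r * (c * s)" using c s by (intro mult_dvd_mono dvd_refl)
  moreover have "P ^ q dvd P ^ r * (P ^ a * P ^ b)"
    using assms(3) by (simp only: power_add[symmetric] P_power_dvd_iff add.assoc)
  ultimately have d: "P ^ q dvd P ^ r * (c * s)" by (rule dvd_trans[rotated])
  have "chi (c * ((s + s') mod P ^ q)) = chi (c * s + c * s')"
    unfolding chi_eq_iff by (simp add: cong_def mod_simps distrib_left)
  also have "\<dots> = chi (c * s) * chi (c * s')"
    by (rule chi_add) (use dvd_mult2[OF d, of "c * s'"] in \<open>simp add: mult_ac\<close>)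
  finally show "chi (c * ((s + s') mod P ^ q)) = chi (c * s) * chi (c * s')" .
  have "chi (((c + c') mod P ^ q) * s) = chi (c * s + c' * s)"
    unfolding chi_eq_iff by (simp add: cong_def mod_simps distrib_right)
  also have "\<dots> = chi (c * s) * chi (c' * s)"
    by (rule chi_add) (use dvd_mult2[OF d, of "c' * s"] in \<open>simp add: mult_ac\<close>)
  finally show "chi (((c + c') mod P ^ q) * s) = chi (c * s) * chi (c' * s)" .
qed

lemma bicharacter_pairB:
  assumes "a \<le> q" "b \<le> q" "q \<le> r + a + b"
  shows "bicharacter (pgroup p q a) (pgroup p q b) (pairB p r q \<psi>)"
  unfolding bicharacter_def hom_def pgroup_simps Cx_def pairB_chi
  using assms pairB_hom[OF assms] by (auto simp: pideal_eq)

lemma dvd_mult_all_iff: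
  assumes "b \<le> q"
  shows "(\<forall>s \<in> pideal p q b. P ^ q dvd c * s) \<longleftrightarrow> P ^ (q - b) dvd c"
proof
  assume "\<forall>s \<in> pideal p q b. P ^ q dvd c * s"
  \<comment> \<open>Reducing the generator covers \<open>b = q\<close>, where it becomes 0.\<close>
  moreover have "P ^ b mod P ^ q \<in> pideal p q b"
    using assms P_pow_pos by (simp add: pideal_eq dvd_mod le_imp_power_dvd)
  ultimately have "P ^ q dvd c * (P ^ b mod P ^ q)" by blast
  hence "P ^ q dvd c * P ^ b" by (simp add: dvd_eq_mod_eq_0 mod_simps)
  hence "P ^ ((q - b) + b) dvd (P ^ b * 1) * c" using assms by (simp add: mult.commute)
  thus "P ^ (q - b) dvd c" by (rule dvd_cancel_power) simp
next
  assume d: "P ^ (q - b) dvd c"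
  show "\<forall>s \<in> pideal p q b. P ^ q dvd c * s"
  proof
    fix s assume "s \<in> pideal p q b"
    hence "P ^ b dvd s" using assms by (simp add: pideal_eq)
    with d have "P ^ (q - b) * P ^ b dvd c * s" by (rule mult_dvd_mono)
    thus "P ^ q dvd c * s" using assms by (simp add: power_add[symmetric])
  qed
qed

lemma P_max_dvd_iff: "P ^ max a b dvd c \<longleftrightarrow> P ^ a dvd c \<and> P ^ b dvd c"
  by (metis dvd_trans le_imp_power_dvd max.cobounded1 max.cobounded2 max_def)

lemma RadA_eq: "a \<le> q \<Longrightarrow> b \<le> q \<Longrightarrow> RadA p r q \<psi> a b = pideal p q (max a (q - b))"
  by (auto simp: RadA_def pairB_chi chi_eq_1_iff dvd_mult_all_iff pideal_eq[of a] pideal_eq[of "max a (q - b)"] P_max_dvd_iff)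

lemma RadB_eq:
  assumes "a \<le> q" "b \<le> q"
  shows "RadB p r q \<psi> a b = pideal p q (max b (q - a))"
proof -
  have "(\<forall>c \<in> pideal p q a. P ^ q dvd c * s) \<longleftrightarrow> P ^ (q - a) dvd s" for s
    using dvd_mult_all_iff[OF assms(1), of s] by (simp add: mult.commute)
  thus ?thesis
    using assms by (auto simp: RadB_def pairB_chi chi_eq_1_iff pideal_eq[of b] pideal_eq[of "max b (q - a)"] P_max_dvd_iff)
qed

end

section \<open>Perfect pairings of cyclic groups\<close>

lemma iso_residue_group:
  assumes f: "f \<in> iso (add_monoid (residue_ring (int m))) G" and m: "m > 1"
  shows "bij_betw f {0..<int m} (carrier G)"
    and "f ((x + y) mod int m) = f (x mod int m) \<otimes>\<^bsub>G\<^esub> f (y mod int m)"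
proof -
  have car: "carrier (add_monoid (residue_ring (int m))) = {0..<int m}"
    by (auto simp: residue_ring_def)
  show "bij_betw f {0..<int m} (carrier G)" using f unfolding iso_def car by simp
  have mem: "k mod int m \<in> carrier (add_monoid (residue_ring (int m)))" for k unfolding car using m by simp
  have "f ((x mod int m) \<otimes>\<^bsub>add_monoid (residue_ring (int m))\<^esub> (y mod int m)) = f (x mod int m) \<otimes>\<^bsub>G\<^esub> f (y mod int m)"
    using f mem unfolding iso_def by (blast intro: hom_mult)
  thus "f ((x + y) mod int m) = f (x mod int m) \<otimes>\<^bsub>G\<^esub> f (y mod int m)"
    by (simp add: residue_ring_def mod_simps)
qed

lemma iso_residue_group_obtain:
  assumes f: "f \<in> iso (add_monoid (residue_ring (int m))) G" and m: "m > 1" and x: "x \<in> carrier G"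
  obtains i where "0 \<le> i" "i < int m" "x = f i"
proof -
  have "x \<in> f ` {0..<int m}" using iso_residue_group(1)[OF f m] x by (simp add: bij_betw_def)
  thus thesis using that by auto
qed

lemma cyclic_pairing_hom:
  assumes m: "m > 1"
    and g: "g \<in> iso (add_monoid (residue_ring (int m))) H"
    and b: "\<And>y. 0 \<le> y \<Longrightarrow> y < int m \<Longrightarrow> b (g y) = expi (k * y) m"
  shows "b \<in> hom H Cx"
  unfolding hom_def
proof (safe, goal_cases)
  case (1 y)
  then obtain j where "0 \<le> j" "j < int m" "y = g j"
    using iso_residue_group_obtain[OF g m] by blast
  thus ?case using b by (simp add: Cx_def expi_def)
next
  case (2 y z)
  obtain i where i: "0 \<le> i" "i < int m" "y = g i" using iso_residue_group_obtain[OF g m 2(1)] .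
  obtain j where j: "0 \<le> j" "j < int m" "z = g j" using iso_residue_group_obtain[OF g m 2(2)] .
  note ij = i j
  have "y \<otimes>\<^bsub>H\<^esub> z = g ((i + j) mod int m)" using iso_residue_group(2)[OF g m, of i j] ij by simp
  hence "b (y \<otimes>\<^bsub>H\<^esub> z) = expi (k * ((i + j) mod int m)) m" using b m by simp
  also have "\<dots> = expi (k * i + k * j) m"
    using m by (subst expi_eq_iff) (auto simp: cong_def mod_simps distrib_left)
  finally show ?case using b ij by (simp add: expi_add Cx_def)
qed

text \<open>A character of a cyclic group is determined by its value at the generator
  \<open>g 1\<close>, which is an \<open>m\<close>-th root of unity and thus some
  \<open>expi j m\<close>.\<close>

lemma hom_cyclic_eq_expi:
  assumes m: "m > 1"
    and g: "g \<in> iso (add_monoid (residue_ring (int m))) H"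
    and h: "h \<in> hom H Cx"
  obtains j where "\<And>y. 0 \<le> y \<Longrightarrow> y < int m \<Longrightarrow> h (g y) = expi (j * y) m"
proof -
  note gi = iso_residue_group[OF g m]
  have mem: "g (k mod int m) \<in> carrier H" for k using gi(1) m by (auto simp: bij_betw_def)
  have add: "h (g ((x + y) mod int m)) = h (g (x mod int m)) * h (g (y mod int m))" for x y
    unfolding gi(2) using h mem by (simp add: hom_def Cx_def)
  have nz: "h (g (x mod int m)) \<noteq> 0" for x using h mem by (auto simp: hom_def Cx_def)
  have h0: "h (g 0) = 1" using add[of 0 0] nz[of 0] by simp
  have pow: "h (g (int k mod int m)) = h (g (1 mod int m)) ^ k" for k
  proof (induction k)
    case (Suc k)
    thus ?case using add[of 1 "int k"] by simp
  qed (simp add: h0)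
  have "h (g (1 mod int m)) ^ m = 1" using pow[of m] h0 by simp
  then obtain j where j: "h (g (1 mod int m)) = expi j m"
    using root_of_unity_expi[of m] m by (metis less_trans zero_less_one)
  have "h (g y) = expi (j * y) m" if "0 \<le> y" "y < int m" for y
    using pow[of "nat y"] that j by (simp add: expi_power_nat mult.commute)
  thus thesis by (rule that)
qed

text \<open>Evaluation at the generator \<open>g 1\<close> settles both halves: the value there is
  \<open>expi (\<kappa> * i) m\<close>, and since \<open>\<kappa>\<close> is a unit modulo
  \<open>m\<close>, every root of unity occurs for exactly one residue \<open>i\<close>.\<close>

lemma cyclic_pairing_iso:
  assumes m: "m > 1" and \<kappa>: "coprime \<kappa> (int m)"
    and f: "f \<in> iso (add_monoid (residue_ring (int m))) G"
    and g: "g \<in> iso (add_monoid (residue_ring (int m))) H"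
    and b: "\<And>x y. 0 \<le> x \<Longrightarrow> x < int m \<Longrightarrow> 0 \<le> y \<Longrightarrow> y < int m \<Longrightarrow> b (f x) (g y) = expi (\<kappa> * x * y) m"
  shows "(\<lambda>x. \<lambda>y \<in> carrier H. b x y) \<in> iso G (char_grp H)"
proof -
  note fi = iso_residue_group[OF f m] and gi = iso_residue_group[OF g m]
  have fE: "\<exists>i. 0 \<le> i \<and> i < int m \<and> x = f i" if "x \<in> carrier G" for x
    using iso_residue_group_obtain[OF f m that] by metis
  have gE: "\<exists>i. 0 \<le> i \<and> i < int m \<and> y = g i" if "y \<in> carrier H" for y
    using iso_residue_group_obtain[OF g m that] by metis
  have gmem: "g i \<in> carrier H" if "0 \<le> i" "i < int m" for i
    using gi(1) that by (auto simp: bij_betw_def)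
  have hom1: "b x \<in> hom H Cx" if x: "x \<in> carrier G" for x
  proof -
    obtain i where "0 \<le> i" "i < int m" "x = f i" using fE[OF x] by blast
    thus ?thesis using b by (intro cyclic_pairing_hom[OF m g, where k = "\<kappa> * i"]) simp
  qed
  have hom2: "(\<lambda>x. b x y) \<in> hom G Cx" if y: "y \<in> carrier H" for y
  proof -
    obtain j where "0 \<le> j" "j < int m" "y = g j" using gE[OF y] by blast
    thus ?thesis using b by (intro cyclic_pairing_hom[OF m f, where k = "\<kappa> * j"]) (simp add: mult_ac)
  qed
  \<comment> \<open>Elements of \<open>char_grp H\<close> are extensional functions. For a
    restriction to remain a homomorphism, \<open>H\<close> must be closed under its product, which
    is transported from Z/m along \<open>g\<close>.\<close>
  have closed: "y \<otimes>\<^bsub>H\<^esub> z \<in> carrier H" if yz: "y \<in> carrier H" "z \<in> carrier H" for y z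
  proof -
    obtain i j where "0 \<le> i" "i < int m" "y = g i" "0 \<le> j" "j < int m" "z = g j" using gE[OF yz(1)] gE[OF yz(2)] by blast
    hence "y \<otimes>\<^bsub>H\<^esub> z = g ((i + j) mod int m)" using gi(2)[of i j] by simp
    thus ?thesis using gmem m by simp
  qed
  have restr: "restrict h (carrier H) \<in> hom H Cx" if "h \<in> hom H Cx" for h
    using that closed by (auto simp: hom_def Pi_def)
  show ?thesis
    unfolding iso_def
  proof (safe intro!: bij_betw_imageI)
    show "(\<lambda>x. \<lambda>y \<in> carrier H. b x y) \<in> hom G (char_grp H)"
      unfolding hom_def[of G]
    proof (safe, goal_cases)
      case (1 x) thus ?case using hom1 by (simp add: char_grp_def restr)
    next
      case (2 x x')
      thus ?case using hom2 by (auto simp: char_grp_def hom_def Cx_def fun_eq_iff restrict_def)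
    qed
  next
    show "inj_on (\<lambda>x. \<lambda>y \<in> carrier H. b x y) (carrier G)"
    proof (rule inj_onI)
      fix x x' assume x: "x \<in> carrier G" "x' \<in> carrier G"
        and e: "(\<lambda>y \<in> carrier H. b x y) = (\<lambda>y \<in> carrier H. b x' y)"
      obtain i j where ij: "0 \<le> i" "i < int m" "x = f i" "0 \<le> j" "j < int m" "x' = f j" using fE[OF x(1)] fE[OF x(2)] by blast
      have "b x (g 1) = b x' (g 1)" using fun_cong[OF e, of "g 1"] gmem[of 1] m by simp
      hence "expi (\<kappa> * i) m = expi (\<kappa> * j) m" using b[of _ 1] ij m by simp
      hence "[\<kappa> * i = \<kappa> * j] (mod int m)" using m by (simp add: expi_eq_iff)
      hence "[i = j] (mod int m)" using \<kappa> by (simp add: cong_mult_lcancel)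
      thus "x = x'" using ij by (simp add: cong_def)
    qed
  next
    fix x assume "x \<in> carrier G"
    thus "(\<lambda>y \<in> carrier H. b x y) \<in> carrier (char_grp H)" using hom1 by (simp add: char_grp_def restr)
  next
    fix h assume "h \<in> carrier (char_grp H)"
    hence h: "h \<in> hom H Cx" "h \<in> extensional (carrier H)" by (auto simp: char_grp_def)
    obtain j where j: "\<And>y. 0 \<le> y \<Longrightarrow> y < int m \<Longrightarrow> h (g y) = expi (j * y) m"
      using hom_cyclic_eq_expi[OF m g h(1)] by metis
    obtain l where l: "[\<kappa> * l = 1] (mod int m)" using cong_solve_coprime_int[OF \<kappa>] by blast
    define x where "x = (l * j) mod int m"
    have x: "0 \<le> x" "x < int m" using m by (auto simp: x_def)
    have "[\<kappa> * x = (\<kappa> * l) * j] (mod int m)" by (simp add: x_def cong_def mod_simps mult.assoc)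
    also have "[(\<kappa> * l) * j = 1 * j] (mod int m)" by (rule cong_mult[OF l cong_refl])
    finally have kx: "[\<kappa> * x = j] (mod int m)" by simp
    have "(\<lambda>y \<in> carrier H. b (f x) y) = h"
    proof
      fix y show "(\<lambda>y \<in> carrier H. b (f x) y) y = h y"
      proof (cases "y \<in> carrier H")
        case True
        then obtain i where i: "0 \<le> i" "i < int m" "y = g i" using gE by blast
        have "[\<kappa> * x * i = j * i] (mod int m)" by (rule cong_mult[OF kx cong_refl])
        hence "expi (\<kappa> * x * i) m = expi (j * i) m" using m by (simp add: expi_eq_iff)
        thus ?thesis using True i b[OF x] j by simp
      qed (use h(2) in \<open>auto simp: extensional_def\<close>)
    qed
    moreover have "f x \<in> carrier G" using fi(1) x by (auto simp: bij_betw_def)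
    ultimately show "h \<in> (\<lambda>x. \<lambda>y \<in> carrier H. b x y) ` carrier G" by blast
  qed
qed

lemma perfect_pairing_cyclic:
  assumes m: "m > 1" and \<kappa>: "coprime \<kappa> (int m)"
    and f: "f \<in> iso (add_monoid (residue_ring (int m))) G"
    and g: "g \<in> iso (add_monoid (residue_ring (int m))) H"
    and b: "\<And>x y. 0 \<le> x \<Longrightarrow> x < int m \<Longrightarrow> 0 \<le> y \<Longrightarrow> y < int m \<Longrightarrow> b (f x) (g y) = expi (\<kappa> * x * y) m"
  shows "perfect_pairing m G H b"
proof -
  have fE: "\<exists>i. 0 \<le> i \<and> i < int m \<and> x = f i" if "x \<in> carrier G" for x
    using iso_residue_group_obtain[OF f m that] by metis
  have gE: "\<exists>i. 0 \<le> i \<and> i < int m \<and> y = g i" if "y \<in> carrier H" for y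
    using iso_residue_group_obtain[OF g m that] by metis
  have "bicharacter G H b"
    unfolding bicharacter_def
  proof (intro conjI ballI)
    fix x assume "x \<in> carrier G"
    then obtain i where "0 \<le> i" "i < int m" "x = f i" using fE by blast
    thus "b x \<in> hom H Cx" using b by (intro cyclic_pairing_hom[OF m g, where k = "\<kappa> * i"]) simp
  next
    fix y assume "y \<in> carrier H"
    then obtain j where "0 \<le> j" "j < int m" "y = g j" using gE by blast
    thus "(\<lambda>x. b x y) \<in> hom G Cx"
      using b by (intro cyclic_pairing_hom[OF m f, where k = "\<kappa> * j"]) (simp add: mult_ac)
  qed
  moreover have "b x y \<in> carrier (mu m)" if xy: "x \<in> carrier G" "y \<in> carrier H" for x y
  proof -
    obtain i j where "0 \<le> i" "i < int m" "x = f i" "0 \<le> j" "j < int m" "y = g j"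
      using fE[OF xy(1)] gE[OF xy(2)] by blast
    thus ?thesis using b m by (simp add: mu_def expi_power_1)
  qed
  moreover have "(\<lambda>y. \<lambda>x \<in> carrier G. b x y) \<in> iso H (char_grp G)"
    using b by (intro cyclic_pairing_iso[OF m \<kappa> g f]) (simp add: mult_ac)
  ultimately show ?thesis
    unfolding perfect_pairing_def using cyclic_pairing_iso[OF m \<kappa> f g b] by blast
qed

section \<open>Heisenberg extensions\<close>

lemma group_mu: "m > 0 \<Longrightarrow> group (mu m)"
proof (rule groupI)
  fix x assume x: "x \<in> carrier (mu m)" and "m > 0"
  hence "x \<noteq> 0" by (auto simp: mu_def zero_power)
  with x have "inverse x \<in> carrier (mu m)" "inverse x \<otimes>\<^bsub>mu m\<^esub> x = \<one>\<^bsub>mu m\<^esub>"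
    by (auto simp: mu_def power_inverse)
  thus "\<exists>y\<in>carrier (mu m). y \<otimes>\<^bsub>mu m\<^esub> x = \<one>\<^bsub>mu m\<^esub>" by blast
qed (auto simp: mu_def power_mult_distrib)

locale bicharacter_pair = G: group G + H: group H
  for G :: "('a, 'm) monoid_scheme" and H :: "('b, 'n) monoid_scheme" +
  fixes m :: nat and b :: "'a \<Rightarrow> 'b \<Rightarrow> complex"
  assumes m_pos: "m > 0" and bichar: "bicharacter G H b"
    and mu_valued: "\<And>x y. x \<in> carrier G \<Longrightarrow> y \<in> carrier H \<Longrightarrow> b x y \<in> carrier (mu m)"
begin

abbreviation "E \<equiv> heisenberg m G H b"

lemma b_mult_left: "x \<in> carrier G \<Longrightarrow> x' \<in> carrier G \<Longrightarrow> y \<in> carrier H \<Longrightarrow> b (x \<otimes>\<^bsub>G\<^esub> x') y = b x y * b x' y"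
  and b_mult_right: "x \<in> carrier G \<Longrightarrow> y \<in> carrier H \<Longrightarrow> y' \<in> carrier H \<Longrightarrow> b x (y \<otimes>\<^bsub>H\<^esub> y') = b x y * b x y'"
  and b_nonzero: "x \<in> carrier G \<Longrightarrow> y \<in> carrier H \<Longrightarrow> b x y \<noteq> 0"
  using bichar by (auto simp: bicharacter_def hom_def Cx_def)

lemma b_one: "y \<in> carrier H \<Longrightarrow> b \<one>\<^bsub>G\<^esub> y = 1" "x \<in> carrier G \<Longrightarrow> b x \<one>\<^bsub>H\<^esub> = 1"
  using b_mult_left[of "\<one>\<^bsub>G\<^esub>" "\<one>\<^bsub>G\<^esub>" y] b_mult_right[of x "\<one>\<^bsub>H\<^esub>" "\<one>\<^bsub>H\<^esub>"]
    b_nonzero[of "\<one>\<^bsub>G\<^esub>" y] b_nonzero[of x "\<one>\<^bsub>H\<^esub>"] by auto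

lemma b_power: "x \<in> carrier G \<Longrightarrow> y \<in> carrier H \<Longrightarrow> b x y ^ m = 1"
  using mu_valued by (simp add: mu_def)

lemma E_simps: "carrier E = carrier (mu m) \<times> carrier G \<times> carrier H"
  "(z, x, y) \<otimes>\<^bsub>E\<^esub> (z', x', y') = (z * z' * b x y', x \<otimes>\<^bsub>G\<^esub> x', y \<otimes>\<^bsub>H\<^esub> y')"
  "\<one>\<^bsub>E\<^esub> = (1, \<one>\<^bsub>G\<^esub>, \<one>\<^bsub>H\<^esub>)"
  by (simp_all add: heisenberg_def)

lemma group_heisenberg: "group E"
proof (rule groupI)
  fix u assume "u \<in> carrier E"
  then obtain z x y where u: "u = (z, x, y)" "z ^ m = 1" "x \<in> carrier G" "y \<in> carrier H"
    by (auto simp: E_simps mu_def)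
  have z: "z \<noteq> 0" using u(2) m_pos by (auto simp: zero_power)
  \<comment> \<open>The factor \<open>b x y\<close> compensates the cocycle value
    \<open>b (inv x) y\<close>, which is its inverse.\<close>
  let ?v = "(inverse z * b x y, inv\<^bsub>G\<^esub> x, inv\<^bsub>H\<^esub> y)"
  have v: "?v \<in> carrier E" using u by (simp add: E_simps mu_def power_mult_distrib power_inverse b_power)
  have "b x y * b (inv\<^bsub>G\<^esub> x) y = 1" using b_mult_left[of x "inv\<^bsub>G\<^esub> x" y] u by (simp add: b_one)
  moreover have "inverse z * b x y * z * b (inv\<^bsub>G\<^esub> x) y = (inverse z * z) * (b x y * b (inv\<^bsub>G\<^esub> x) y)"
    by (simp only: mult_ac)
  ultimately have "inverse z * b x y * z * b (inv\<^bsub>G\<^esub> x) y = 1" using z by simp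
  hence "?v \<otimes>\<^bsub>E\<^esub> u = \<one>\<^bsub>E\<^esub>" using u by (simp add: E_simps)
  with v show "\<exists>v\<in>carrier E. v \<otimes>\<^bsub>E\<^esub> u = \<one>\<^bsub>E\<^esub>" by blast
next
  fix u v w assume "u \<in> carrier E" "v \<in> carrier E" "w \<in> carrier E"
  thus "u \<otimes>\<^bsub>E\<^esub> v \<otimes>\<^bsub>E\<^esub> w = u \<otimes>\<^bsub>E\<^esub> (v \<otimes>\<^bsub>E\<^esub> w)"
    by (cases u; cases v; cases w)
      (auto simp: E_simps G.m_assoc H.m_assoc b_mult_left b_mult_right)
qed (auto simp: E_simps mu_def power_mult_distrib b_power b_one)

lemma heisenberg_central_extension: "central_extension (mu m) E (G \<times>\<times> H) (heis_incl G H) snd"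
  unfolding central_extension_def
proof (intro conjI ballI)
  show "group (mu m)" by (rule group_mu[OF m_pos])
  show "group E" by (rule group_heisenberg)
  show "group (G \<times>\<times> H)" by (intro DirProd_group G.is_group H.is_group)
  show "heis_incl G H \<in> mon (mu m) E"
    unfolding mon_def hom_def by (auto simp: heis_incl_def E_simps b_one inj_on_def) (auto simp: mu_def)
  show "snd \<in> epi E (G \<times>\<times> H)"
  proof -
    have "1 \<in> carrier (mu m)" by (simp add: mu_def)
    hence "carrier (mu m) \<noteq> {}" by blast
    thus ?thesis by (auto simp: epi_def hom_def E_simps snd_image_times)
  qed
  show "kernel E (G \<times>\<times> H) snd = heis_incl G H ` carrier (mu m)"
    unfolding kernel_def by (auto simp: E_simps heis_incl_def)
  fix n e assume "n \<in> carrier (mu m)" "e \<in> carrier E"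
  thus "heis_incl G H n \<otimes>\<^bsub>E\<^esub> e = e \<otimes>\<^bsub>E\<^esub> heis_incl G H n"
    by (cases e) (simp add: E_simps heis_incl_def b_one)
qed

text \<open>Only the product with \<open>u\<close> on the left picks up a nontrivial cocycle value,
  namely \<open>b x y\<close>; the opposite product has \<open>b\<close> at the two identities,
  which is 1. The central coordinates of the lifts cancel.\<close>

lemma heisenberg_commutator:
  assumes u: "u \<in> carrier E" "snd u = (x, \<one>\<^bsub>H\<^esub>)" and v: "v \<in> carrier E" "snd v = (\<one>\<^bsub>G\<^esub>, y)"
  shows "grp_comm E u v = heis_incl G H (b x y)"
proof -
  interpret E: group E by (rule group_heisenberg)
  obtain z z' where uv: "u = (z, x, \<one>\<^bsub>H\<^esub>)" "v = (z', \<one>\<^bsub>G\<^esub>, y)" using u(2) v(2) by (cases u; cases v) auto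
  have xy: "x \<in> carrier G" "y \<in> carrier H" using u(1) v(1) uv by (auto simp: E_simps)
  let ?i = "heis_incl G H (b x y)"
  have i: "?i \<in> carrier E" using mu_valued[OF xy] by (simp add: heis_incl_def E_simps)
  have "u \<otimes>\<^bsub>E\<^esub> v = ?i \<otimes>\<^bsub>E\<^esub> (v \<otimes>\<^bsub>E\<^esub> u)" using xy by (simp add: uv E_simps heis_incl_def b_one)
  hence "grp_comm E u v = ?i \<otimes>\<^bsub>E\<^esub> (v \<otimes>\<^bsub>E\<^esub> u) \<otimes>\<^bsub>E\<^esub> inv\<^bsub>E\<^esub> u \<otimes>\<^bsub>E\<^esub> inv\<^bsub>E\<^esub> v"
    by (simp only: grp_comm_def)
  also have "\<dots> = ?i"
    using u(1) v(1) i by (simp add: E.m_assoc E.inv_solve_right')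
  finally show ?thesis .
qed

lemma order_heisenberg: "Coset.order E = m * (Coset.order G * Coset.order H)"
proof -
  have "card (carrier (mu m)) = m" unfolding mu_def using card_roots_unity_eq[OF m_pos] by simp
  thus ?thesis by (simp add: Coset.order_def E_simps card_cartesian_product)
qed

end

context faithful_char
begin

section \<open>Residual groups\<close>

lemma pr_gt_1: "p ^ r > 1"
  by (rule one_less_power[OF prime_gt_1_nat[OF p_prime]]) (use r_pos in simp)

context
  fixes a :: nat
  assumes a: "a + r \<le> q"
begin

lemma comm_group_pgroup: "comm_group (pgroup p q a)"
proof (rule comm_groupI)
  have P: "P ^ a dvd P ^ q" using a by (simp add: P_power_dvd_iff)
  fix x y assume "x \<in> carrier (pgroup p q a)" "y \<in> carrier (pgroup p q a)"
  hence "P ^ a dvd x + y" using a by (simp add: pgroup_simps pideal_eq)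
  hence "P ^ a dvd (x + y) mod P ^ q" using P by (simp add: dvd_mod)
  thus "x \<otimes>\<^bsub>pgroup p q a\<^esub> y \<in> carrier (pgroup p q a)"
    using a P_pow_pos by (simp add: pgroup_simps pideal_eq)
next
  have P: "P ^ a dvd P ^ q" using a by (simp add: P_power_dvd_iff)
  fix x assume x: "x \<in> carrier (pgroup p q a)"
  hence "P ^ a dvd (- x) mod P ^ q" using a P by (simp add: pgroup_simps pideal_eq dvd_mod)
  hence "(- x) mod P ^ q \<in> carrier (pgroup p q a)" using a P_pow_pos by (simp add: pgroup_simps pideal_eq)
  moreover have "((- x) mod P ^ q) \<otimes>\<^bsub>pgroup p q a\<^esub> x = \<one>\<^bsub>pgroup p q a\<^esub>"
    by (simp add: pgroup_simps mod_simps)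
  ultimately show "\<exists>y\<in>carrier (pgroup p q a). y \<otimes>\<^bsub>pgroup p q a\<^esub> x = \<one>\<^bsub>pgroup p q a\<^esub>" by blast
qed (use a zero_in_pideal in \<open>auto simp: pgroup_simps pideal_eq mod_simps add_ac\<close>)

lemma resid_class_eq:
  "resid_class p r q a c = {d \<in> {0..<P ^ q}. [d = c] (mod P ^ (a + r))}"
proof (intro equalityI subsetI)
  have P: "P ^ (a + r) dvd P ^ q" using a by (simp add: P_power_dvd_iff)
  fix d
  {
    assume "d \<in> resid_class p r q a c"
    then obtain h where h: "h \<in> pideal p q (a + r)" "d = (h + c) mod P ^ q"
      by (auto simp: resid_class_def r_coset_def pgroup_simps)
    have "[d = h + c] (mod P ^ (a + r))" unfolding h(2) cong_def using a by (simp add: mod_power_mod)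
    moreover have "[h + c = 0 + c] (mod P ^ (a + r))"
      using h(1) a by (intro cong_add cong_refl) (simp add: pideal_eq cong_0_iff)
    ultimately have "[d = c] (mod P ^ (a + r))" by (metis cong_trans add_0)
    thus "d \<in> {d \<in> {0..<P ^ q}. [d = c] (mod P ^ (a + r))}" using h(2) P_pow_pos by simp
  next
    assume d: "d \<in> {d \<in> {0..<P ^ q}. [d = c] (mod P ^ (a + r))}"
    have mem: "(d - c) mod P ^ q \<in> pideal p q (a + r)"
      using d P P_pow_pos a by (simp add: pideal_eq dvd_mod cong_iff_dvd_diff)
    have "((d - c) mod P ^ q + c) mod P ^ q = d" using d by (simp add: mod_simps)
    thus "d \<in> resid_class p r q a c"
      unfolding resid_class_def r_coset_def pgroup_simps by (intro UN_I[OF mem]) simp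
  }
qed

lemma resid_class_eq_iff:
  assumes "c \<in> pideal p q a"
  shows "resid_class p r q a c = resid_class p r q a d \<longleftrightarrow> [c = d] (mod P ^ (a + r))"
proof
  assume e: "resid_class p r q a c = resid_class p r q a d"
  have "c \<in> resid_class p r q a c" using assms a by (simp add: resid_class_eq pideal_eq)
  hence "c \<in> resid_class p r q a d" unfolding e .
  thus "[c = d] (mod P ^ (a + r))" by (simp add: resid_class_eq)
next
  assume "[c = d] (mod P ^ (a + r))"
  thus "resid_class p r q a c = resid_class p r q a d" by (simp add: resid_class_eq cong_def)
qed

lemma normal_pideal: "pideal p q (a + r) \<lhd> pgroup p q a"
proof -
  interpret comm_group "pgroup p q a" by (rule comm_group_pgroup)
  have "subgroup (pideal p q (a + r)) (pgroup p q a)"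
  proof (rule subgroupI)
    show "pideal p q (a + r) \<subseteq> carrier (pgroup p q a)" using a by (simp add: pgroup_simps pideal_subset_iff)
    show "pideal p q (a + r) \<noteq> {}" using zero_in_pideal[OF a] by blast
  next
    have P: "P ^ (a + r) dvd P ^ q" using a by (simp add: P_power_dvd_iff)
    fix x assume x: "x \<in> pideal p q (a + r)"
    have "pideal p q (a + r) \<subseteq> carrier (pgroup p q a)" using a by (simp add: pgroup_simps pideal_subset_iff)
    with x have "x \<in> carrier (pgroup p q a)" by blast
    moreover have m: "(- x) mod P ^ q \<in> pideal p q (a + r)"
      using x a P P_pow_pos by (simp add: pideal_eq dvd_mod)
    with \<open>pideal p q (a + r) \<subseteq> carrier (pgroup p q a)\<close> have "(- x) mod P ^ q \<in> carrier (pgroup p q a)" by blast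
    ultimately have "inv\<^bsub>pgroup p q a\<^esub> x = (- x) mod P ^ q"
      by (intro inv_equality) (simp_all add: pgroup_simps mod_simps)
    with m show "inv\<^bsub>pgroup p q a\<^esub> x \<in> pideal p q (a + r)" by simp
    fix y assume "y \<in> pideal p q (a + r)"
    with x have "P ^ (a + r) dvd (x + y) mod P ^ q" using P a by (simp add: pideal_eq dvd_mod)
    thus "x \<otimes>\<^bsub>pgroup p q a\<^esub> y \<in> pideal p q (a + r)" using a P_pow_pos by (simp add: pgroup_simps pideal_eq)
  qed
  thus ?thesis by (rule subgroup_imp_normal)
qed

lemma group_resid_grp: "group (resid_grp p r q a)"
  unfolding resid_grp_def by (rule normal.factorgroup_is_group[OF normal_pideal])

lemma carrier_resid_grp: "carrier (resid_grp p r q a) = resid_class p r q a ` pideal p q a"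
  by (auto simp: resid_grp_def FactGroup_def RCOSETS_def resid_class_def pgroup_simps)

lemma resid_class_mult:
  assumes "c \<in> pideal p q a" "d \<in> pideal p q a"
  shows "resid_class p r q a c \<otimes>\<^bsub>resid_grp p r q a\<^esub> resid_class p r q a d = resid_class p r q a ((c + d) mod P ^ q)"
  using normal.rcos_sum[OF normal_pideal, of c d] assms
  by (simp add: resid_grp_def FactGroup_def resid_class_def pgroup_simps)

lemma scaled_mem: "(P ^ a * x) mod P ^ q \<in> pideal p q a"
  using a P_pow_pos by (simp add: pideal_eq dvd_mod le_imp_power_dvd)

text \<open>Taking all integers as arguments serves two purposes: as an epimorphism from Z it shows
  that the residual group is cyclic, and on residues modulo \<open>P ^ r\<close> it is the
  isomorphism that provides coordinates.\<close>

definition scaled_class :: "int \<Rightarrow> int set" where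
  "scaled_class x = resid_class p r q a (P ^ a * x mod P ^ q)"

lemma scaled_class_eq_iff: "scaled_class x = scaled_class y \<longleftrightarrow> [x = y] (mod P ^ r)"
proof -
  have "scaled_class x = scaled_class y \<longleftrightarrow> [P ^ a * x = P ^ a * y] (mod P ^ (r + a))"
    unfolding scaled_class_def resid_class_eq_iff[OF scaled_mem] cong_def
    using a by (simp add: mod_power_mod add.commute)
  thus ?thesis by (simp only: cong_mult_P_power_iff)
qed

lemma scaled_class_mult:
  "scaled_class (x + y) = scaled_class x \<otimes>\<^bsub>resid_grp p r q a\<^esub> scaled_class y"
  unfolding scaled_class_def resid_class_mult[OF scaled_mem scaled_mem] by (simp add: mod_simps distrib_left)

lemma scaled_class_surj: "range scaled_class = carrier (resid_grp p r q a)"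
proof (intro equalityI subsetI)
  fix K assume "K \<in> range scaled_class"
  thus "K \<in> carrier (resid_grp p r q a)" using scaled_mem by (auto simp: scaled_class_def carrier_resid_grp)
next
  fix K assume "K \<in> carrier (resid_grp p r q a)"
  then obtain c where c: "c \<in> pideal p q a" "K = resid_class p r q a c" by (auto simp: carrier_resid_grp)
  then obtain k where "c = P ^ a * k" using a by (auto simp: pideal_eq)
  with c have "K = scaled_class k" using a by (auto simp: scaled_class_def pideal_eq)
  thus "K \<in> range scaled_class" by blast
qed

lemma scaled_class_iso: "scaled_class \<in> iso (add_monoid (R p r)) (resid_grp p r q a)"
proof -
  have car: "carrier (add_monoid (R p r)) = {0..<P ^ r}" by (auto simp: residue_ring_def)
  have reduce: "scaled_class (x mod P ^ r) = scaled_class x" for x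
    unfolding scaled_class_eq_iff by (simp add: cong_def)
  have "scaled_class \<in> hom (add_monoid (R p r)) (resid_grp p r q a)"
    unfolding hom_def using scaled_class_surj
    by (auto simp: residue_ring_def reduce scaled_class_mult)
  moreover have "inj_on scaled_class {0..<P ^ r}"
    by (rule inj_onI) (simp add: scaled_class_eq_iff cong_def)
  moreover have "scaled_class ` {0..<P ^ r} = range scaled_class"
  proof (intro equalityI subsetI)
    fix K assume "K \<in> range scaled_class"
    then obtain x where "K = scaled_class (x mod P ^ r)" by (auto simp: reduce)
    moreover have "x mod P ^ r \<in> {0..<P ^ r}" using P_pow_pos by simp
    ultimately show "K \<in> scaled_class ` {0..<P ^ r}" by blast
  qed auto
  ultimately show ?thesis unfolding iso_def bij_betw_def car scaled_class_surj by simp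
qed

lemma order_resid_grp: "Coset.order (resid_grp p r q a) = p ^ r"
proof -
  have "scaled_class \<in> iso (add_monoid (residue_ring (int (p ^ r)))) (resid_grp p r q a)"
    using scaled_class_iso by simp
  from iso_residue_group(1)[OF this pr_gt_1]
  have "bij_betw scaled_class {0..<P ^ r} (carrier (resid_grp p r q a))" by simp
  hence "card (carrier (resid_grp p r q a)) = card {0..<P ^ r}" by (simp only: bij_betw_same_card)
  thus ?thesis by (simp add: Coset.order_def nat_power_eq)
qed

lemma cyclic_resid_grp: "cyclic_group (resid_grp p r q a)"
proof (rule group.cyclic_group_epimorphic_image[OF group_integer_group _ cyclic_integer_group group_resid_grp])
  show "scaled_class \<in> epi integer_group (resid_grp p r q a)"
    unfolding epi_def hom_def using scaled_class_surj by (auto simp: scaled_class_mult)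
qed

lemma scaled_class_ppow: "resid_class p r q a (ppow p q a * x mod int p ^ q) = scaled_class x"
  by (simp add: scaled_class_def ppow_def mod_simps)

end

section \<open>The induced pairing\<close>

context
  fixes a b :: nat
  assumes r_less: "r < q" and ab: "a + b = q - r"
begin

lemma ar: "a + r \<le> q" and br: "b + r \<le> q" and abr: "a + b + r = q"
  using r_less ab by auto

text \<open>A change of representatives alters the product by dt - cs = (d - c)t + c(t - s). Both
  summands are divisible by \<open>P ^ (a + b + r)\<close>, which is \<open>P ^ q\<close> on a
  maximal window; so the image of a product of classes is a singleton.\<close>

lemma descB_resid_class:
  assumes c: "c \<in> pideal p q a" and s: "s \<in> pideal p q b"
  shows "descB p r q \<psi> (resid_class p r q a c) (resid_class p r q b s) = pairB p r q \<psi> c s"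
proof -
  have const: "pairB p r q \<psi> d t = pairB p r q \<psi> c s"
    if d: "d \<in> resid_class p r q a c" and t: "t \<in> resid_class p r q b s" for d t
  proof -
    have dt: "P ^ (a + r) dvd d - c" "P ^ (b + r) dvd t - s"
      using d t ar br by (auto simp: resid_class_eq cong_iff_dvd_diff)
    have "P ^ a dvd c" "P ^ b dvd s" using c s ar br by (auto simp: pideal_eq)
    moreover have "P ^ b dvd t - s" using dt(2) by (simp add: power_add dvd_mult_left)
    ultimately have "P ^ b dvd t" using dvd_add[of "P ^ b" "t - s" s] by simp
    have "P ^ (a + r) * P ^ b dvd (d - c) * t" by (rule mult_dvd_mono[OF dt(1) \<open>P ^ b dvd t\<close>])
    moreover have "P ^ a * P ^ (b + r) dvd c * (t - s)" by (rule mult_dvd_mono[OF \<open>P ^ a dvd c\<close> dt(2)])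
    moreover have "P ^ (a + r) * P ^ b = P ^ q" "P ^ a * P ^ (b + r) = P ^ q"
      using abr by (simp_all add: power_add[symmetric] add_ac)
    ultimately have "P ^ q dvd (d - c) * t + c * (t - s)" by (intro dvd_add) simp_all
    hence "[d * t = c * s] (mod P ^ q)" by (simp add: cong_iff_dvd_diff algebra_simps)
    thus ?thesis by (simp add: pairB_chi chi_eq_iff)
  qed
  have mem: "(c, s) \<in> resid_class p r q a c \<times> resid_class p r q b s"
    using c s ar br by (simp add: resid_class_eq pideal_eq)
  have "(\<lambda>(c, s). pairB p r q \<psi> c s) ` (resid_class p r q a c \<times> resid_class p r q b s) = {pairB p r q \<psi> c s}"
  proof (intro equalityI subsetI)
    fix v assume "v \<in> (\<lambda>(c, s). pairB p r q \<psi> c s) ` (resid_class p r q a c \<times> resid_class p r q b s)"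
    then obtain d t where "d \<in> resid_class p r q a c" "t \<in> resid_class p r q b s" "v = pairB p r q \<psi> d t"
      by (auto elim!: imageE)
    thus "v \<in> {pairB p r q \<psi> c s}" using const by simp
  next
    fix v assume "v \<in> {pairB p r q \<psi> c s}"
    thus "v \<in> (\<lambda>(c, s). pairB p r q \<psi> c s) ` (resid_class p r q a c \<times> resid_class p r q b s)"
      using mem by (intro image_eqI[of _ _ "(c, s)"]) simp_all
  qed
  thus ?thesis by (simp add: descB_def)
qed

text \<open>The product has depth \<open>d = q - r\<close>, and \<open>q \<le> r + 2 * d\<close>
  because \<open>r < q\<close>; thus the logarithm is linear here, and a root of unity of order
  dividing \<open>p ^ r\<close> remains.\<close>

lemma chi_scaled: "chi ((P ^ a * x) * (P ^ b * y)) = expi (conductor_unit p r q \<psi> * x * y) (p ^ r)"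
proof -
  have e: "(P ^ a * x) * (P ^ b * y) = P ^ (q - r) * (x * y)"
    unfolding ab[symmetric] power_add by (simp only: mult_ac)
  have "chi (P ^ (q - r) * (x * y)) = expi (conductor_unit p r q \<psi> * (x * y)) (p ^ (q - (q - r)))"
    using r_less by (intro chi_conductor_unit) auto
  thus ?thesis unfolding e using r_less by (simp add: mult.assoc)
qed

lemma descB_scaled:
  "descB p r q \<psi> (scaled_class a x) (scaled_class b y) = expi (conductor_unit p r q \<psi> * x * y) (p ^ r)"
proof -
  have "descB p r q \<psi> (scaled_class a x) (scaled_class b y) = chi ((P ^ a * x mod P ^ q) * (P ^ b * y mod P ^ q))"
    unfolding scaled_class_def[OF ar] scaled_class_def[OF br]
    by (simp only: descB_resid_class[OF scaled_mem[OF ar] scaled_mem[OF br]] pairB_chi)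
  also have "\<dots> = chi ((P ^ a * x) * (P ^ b * y))" unfolding chi_eq_iff by (simp add: cong_def mod_simps)
  finally show ?thesis by (simp only: chi_scaled)
qed

lemma perfect_pairing_descB: "perfect_pairing (p ^ r) (resid_grp p r q a) (resid_grp p r q b) (descB p r q \<psi>)"
proof (rule perfect_pairing_cyclic[OF pr_gt_1])
  show "coprime (conductor_unit p r q \<psi>) (int (p ^ r))" using coprime_conductor_unit by simp
  show "scaled_class a \<in> iso (add_monoid (residue_ring (int (p ^ r)))) (resid_grp p r q a)"
    using scaled_class_iso[OF ar] by simp
  show "scaled_class b \<in> iso (add_monoid (residue_ring (int (p ^ r)))) (resid_grp p r q b)"
    using scaled_class_iso[OF br] by simp
qed (rule descB_scaled)

lemma bicharacter_pair_descB: "bicharacter_pair (resid_grp p r q a) (resid_grp p r q b) (p ^ r) (descB p r q \<psi>)"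
proof -
  interpret G: group "resid_grp p r q a" by (rule group_resid_grp[OF ar])
  interpret H: group "resid_grp p r q b" by (rule group_resid_grp[OF br])
  show ?thesis
    using perfect_pairing_descB p_prime by unfold_locales (auto simp: perfect_pairing_def prime_gt_0_nat)
qed

lemma order_heisenberg_descB:
  "Coset.order (heisenberg (p ^ r) (resid_grp p r q a) (resid_grp p r q b) (descB p r q \<psi>)) = p ^ (3 * r)"
proof -
  have "3 * r = r + (r + r)" by simp
  hence "p ^ (3 * r) = p ^ r * (p ^ r * p ^ r)" by (simp only: power_add)
  thus ?thesis
    using bicharacter_pair.order_heisenberg[OF bicharacter_pair_descB]
    by (simp only: order_resid_grp[OF ar] order_resid_grp[OF br])
qed

end

end

theorem theorem5p1:
  fixes p r q \<alpha> \<beta> :: nat and \<psi> :: "(nat \<Rightarrow> int) set \<Rightarrow> complex"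
  assumes "normalization_semidom_class.prime p" "odd p" "r \<ge> 1" "q \<ge> 1" "\<alpha> \<le> q" "\<beta> \<le> q"
    and "faithful_character p r q \<psi>"
  shows
    "((\<forall>c \<in> pideal p q \<alpha>. \<forall>s \<in> pideal p q \<beta>. is_scalar p q (can_comm p r q \<psi> c s))
        \<longleftrightarrow> r + \<alpha> + \<beta> \<ge> q)
   \<and> (scalar_window p r q \<psi> (window p q \<alpha> \<beta>) \<longrightarrow>
        bicharacter (pgroup p q \<alpha>) (pgroup p q \<beta>) (pairB p r q \<psi>)
      \<and> RadA p r q \<psi> \<alpha> \<beta> = pideal p q (max \<alpha> (q - \<beta>))
      \<and> RadB p r q \<psi> \<alpha> \<beta> = pideal p q (max \<beta> (q - \<alpha>)))
   \<and> (q \<le> r \<longrightarrow> scalar_window p r q \<psi> (window p q 0 0))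
   \<and> (q > r \<longrightarrow>
        {W. maximal_scalar_window p r q \<psi> W} = {window p q a b |a b. a + b = q - r}
      \<and> (\<forall>a\<le>q. \<forall>b\<le>q. maximal_scalar_window p r q \<psi> (window p q a b) \<longleftrightarrow> a + b = q - r)
      \<and> card {W. maximal_scalar_window p r q \<psi> W} = q - r + 1)
   \<and> (q > r \<and> \<alpha> + \<beta> = q - r \<longrightarrow>
        (RadA p r q \<psi> \<alpha> \<beta> = pideal p q (\<alpha> + r)
       \<and> RadB p r q \<psi> \<alpha> \<beta> = pideal p q (\<beta> + r)
       \<and> Group.group (resid_grp p r q \<alpha>) \<and> Elementary_Groups.cyclic_group (resid_grp p r q \<alpha>)
       \<and> Coset.order (resid_grp p r q \<alpha>) = p ^ r
       \<and> Group.group (resid_grp p r q \<beta>) \<and> Elementary_Groups.cyclic_group (resid_grp p r q \<beta>)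
       \<and> Coset.order (resid_grp p r q \<beta>) = p ^ r)
      \<and> (is_conductor_unit p r q \<psi> (conductor_unit p r q \<psi>)
       \<and> (\<forall>x \<in> carrier (R p q). \<forall>y \<in> carrier (R p q).
            pairB p r q \<psi> (ppow p q \<alpha> \<otimes>\<^bsub>R p q\<^esub> x) (ppow p q \<beta> \<otimes>\<^bsub>R p q\<^esub> y)
              = expi (conductor_unit p r q \<psi> * x * y) (p ^ r)))
      \<and> ((\<forall>c \<in> pideal p q \<alpha>. \<forall>s \<in> pideal p q \<beta>.
            descB p r q \<psi> (resid_class p r q \<alpha> c) (resid_class p r q \<beta> s) = pairB p r q \<psi> c s)
       \<and> perfect_pairing (p ^ r) (resid_grp p r q \<alpha>) (resid_grp p r q \<beta>) (descB p r q \<psi>)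
       \<and> (\<lambda>x. resid_class p r q \<alpha> (ppow p q \<alpha> * x mod int p ^ q))
            \<in> Group.iso (add_monoid (R p r)) (resid_grp p r q \<alpha>)
       \<and> (\<lambda>y. resid_class p r q \<beta> (ppow p q \<beta> * y mod int p ^ q))
            \<in> Group.iso (add_monoid (R p r)) (resid_grp p r q \<beta>)
       \<and> (\<forall>x \<in> carrier (R p r). \<forall>y \<in> carrier (R p r).
            descB p r q \<psi> (resid_class p r q \<alpha> (ppow p q \<alpha> * x mod int p ^ q))
                          (resid_class p r q \<beta> (ppow p q \<beta> * y mod int p ^ q))
              = std_pairing (p ^ r) (conductor_unit p r q \<psi> * x) y))
      \<and> (central_extension (mu (p ^ r))
            (heisenberg (p ^ r) (resid_grp p r q \<alpha>) (resid_grp p r q \<beta>) (descB p r q \<psi>))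
            (resid_grp p r q \<alpha> \<times>\<times> resid_grp p r q \<beta>)
            (heis_incl (resid_grp p r q \<alpha>) (resid_grp p r q \<beta>)) snd
       \<and> Coset.order (heisenberg (p ^ r) (resid_grp p r q \<alpha>) (resid_grp p r q \<beta>) (descB p r q \<psi>))
            = p ^ (3 * r)
       \<and> (\<forall>u \<in> carrier (heisenberg (p ^ r) (resid_grp p r q \<alpha>) (resid_grp p r q \<beta>) (descB p r q \<psi>)).
          \<forall>v \<in> carrier (heisenberg (p ^ r) (resid_grp p r q \<alpha>) (resid_grp p r q \<beta>) (descB p r q \<psi>)).
          \<forall>x \<in> carrier (resid_grp p r q \<alpha>). \<forall>y \<in> carrier (resid_grp p r q \<beta>).
            snd u = (x, \<one>\<^bsub>resid_grp p r q \<beta>\<^esub>) \<and> snd v = (\<one>\<^bsub>resid_grp p r q \<alpha>\<^esub>, y) \<longrightarrow>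
              grp_comm (heisenberg (p ^ r) (resid_grp p r q \<alpha>) (resid_grp p r q \<beta>) (descB p r q \<psi>)) u v
                = heis_incl (resid_grp p r q \<alpha>) (resid_grp p r q \<beta>) (descB p r q \<psi> x y))))"
proof -
  interpret faithful_char p r q \<psi>
    using assms by unfold_locales auto
  show ?thesis
  proof (intro conjI impI, goal_cases)
    case 1
    show ?case using commutators_scalar_iff[OF assms(5,6)] by simp
  next
    case 2
    hence "\<forall>c \<in> pideal p q \<alpha>. \<forall>s \<in> pideal p q \<beta>. is_scalar p q (can_comm p r q \<psi> c s)"
      by (auto simp: scalar_window_def window_def)
    hence "q \<le> r + \<alpha> + \<beta>" using commutators_scalar_iff[OF assms(5,6)] by simp
    thus ?case by (rule bicharacter_pairB[OF assms(5,6)])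
  next
    case 3 show ?case by (rule RadA_eq[OF assms(5,6)])
  next
    case 4 show ?case by (rule RadB_eq[OF assms(5,6)])
  next
    case 5 thus ?case unfolding scalar_window_iff by auto
  next
    case 6 thus ?case by (auto simp: maximal_scalar_window_iff)
  next
    case 7
    show ?case
    proof (intro allI impI)
      fix a b assume "a \<le> q" "b \<le> q"
      thus "maximal_scalar_window p r q \<psi> (window p q a b) \<longleftrightarrow> a + b = q - r"
        unfolding maximal_scalar_window_iff[OF 7] by (auto simp: window_eq_iff)
    qed
  next
    case 8 thus ?case by (rule card_maximal_scalar_windows)
  next
    case 9
    hence "max \<alpha> (q - \<beta>) = \<alpha> + r" by auto
    thus ?case by (simp add: RadA_eq[OF assms(5,6)])
  next
    case 10
    hence "max \<beta> (q - \<alpha>) = \<beta> + r" by auto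
    thus ?case by (simp add: RadB_eq[OF assms(5,6)])
  next
    case 11 thus ?case by (intro group_resid_grp) auto
  next
    case 12 thus ?case by (intro cyclic_resid_grp) auto
  next
    case 13 thus ?case by (intro order_resid_grp) auto
  next
    case 14 thus ?case by (intro group_resid_grp) auto
  next
    case 15 thus ?case by (intro cyclic_resid_grp) auto
  next
    case 16 thus ?case by (intro order_resid_grp) auto
  next
    case 17 show ?case by (rule conductor_unit)
  next
    case 18
    hence rq: "r < q" "\<alpha> + \<beta> = q - r" by auto
    show ?case
    proof (intro ballI)
      fix x y
      have "pairB p r q \<psi> (ppow p q \<alpha> \<otimes>\<^bsub>R p q\<^esub> x) (ppow p q \<beta> \<otimes>\<^bsub>R p q\<^esub> y) = chi ((P ^ \<alpha> * x) * (P ^ \<beta> * y))"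
        unfolding pairB_chi chi_eq_iff by (simp add: R_ops ppow_def cong_def mod_simps)
      thus "pairB p r q \<psi> (ppow p q \<alpha> \<otimes>\<^bsub>R p q\<^esub> x) (ppow p q \<beta> \<otimes>\<^bsub>R p q\<^esub> y)
          = expi (conductor_unit p r q \<psi> * x * y) (p ^ r)"
        by (simp only: chi_scaled[OF rq])
    qed
  next
    case 19 thus ?case by (auto intro: descB_resid_class)
  next
    case 20 thus ?case by (auto intro: perfect_pairing_descB)
  next
    case 21
    hence "\<alpha> + r \<le> q" by auto
    thus ?case by (simp only: scaled_class_ppow scaled_class_iso)
  next
    case 22
    hence "\<beta> + r \<le> q" by auto
    thus ?case by (simp only: scaled_class_ppow scaled_class_iso)
  next
    case 23
    hence rq: "r < q" "\<alpha> + \<beta> = q - r" and le: "\<alpha> + r \<le> q" "\<beta> + r \<le> q" by auto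
    show ?case
      by (simp add: scaled_class_ppow[OF le(1)] scaled_class_ppow[OF le(2)] descB_scaled[OF rq] std_pairing_def)
  next
    case 24
    thus ?case by (intro bicharacter_pair.heisenberg_central_extension bicharacter_pair_descB) auto
  next
    case 25 thus ?case by (intro order_heisenberg_descB) auto
  next
    case 26
    hence "bicharacter_pair (resid_grp p r q \<alpha>) (resid_grp p r q \<beta>) (p ^ r) (descB p r q \<psi>)"
      by (intro bicharacter_pair_descB) auto
    thus ?case by (auto intro: bicharacter_pair.heisenberg_commutator)
  qed
qed

end
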